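(* Let $(R,\mathfrak m,k)$ be a noetherian local ring (or a standard graded $k$-algebra). Let $0\to M\xrightarrow{\phi} P\xrightarrow{\lambda} N\to 0$ be a short exact sequence of non-zero finitely generated $R$-modules (graded, with degree-preserving maps, in the graded case), where $M$ is identified with a submodule of $P$ via $\phi$. Assume that (i) $P$ is a Koszul module; (ii) $M\subseteq \mathfrak m P$. Then $\operatorname{ld}_R N-1\le \operatorname{ld}_R M\le \max\{0,\operatorname{ld}_R N-1\}$. In particular, $\operatorname{ld}_R N=\operatorname{ld}_R M+1$ if $\operatorname{ld}_R M\ge 1$, and $\operatorname{ld}_R N\le 1$ if $\operatorname{ld}_R M=0$. Furthermore, $\operatorname{ld}_R N=0$ if and only if $M$ is a Koszul module and $M\cap \mathfrak m^{s+1}P=\mathfrak m^sM$ for all $s\ge 0$.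
   Context: $(R,\mathfrak m,k)$ denotes a commutative noetherian local ring with maximal ideal $\mathfrak m$ and residue field $k=R/\mathfrak m$; statements are also meant to cover, with the obvious changes, the graded situation where $R$ is a standard graded $k$-algebra with graded maximal ideal $\mathfrak m$ and modules are graded. Linearity defect: for a finitely generated $R$-module $M$ with minimal free resolution $F$, filter $F$ by the subcomplexes $\mathcal G^nF$ with $(\mathcal G^nF)_i=\mathfrak m^{n-i}F_i$ (where $\mathfrak m^j=R$ for $j\le 0$), with differential induced by that of $F$. The associated graded complex of this filtration is the linear part $\operatorname{lin}^R F$. The linearity defect is $\operatorname{ld}_R M=\sup\{i: H_i(\operatorname{lin}^R F)\ne 0\}\in\{0,1,\dots\}\cup\{\infty\}$ for $M\neq 0$, and $\operatorname{ld}_R 0=0$. $M$ is called a Koszul module if $\operatorname{ld}_R M=0$. *)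

theory Defs
  imports "HOL-Algebra.Algebra" "HOL-Library.Extended_Real"
begin

section \<open>Modules\<close>

definition module_hom ::
  "('a, 'r) ring_scheme \<Rightarrow> ('a, 'b, 'x) module_scheme \<Rightarrow> ('a, 'c, 'y) module_scheme \<Rightarrow> ('b \<Rightarrow> 'c) set"
  where "module_hom R M N =
    {f \<in> hom (add_monoid M) (add_monoid N).
       \<forall>a\<in>carrier R. \<forall>x\<in>carrier M. f (a \<odot>\<^bsub>M\<^esub> x) = a \<odot>\<^bsub>N\<^esub> f x}"

definition finitely_generated :: "('a, 'r) ring_scheme \<Rightarrow> ('a, 'b, 'x) module_scheme \<Rightarrow> bool"
  where "finitely_generated R M \<longleftrightarrow>
    (\<exists>S. finite S \<and> S \<subseteq> carrier M \<and>
         (\<forall>H. submodule H R M \<longrightarrow> S \<subseteq> H \<longrightarrow> H = carrier M))"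

definition nonzero_module :: "('a, 'b, 'x) module_scheme \<Rightarrow> bool"
  where "nonzero_module M \<longleftrightarrow> carrier M \<noteq> {\<zero>\<^bsub>M\<^esub>}"

definition short_exact ::
  "('a, 'r) ring_scheme \<Rightarrow> ('a, 'b, 'x) module_scheme \<Rightarrow> ('a, 'c, 'y) module_scheme \<Rightarrow>
   ('a, 'd, 'z) module_scheme \<Rightarrow> ('b \<Rightarrow> 'c) \<Rightarrow> ('c \<Rightarrow> 'd) \<Rightarrow> bool"
  where "short_exact R M P N f g \<longleftrightarrow>
    f \<in> module_hom R M P \<and> g \<in> module_hom R P N \<and>
    inj_on f (carrier M) \<and> f ` carrier M = a_kernel P N g \<and> g ` carrier P = carrier N"

definition is_basis :: "('a, 'r) ring_scheme \<Rightarrow> ('a, 'b, 'x) module_scheme \<Rightarrow> 'b set \<Rightarrow> bool"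
  where "is_basis R M B \<longleftrightarrow>
    finite B \<and> B \<subseteq> carrier M \<and>
    (\<forall>x\<in>carrier M. \<exists>!c. c \<in> B \<rightarrow>\<^sub>E carrier R \<and> x = (\<Oplus>\<^bsub>M\<^esub>b\<in>B. c b \<odot>\<^bsub>M\<^esub> b))"

text \<open>The submodule \<open>I N\<close> of \<open>M\<close>, for an ideal \<open>I\<close> and a submodule \<open>N\<close>; cf. \<^const>\<open>ideal_prod\<close>.
  Powers of an ideal are formed in the monoid \<^term>\<open>ideals_set R\<close>, so the zeroth power is the whole ring.\<close>

inductive_set ideal_smult :: "('a, 'b, 'x) module_scheme \<Rightarrow> 'a set \<Rightarrow> 'b set \<Rightarrow> 'b set"
  for M and I and N where
    smult: "a \<in> I \<Longrightarrow> x \<in> N \<Longrightarrow> a \<odot>\<^bsub>M\<^esub> x \<in> ideal_smult M I N"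
  | sum: "x \<in> ideal_smult M I N \<Longrightarrow> y \<in> ideal_smult M I N \<Longrightarrow> x \<oplus>\<^bsub>M\<^esub> y \<in> ideal_smult M I N"

abbreviation ideal_power :: "('a, 'r) ring_scheme \<Rightarrow> 'a set \<Rightarrow> nat \<Rightarrow> 'a set"
  where "ideal_power R I n \<equiv> I [^]\<^bsub>ideals_set R\<^esub> n"

text \<open>The multiplicative fields of the records built below play no role for modules.\<close>

definition quotient_module :: "('a, 'b, 'x) module_scheme \<Rightarrow> 'b set \<Rightarrow> ('a, 'b set) module"
  where "quotient_module M H =
    \<lparr>carrier = a_rcosets\<^bsub>M\<^esub> H, monoid.mult = undefined, one = undefined,
     ring.zero = H, ring.add = set_add M,
     smult = (\<lambda>a A. \<Union>x\<in>A. H +>\<^bsub>M\<^esub> (a \<odot>\<^bsub>M\<^esub> x))\<rparr>"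

definition direct_sum_module :: "('i \<Rightarrow> ('a, 'b, 'x) module_scheme) \<Rightarrow> ('a, 'i \<Rightarrow> 'b) module"
  where "direct_sum_module A =
    \<lparr>carrier = {u. (\<forall>n. u n \<in> carrier (A n)) \<and> finite {n. u n \<noteq> \<zero>\<^bsub>A n\<^esub>}},
     monoid.mult = undefined, one = undefined,
     ring.zero = (\<lambda>n. \<zero>\<^bsub>A n\<^esub>), ring.add = (\<lambda>u v n. u n \<oplus>\<^bsub>A n\<^esub> v n),
     smult = (\<lambda>a u n. a \<odot>\<^bsub>A n\<^esub> u n)\<rparr>"


section \<open>Homology and the linear part\<close>

text \<open>A complex \<open>\<dots> \<rightarrow> C 2 \<rightarrow> C 1 \<rightarrow> C 0 \<rightarrow> 0\<close> is given by its modules \<open>C i\<close> and its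
  differentials \<open>d i : C (Suc i) \<rightarrow> C i\<close>.\<close>

definition cycles :: "(nat \<Rightarrow> ('a, 'b, 'x) module_scheme) \<Rightarrow> (nat \<Rightarrow> 'b \<Rightarrow> 'b) \<Rightarrow> nat \<Rightarrow> 'b set"
  where "cycles C d i =
    (case i of 0 \<Rightarrow> carrier (C 0) | Suc j \<Rightarrow> a_kernel (C (Suc j)) (C j) (d j))"

definition boundaries :: "(nat \<Rightarrow> ('a, 'b, 'x) module_scheme) \<Rightarrow> (nat \<Rightarrow> 'b \<Rightarrow> 'b) \<Rightarrow> nat \<Rightarrow> 'b set"
  where "boundaries C d i = d i ` carrier (C (Suc i))"

definition homology ::
  "(nat \<Rightarrow> ('a, 'b, 'x) module_scheme) \<Rightarrow> (nat \<Rightarrow> 'b \<Rightarrow> 'b) \<Rightarrow> nat \<Rightarrow> ('a, 'b set) module"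
  where "homology C d i = quotient_module ((C i)\<lparr>carrier := cycles C d i\<rparr>) (boundaries C d i)"

text \<open>\<open>filt R m F n i\<close> is \<open>m\<^sup>n\<^sup>-\<^sup>i F i\<close>; truncated subtraction implements the convention
  that nonpositive powers of \<open>m\<close> are the ring. For the same reason the pieces of the associated graded
  complex in negative filtration degree vanish, and it suffices to let \<open>n\<close> range over \<^typ>\<open>nat\<close>.\<close>

definition filt ::
  "('a, 'r) ring_scheme \<Rightarrow> 'a set \<Rightarrow> (nat \<Rightarrow> ('a, 'b, 'x) module_scheme) \<Rightarrow> nat \<Rightarrow> nat \<Rightarrow> 'b set"
  where "filt R m F n i = ideal_smult (F i) (ideal_power R m (n - i)) (carrier (F i))"

definition gr_piece ::
  "('a, 'r) ring_scheme \<Rightarrow> 'a set \<Rightarrow> (nat \<Rightarrow> ('a, 'b, 'x) module_scheme) \<Rightarrow> nat \<Rightarrow> nat \<Rightarrow>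
   ('a, 'b set) module"
  where "gr_piece R m F i n =
    quotient_module ((F i)\<lparr>carrier := filt R m F n i\<rparr>) (filt R m F (Suc n) i)"

definition lin ::
  "('a, 'r) ring_scheme \<Rightarrow> 'a set \<Rightarrow> (nat \<Rightarrow> ('a, 'b, 'x) module_scheme) \<Rightarrow> nat \<Rightarrow>
   ('a, nat \<Rightarrow> 'b set) module"
  where "lin R m F i = direct_sum_module (gr_piece R m F i)"

definition lin_diff ::
  "('a, 'r) ring_scheme \<Rightarrow> 'a set \<Rightarrow> (nat \<Rightarrow> ('a, 'b, 'x) module_scheme) \<Rightarrow> (nat \<Rightarrow> 'b \<Rightarrow> 'b) \<Rightarrow>
   nat \<Rightarrow> (nat \<Rightarrow> 'b set) \<Rightarrow> (nat \<Rightarrow> 'b set)"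
  where "lin_diff R m F d i u = (\<lambda>n. \<Union>x\<in>u n. filt R m F (Suc n) i +>\<^bsub>F i\<^esub> d i x)"

definition lin_defect ::
  "('a, 'r) ring_scheme \<Rightarrow> 'a set \<Rightarrow> (nat \<Rightarrow> ('a, 'b, 'x) module_scheme) \<Rightarrow> (nat \<Rightarrow> 'b \<Rightarrow> 'b) \<Rightarrow> enat"
  where "lin_defect R m F d =
    Sup {enat i | i. nonzero_module (homology (lin R m F) (lin_diff R m F d) i)}"


section \<open>The local case\<close>

locale noetherian_local_ring = cring R + noetherian_ring R + maximalideal m R
  for R :: "('a, 'r) ring_scheme" (structure) and m :: "'a set" +
  assumes unique_maximal: "maximalideal I R \<Longrightarrow> I = m"

locale minimal_free_resolution =
  fixes R :: "('a, 'r) ring_scheme" and m :: "'a set" and M :: "('a, 'b, 'x) module_scheme"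
    and F :: "nat \<Rightarrow> ('a, 'f, 'y) module_scheme" and d :: "nat \<Rightarrow> 'f \<Rightarrow> 'f" and e :: "'f \<Rightarrow> 'b"
  assumes modules: "module R (F i)"
    and free: "\<exists>B. is_basis R (F i) B"
    and diff_hom: "d i \<in> module_hom R (F (Suc i)) (F i)"
    and augmentation_hom: "e \<in> module_hom R (F 0) M"
    and augmentation_surj: "e ` carrier (F 0) = carrier M"
    and exact_0: "d 0 ` carrier (F (Suc 0)) = a_kernel (F 0) M e"
    and exact_Suc: "d (Suc i) ` carrier (F (Suc (Suc i))) = a_kernel (F (Suc i)) (F i) (d i)"
    and minimal: "d i ` carrier (F (Suc i)) \<subseteq> ideal_smult (F i) m (carrier (F i))"

text \<open>The linearity defect is computed from some minimal free resolution, these being unique up to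
  isomorphism. Every free module of finite rank is isomorphic to one carried by the
  type \<^typ>\<open>nat \<Rightarrow> 'a\<close>, with \<^typ>\<open>'a\<close> the type of ring elements, so that there is
  no loss in choosing the resolution there.\<close>

definition ld :: "('a, 'r) ring_scheme \<Rightarrow> 'a set \<Rightarrow> ('a, 'b, 'x) module_scheme \<Rightarrow> enat"
  where "ld R m M =
    (if nonzero_module M then
       (let (F, d) = (SOME (F :: nat \<Rightarrow> ('a, nat \<Rightarrow> 'a) module, d).
                        \<exists>e. minimal_free_resolution R m M F d e)
        in lin_defect R m F d)
     else 0)"

definition koszul :: "('a, 'r) ring_scheme \<Rightarrow> 'a set \<Rightarrow> ('a, 'b, 'x) module_scheme \<Rightarrow> bool"
  where "koszul R m M \<longleftrightarrow> ld R m M = 0"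


section \<open>The graded case\<close>

definition decomposition :: "('b, 'x) ring_scheme \<Rightarrow> ('i \<Rightarrow> 'b set) \<Rightarrow> bool"
  where "decomposition M G \<longleftrightarrow>
    (\<forall>i. subgroup (G i) (add_monoid M)) \<and>
    (\<forall>x\<in>carrier M. \<exists>!f. (\<forall>i. f i \<in> G i) \<and> finite {i. f i \<noteq> \<zero>\<^bsub>M\<^esub>} \<and>
       x = (\<Oplus>\<^bsub>M\<^esub>i\<in>{i. f i \<noteq> \<zero>\<^bsub>M\<^esub>}. f i))"

text \<open>The base field \<open>k\<close> is the component \<open>Rg 0\<close>.\<close>

locale standard_graded_algebra = cring R
  for R :: "('a, 'r) ring_scheme" (structure) +
  fixes Rg :: "nat \<Rightarrow> 'a set"
  assumes decomp: "decomposition R Rg"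
    and graded_mult: "a \<in> Rg i \<Longrightarrow> b \<in> Rg j \<Longrightarrow> a \<otimes> b \<in> Rg (i + j)"
    and base_field: "subfield (Rg 0) R"
    and standard: "\<exists>S. finite S \<and> S \<subseteq> Rg 1 \<and> generate_ring R (Rg 0 \<union> S) = carrier R"

definition irrelevant_ideal :: "('a, 'r) ring_scheme \<Rightarrow> (nat \<Rightarrow> 'a set) \<Rightarrow> 'a set"
  where "irrelevant_ideal R Rg = Idl\<^bsub>R\<^esub> (\<Union>i\<in>{1..}. Rg i)"

locale graded_module = module R M
  for R :: "('a, 'r) ring_scheme" (structure) and Rg :: "nat \<Rightarrow> 'a set"
    and M :: "('a, 'b, 'x) module_scheme" (structure) and Mg :: "int \<Rightarrow> 'b set" +
  assumes decomp: "decomposition M Mg"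
    and graded_smult: "a \<in> Rg i \<Longrightarrow> x \<in> Mg j \<Longrightarrow> a \<odot>\<^bsub>M\<^esub> x \<in> Mg (int i + j)"

definition degree_preserving :: "(int \<Rightarrow> 'b set) \<Rightarrow> (int \<Rightarrow> 'c set) \<Rightarrow> ('b \<Rightarrow> 'c) \<Rightarrow> bool"
  where "degree_preserving G H f \<longleftrightarrow> (\<forall>j. f ` G j \<subseteq> H j)"

locale graded_minimal_free_resolution =
  minimal_free_resolution R "irrelevant_ideal R Rg" M F d e
  for R :: "('a, 'r) ring_scheme" and Rg :: "nat \<Rightarrow> 'a set"
    and M :: "('a, 'b, 'x) module_scheme" and Mg :: "int \<Rightarrow> 'b set"
    and F :: "nat \<Rightarrow> ('a, 'f, 'y) module_scheme" and Fg :: "nat \<Rightarrow> int \<Rightarrow> 'f set"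
    and d :: "nat \<Rightarrow> 'f \<Rightarrow> 'f" and e :: "'f \<Rightarrow> 'b" +
  assumes graded: "graded_module R Rg (F i) (Fg i)"
    and graded_free: "\<exists>B. is_basis R (F i) B \<and> B \<subseteq> (\<Union>j. Fg i j)"
    and diff_degree: "degree_preserving (Fg (Suc i)) (Fg i) (d i)"
    and augmentation_degree: "degree_preserving (Fg 0) Mg e"

definition graded_ld ::
  "('a, 'r) ring_scheme \<Rightarrow> (nat \<Rightarrow> 'a set) \<Rightarrow> ('a, 'b, 'x) module_scheme \<Rightarrow> (int \<Rightarrow> 'b set) \<Rightarrow> enat"
  where "graded_ld R Rg M Mg =
    (if nonzero_module M then
       (let (F, d) = (SOME (F :: nat \<Rightarrow> ('a, nat \<Rightarrow> 'a) module, d).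
                        \<exists>Fg e. graded_minimal_free_resolution R Rg M Mg F Fg d e)
        in lin_defect R (irrelevant_ideal R Rg) F d)
     else 0)"

definition graded_koszul ::
  "('a, 'r) ring_scheme \<Rightarrow> (nat \<Rightarrow> 'a set) \<Rightarrow> ('a, 'b, 'x) module_scheme \<Rightarrow> (int \<Rightarrow> 'b set) \<Rightarrow> bool"
  where "graded_koszul R Rg M Mg \<longleftrightarrow> graded_ld R Rg M Mg = 0"

end

theory Submission
  imports Defs
begin

text \<open>
  Let \<open>F\<close> and \<open>G\<close> be minimal free resolutions of \<open>M\<close> and \<open>P\<close>. The inclusion of \<open>M\<close> into \<open>m P\<close> can be lifted
  to a chain map \<open>\<phi>\<close> with values in \<open>m G\<close> (\<open>comparison_into_mG\<close>): in each degree the values to be lifted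
  are cycles in \<open>m\<^sup>2 G\<close>, and as \<open>P\<close> is Koszul, its differential is strict for the \<open>m\<close>-adic filtration
  (\<open>lin_exact_strict\<close>), so they are boundaries of elements of \<open>m G\<close>. Consequently the mapping cone \<open>W\<close>
  of \<open>\<phi>\<close> is a minimal free resolution of \<open>N\<close> (\<open>cone_resolution\<close>).

  Since \<open>\<phi>\<close> raises the filtration degree, there is a short exact sequence of complexes from
  \<open>lin G\<close> via \<open>lin W\<close> to \<open>lin F\<close> shifted by one. The homology of \<open>lin G\<close> vanishes in positive degrees.
  Hence \<open>lin W\<close> in degree \<open>i + 2\<close> and \<open>lin F\<close> in degree \<open>i + 1\<close> have the same homology
  (\<open>cone_lin_exact_Suc\<close>), which gives the inequalities. If moreover \<open>M\<close> is Koszul, then the homology of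
  \<open>lin W\<close> in degree \<open>1\<close> is the kernel of the map from \<open>gr M\<close> to \<open>gr P\<close> induced by the inclusion
  (\<open>cone_lin_exact_0\<close>), and the injectivity of this map is the condition on the filtrations.

  All this is carried out on elements: homology of the linear part in a positive degree vanishes
  if and only if \<open>lin_exact\<close> holds, and the linearity defect is determined by these
  predicates (\<open>lin_defect_le_iff\<close>). They do not depend on the minimal resolution, because the homotopies
  between the comparison maps raise the filtration degree (\<open>lin_exact_transfer\<close>). These arguments are
  the same for every ideal \<open>m\<close> of a nonzero commutative ring, so the local and the graded statement
  differ only in the existence of resolutions.

  For existence, a local ring is regarded as a graded ring concentrated in degree \<open>0\<close>.
  Covers by homogeneous generating sets of minimal cardinality have kernels in \<open>m F\<close>
  (\<open>minimal_generators_relation\<close>), and iterating them yields a minimal resolution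
  (\<open>graded_minimal_resolution_exists\<close>). The kernels are finitely generated because the ring is noetherian;
  for standard graded algebras this is Hilbert's basis theorem (\<open>noetherian_adjoined\<close>).
\<close>

section \<open>Module homomorphisms\<close>

lemma module_homI:
  assumes "\<And>x. x \<in> carrier M \<Longrightarrow> f x \<in> carrier N"
    and "\<And>x y. x \<in> carrier M \<Longrightarrow> y \<in> carrier M \<Longrightarrow> f (x \<oplus>\<^bsub>M\<^esub> y) = f x \<oplus>\<^bsub>N\<^esub> f y"
    and "\<And>a x. a \<in> carrier R \<Longrightarrow> x \<in> carrier M \<Longrightarrow> f (a \<odot>\<^bsub>M\<^esub> x) = a \<odot>\<^bsub>N\<^esub> f x"
  shows "f \<in> module_hom R M N"
  using assms by (auto simp: module_hom_def hom_def)

lemma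
  assumes "f \<in> module_hom R M N" and "x \<in> carrier M"
  shows module_hom_closed: "f x \<in> carrier N"
    and module_hom_add: "y \<in> carrier M \<Longrightarrow> f (x \<oplus>\<^bsub>M\<^esub> y) = f x \<oplus>\<^bsub>N\<^esub> f y"
    and module_hom_smult: "a \<in> carrier R \<Longrightarrow> f (a \<odot>\<^bsub>M\<^esub> x) = a \<odot>\<^bsub>N\<^esub> f x"
  using assms by (auto simp: module_hom_def hom_def)

lemma module_hom_group_hom:
  assumes "module R M" "module R N" "f \<in> module_hom R M N"
  shows "group_hom (add_monoid M) (add_monoid N) f"
proof -
  interpret M: module R M by fact
  interpret N: module R N by fact
  show ?thesis
    using assms(3) by (unfold_locales) (auto simp: module_hom_def)
qed

lemma
  assumes "module R M" "module R N" "f \<in> module_hom R M N"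
  shows module_hom_zero: "f \<zero>\<^bsub>M\<^esub> = \<zero>\<^bsub>N\<^esub>"
    and module_hom_neg: "x \<in> carrier M \<Longrightarrow> f (\<ominus>\<^bsub>M\<^esub> x) = \<ominus>\<^bsub>N\<^esub> f x"
  using group_hom.hom_one[OF module_hom_group_hom[OF assms]]
    group_hom.hom_inv[OF module_hom_group_hom[OF assms]] by (auto simp: a_inv_def)

lemma module_hom_minus:
  assumes "module R M" "module R N" "f \<in> module_hom R M N" "x \<in> carrier M" "y \<in> carrier M"
  shows "f (x \<ominus>\<^bsub>M\<^esub> y) = f x \<ominus>\<^bsub>N\<^esub> f y"
proof -
  interpret M: module R M by fact
  show ?thesis
    using assms by (simp add: a_minus_def module_hom_add module_hom_neg)
qed

lemma module_hom_finsum: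
  assumes "module R M" "module R N" and f: "f \<in> module_hom R M N"
    and g: "g \<in> I \<rightarrow> carrier M"
  shows "f (\<Oplus>\<^bsub>M\<^esub>i\<in>I. g i) = (\<Oplus>\<^bsub>N\<^esub>i\<in>I. f (g i))"
proof -
  interpret M: module R M by fact
  interpret N: module R N by fact
  show ?thesis
    using g
  proof (induction I rule: infinite_finite_induct)
    case (infinite A)
    then show ?case
      by (simp add: M.finsum_infinite N.finsum_infinite module_hom_zero[OF assms(1-3)])
  next
    case empty
    then show ?case by (simp add: module_hom_zero[OF assms(1-3)])
  next
    case (insert x A)
    then have "g \<in> A \<rightarrow> carrier M" "g x \<in> carrier M" by auto
    moreover from this have "(\<lambda>i. f (g i)) \<in> A \<rightarrow> carrier N" using module_hom_closed[OF f] by auto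
    moreover have "(\<Oplus>\<^bsub>M\<^esub>i\<in>A. g i) \<in> carrier M" using calculation by simp
    ultimately show ?case using insert
      by (simp add: module_hom_closed[OF f] module_hom_add[OF f])
  qed
qed

lemma module_hom_comp:
  assumes f: "f \<in> module_hom R M N" and g: "g \<in> module_hom R N P"
  shows "(\<lambda>x. g (f x)) \<in> module_hom R M P"
  by (intro module_homI) (simp_all add: module_hom_closed[OF f] module_hom_closed[OF g]
    module_hom_add[OF f] module_hom_add[OF g] module_hom_smult[OF f] module_hom_smult[OF g])

lemma module_hom_id: "(\<lambda>x. x) \<in> module_hom R M M"
  by (intro module_homI) auto

lemma module_hom_neg_fun:
  assumes "module R N" and f: "f \<in> module_hom R M N"
  shows "(\<lambda>x. \<ominus>\<^bsub>N\<^esub> f x) \<in> module_hom R M N"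
proof -
  interpret N: module R N by fact
  show ?thesis
    by (intro module_homI) (simp_all add: module_hom_closed[OF f] module_hom_add[OF f]
      module_hom_smult[OF f] N.minus_add N.smult_r_minus N.a_comm)
qed

lemma module_hom_add_fun:
  assumes "module R N" and f: "f \<in> module_hom R M N" and g: "g \<in> module_hom R M N"
  shows "(\<lambda>x. f x \<oplus>\<^bsub>N\<^esub> g x) \<in> module_hom R M N"
proof -
  interpret N: module R N by fact
  show ?thesis
    by (intro module_homI) (simp_all add: module_hom_closed[OF f] module_hom_closed[OF g]
      module_hom_add[OF f] module_hom_add[OF g] module_hom_smult[OF f] module_hom_smult[OF g] N.smult_r_distr N.a_ac)
qed

lemma module_hom_minus_fun:
  assumes "module R N" and f: "f \<in> module_hom R M N" and g: "g \<in> module_hom R M N"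
  shows "(\<lambda>x. f x \<ominus>\<^bsub>N\<^esub> g x) \<in> module_hom R M N"
  using module_hom_add_fun[OF assms(1) f module_hom_neg_fun[OF assms(1) g]]
  by (simp add: a_minus_def)

lemma module_hom_subset:
  assumes "f \<in> module_hom R M N" "S \<subseteq> carrier M"
  shows "f ` S \<subseteq> carrier N"
  using module_hom_closed[OF assms(1)] assms(2) by auto

lemma submodule_vimage:
  assumes "module R M" "module R N" and f: "f \<in> module_hom R M N" and "submodule H R N"
  shows "submodule {x \<in> carrier M. f x \<in> H} R M"
proof -
  interpret M: module R M by fact
  interpret N: module R N by fact
  note H = N.submoduleE[OF assms(4)]
  have "\<zero>\<^bsub>N\<^esub> \<in> H" using submodule.axioms(1)[OF assms(4)] by (auto dest: subgroup.one_closed)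
  then show ?thesis
    using H f module_hom_zero[OF assms(1-3)] module_hom_neg[OF assms(1-3)]
    by (intro M.submoduleI) (auto simp: module_hom_add[OF f] module_hom_smult[OF f])
qed

lemma (in module) submodule_zero: "submodule H R M \<Longrightarrow> \<zero>\<^bsub>M\<^esub> \<in> H"
  using subgroup.one_closed[OF submodule.axioms(1)] by fastforce

lemma (in module) submodule_minus:
  "submodule H R M \<Longrightarrow> x \<in> H \<Longrightarrow> y \<in> H \<Longrightarrow> x \<ominus>\<^bsub>M\<^esub> y \<in> H"
  using submoduleE[of H] by (simp add: a_minus_def)

lemma submodule_image:
  assumes "module R M" "module R N" and f: "f \<in> module_hom R M N" and H: "submodule H R M"
  shows "submodule (f ` H) R N"
proof -
  interpret M: module R M by fact
  interpret N: module R N by fact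
  note HE = M.submoduleE[OF H]
  show ?thesis
  proof (rule N.submoduleI)
    show "f ` H \<subseteq> carrier N" using HE(1) module_hom_closed[OF f] by auto
    show "\<zero>\<^bsub>N\<^esub> \<in> f ` H"
      using M.submodule_zero[OF H] module_hom_zero[OF assms(1-3)] by (metis imageI)
    show "\<ominus>\<^bsub>N\<^esub> a \<in> f ` H" if "a \<in> f ` H" for a
      using that HE(1,3) module_hom_neg[OF assms(1-3)] by (auto simp: subset_iff image_iff) metis
    show "a \<oplus>\<^bsub>N\<^esub> b \<in> f ` H" if "a \<in> f ` H" "b \<in> f ` H" for a b
      using that HE(1,5) module_hom_add[OF f] by (auto simp: subset_iff image_iff) metis
    show "a \<odot>\<^bsub>N\<^esub> x \<in> f ` H" if "a \<in> carrier R" "x \<in> f ` H" for a x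
      using that HE(1,4) module_hom_smult[OF f] by (auto simp: subset_iff image_iff) metis
  qed
qed

lemma (in module) submodule_finsum:
  assumes H: "submodule H R M" and g: "g \<in> I \<rightarrow> H"
  shows "(\<Oplus>\<^bsub>M\<^esub>i\<in>I. g i) \<in> H"
  using g
proof (induction I rule: infinite_finite_induct)
  case (infinite A)
  then show ?case using submodule_zero[OF H] by (simp add: M.finsum_infinite)
next
  case empty
  then show ?case using submodule_zero[OF H] by simp
next
  case (insert x A)
  then show ?case using submoduleE[OF H] by (auto simp: Pi_iff subset_iff)
qed


section \<open>Products of ideals with submodules\<close>

text \<open>The term of degree \<open>p\<close> of the \<open>m\<close>-adic filtration of a module.\<close>

definition mpow :: "('a, 'r) ring_scheme \<Rightarrow> 'a set \<Rightarrow> nat \<Rightarrow> ('a, 'b, 'x) module_scheme \<Rightarrow> 'b set"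
  where "mpow R m p M = ideal_smult M (ideal_power R m p) (carrier M)"

lemma ideal_smult_least:
  assumes "\<And>a x. a \<in> I \<Longrightarrow> x \<in> N \<Longrightarrow> a \<odot>\<^bsub>M\<^esub> x \<in> K"
    and "\<And>x y. x \<in> K \<Longrightarrow> y \<in> K \<Longrightarrow> x \<oplus>\<^bsub>M\<^esub> y \<in> K"
  shows "ideal_smult M I N \<subseteq> K"
proof
  fix x assume "x \<in> ideal_smult M I N"
  then show "x \<in> K" by induction (auto intro: assms)
qed

lemma ideal_smult_mono:
  assumes "I \<subseteq> J" "N \<subseteq> K" shows "ideal_smult M I N \<subseteq> ideal_smult M J K"
  using assms by (intro ideal_smult_least) (auto intro: ideal_smult.intros)

lemma (in module) ideal_smult_submodule:
  assumes I: "ideal I R" and H: "submodule H R M"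
  shows "submodule (ideal_smult M I H) R M"
proof -
  interpret I: ideal I R by fact
  note HE = submoduleE[OF H]
  have sub: "ideal_smult M I H \<subseteq> carrier M"
    using HE(1) by (intro ideal_smult_least) (auto simp: subset_iff)
  have inv: "\<ominus>\<^bsub>M\<^esub> x \<in> ideal_smult M I H" if "x \<in> ideal_smult M I H" for x
    using that
  proof induction
    case (smult a x)
    then show ?case using HE(1,3) ideal_smult.smult[of a I "\<ominus>\<^bsub>M\<^esub> x" H M]
      by (auto simp: smult_r_minus subset_iff)
  next
    case (sum x y)
    then show ?case using sub ideal_smult.sum[of "\<ominus>\<^bsub>M\<^esub> x" M I H "\<ominus>\<^bsub>M\<^esub> y"]
      by (auto simp: M.minus_add subset_iff)
  qed
  have sm: "a \<odot>\<^bsub>M\<^esub> x \<in> ideal_smult M I H" if "x \<in> ideal_smult M I H" "a \<in> carrier R" for x a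
    using that
  proof (induction arbitrary: a)
    case (smult b x)
    then have "a \<odot>\<^bsub>M\<^esub> (b \<odot>\<^bsub>M\<^esub> x) = (a \<otimes> b) \<odot>\<^bsub>M\<^esub> x" using HE(1) by (auto simp: smult_assoc1 subset_iff)
    then show ?case using smult by (auto intro: ideal_smult.smult I.I_l_closed)
  next
    case (sum x y)
    then show ?case using sub ideal_smult.sum[of "a \<odot>\<^bsub>M\<^esub> x" M I H "a \<odot>\<^bsub>M\<^esub> y"]
      by (auto simp: smult_r_distr subset_iff)
  qed
  have "\<zero> \<odot>\<^bsub>M\<^esub> \<zero>\<^bsub>M\<^esub> \<in> ideal_smult M I H"
    using ideal.axioms(1)[OF I] submodule_zero[OF H]
    by (intro ideal_smult.smult) (auto dest: additive_subgroup.zero_closed)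
  then have "\<zero>\<^bsub>M\<^esub> \<in> ideal_smult M I H" by simp
  with sub inv sm show ?thesis
    by (intro submoduleI) (auto intro: ideal_smult.sum)
qed

text \<open>Linear maps commute with the formation of \<open>I H\<close> exactly, and not only up to inclusion;
  this is what makes surjections strict for the \<open>m\<close>-adic filtrations.\<close>

lemma ideal_smult_image:
  assumes "module R M" and f: "f \<in> module_hom R M N" and IH: "I \<subseteq> carrier R" "H \<subseteq> carrier M"
  shows "f ` ideal_smult M I H = ideal_smult N I (f ` H)"
proof -
  interpret M: module R M by fact
  have sub: "ideal_smult M I H \<subseteq> carrier M"
    using IH by (intro ideal_smult_least) (auto simp: subset_iff)
  have "f ` ideal_smult M I H \<subseteq> ideal_smult N I (f ` H)"
  proof safe
    fix x assume "x \<in> ideal_smult M I H"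
    then show "f x \<in> ideal_smult N I (f ` H)"
    proof induction
      case (smult a x)
      with IH have "f (a \<odot>\<^bsub>M\<^esub> x) = a \<odot>\<^bsub>N\<^esub> f x" by (intro module_hom_smult[OF f]) auto
      then show ?case using smult by (auto intro: ideal_smult.smult)
    next
      case (sum x y)
      with sub have "f (x \<oplus>\<^bsub>M\<^esub> y) = f x \<oplus>\<^bsub>N\<^esub> f y" by (intro module_hom_add[OF f]) auto
      then show ?case using sum by (auto intro: ideal_smult.sum)
    qed
  qed
  moreover have "ideal_smult N I (f ` H) \<subseteq> f ` ideal_smult M I H"
  proof (rule ideal_smult_least)
    fix a y assume "a \<in> I" "y \<in> f ` H"
    then obtain x where x: "x \<in> H" "y = f x" by (elim imageE)
    have "x \<in> carrier M" "a \<in> carrier R" using IH x(1) \<open>a \<in> I\<close> by (simp_all add: subset_iff)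
    then have "a \<odot>\<^bsub>N\<^esub> y = f (a \<odot>\<^bsub>M\<^esub> x)"
      unfolding x(2) by (intro module_hom_smult[OF f, symmetric])
    moreover have "a \<odot>\<^bsub>M\<^esub> x \<in> ideal_smult M I H" by (rule ideal_smult.smult) fact+
    ultimately show "a \<odot>\<^bsub>N\<^esub> y \<in> f ` ideal_smult M I H" by (rule image_eqI)
  next
    fix u v assume "u \<in> f ` ideal_smult M I H" "v \<in> f ` ideal_smult M I H"
    then obtain x y where xy: "x \<in> ideal_smult M I H" "y \<in> ideal_smult M I H" "u = f x" "v = f y"
      by (elim imageE)
    have "x \<in> carrier M" "y \<in> carrier M" using sub xy(1,2) by (simp_all add: subset_iff)
    then have "u \<oplus>\<^bsub>N\<^esub> v = f (x \<oplus>\<^bsub>M\<^esub> y)"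
      unfolding xy(3,4) by (intro module_hom_add[OF f, symmetric])
    moreover have "x \<oplus>\<^bsub>M\<^esub> y \<in> ideal_smult M I H" using xy(1,2) by (rule ideal_smult.sum)
    ultimately show "u \<oplus>\<^bsub>N\<^esub> v \<in> f ` ideal_smult M I H" by (rule image_eqI)
  qed
  ultimately show ?thesis by blast
qed

text \<open>The comparison of resolutions and the mapping cone construction take place over a commutative ring with
  an ideal; the local and the graded situation both specialise this locale.\<close>

locale ring_ideal = cring R + ideal m R for R :: "('a, 'r) ring_scheme" (structure) and m :: "'a set"
begin

lemma monoid_ideals: "monoid (ideals_set R)"
  using ideals_set_is_semiring by (simp add: semiring_def)

lemma m_in_ideals: "m \<in> carrier (ideals_set R)"
  using ideal_axioms by (simp add: ideals_set_def)

lemma ideal_power_ideal: "ideal (ideal_power R m p) R"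
  using monoid.nat_pow_closed[OF monoid_ideals m_in_ideals] by (simp add: ideals_set_def)

lemma ideal_power_sub: "ideal_power R m p \<subseteq> carrier R"
  using ideal.Icarr[OF ideal_power_ideal] by auto

lemma ideal_power_0: "ideal_power R m 0 = carrier R"
  by (simp add: ideals_set_def nat_pow_def)

lemma ideal_power_1: "ideal_power R m (Suc 0) = m"
  using monoid.nat_pow_eone[OF monoid_ideals m_in_ideals] by simp

lemma ideal_power_add: "ideal_prod R (ideal_power R m p) (ideal_power R m q) = ideal_power R m (p + q)"
  using monoid.nat_pow_mult[OF monoid_ideals m_in_ideals, of p q] by (simp add: ideals_set_def)

lemma ideal_power_mult:
  "a \<in> ideal_power R m p \<Longrightarrow> b \<in> ideal_power R m q \<Longrightarrow> a \<otimes> b \<in> ideal_power R m (p + q)"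
  using ideal_prod.prod[of a _ b _ R] ideal_power_add by blast

lemma ideal_power_antimono: "p \<le> q \<Longrightarrow> ideal_power R m q \<subseteq> ideal_power R m p"
  using ideal_prod_inter[OF ideal_power_ideal[of p] ideal_power_ideal[of "q - p"]]
    ideal_power_add[of p "q - p"] by auto

lemma mpow_0:
  assumes "module R M" shows "mpow R m 0 M = carrier M"
proof -
  interpret M: module R M by fact
  have "mpow R m 0 M \<subseteq> carrier M"
    unfolding mpow_def ideal_power_0 by (intro ideal_smult_least) auto
  moreover have "x \<in> mpow R m 0 M" if "x \<in> carrier M" for x
    unfolding mpow_def ideal_power_0 using that ideal_smult.smult[of \<one> "carrier R" x "carrier M" M] by simp
  ultimately show ?thesis by auto
qed

lemma mpow_1: "mpow R m (Suc 0) M = ideal_smult M m (carrier M)"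
  by (simp only: mpow_def ideal_power_1)

lemma mpow_submodule:
  assumes "module R M" shows "submodule (mpow R m p M) R M"
  unfolding mpow_def using assms by (simp add: ideal_power_ideal module.carrier_is_submodule module.ideal_smult_submodule)

lemma mpow_sub:
  assumes "module R M" shows "mpow R m p M \<subseteq> carrier M"
  using module.submoduleE(1)[OF assms mpow_submodule[OF assms]] .

lemma mpow_closed: "module R M \<Longrightarrow> x \<in> mpow R m p M \<Longrightarrow> x \<in> carrier M"
  using mpow_sub[of M p] by (simp add: subset_iff)

lemma
  assumes "module R M"
  shows mpow_zero: "\<zero>\<^bsub>M\<^esub> \<in> mpow R m p M"
    and mpow_add: "x \<in> mpow R m p M \<Longrightarrow> y \<in> mpow R m p M \<Longrightarrow> x \<oplus>\<^bsub>M\<^esub> y \<in> mpow R m p M"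
    and mpow_neg: "x \<in> mpow R m p M \<Longrightarrow> \<ominus>\<^bsub>M\<^esub> x \<in> mpow R m p M"
    and mpow_minus: "x \<in> mpow R m p M \<Longrightarrow> y \<in> mpow R m p M \<Longrightarrow> x \<ominus>\<^bsub>M\<^esub> y \<in> mpow R m p M"
  using module.submoduleE[OF assms mpow_submodule[OF assms, of p]]
    module.submodule_zero[OF assms mpow_submodule[OF assms, of p]]
    module.submodule_minus[OF assms mpow_submodule[OF assms, of p]] by auto

lemma mpow_antimono: "p \<le> q \<Longrightarrow> mpow R m q M \<subseteq> mpow R m p M"
  unfolding mpow_def by (intro ideal_smult_mono ideal_power_antimono) auto

lemma mpow_mono_mem: "x \<in> mpow R m q M \<Longrightarrow> p \<le> q \<Longrightarrow> x \<in> mpow R m p M"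
  using mpow_antimono[of p q M] by (simp add: subset_iff)

lemma mpow_smult:
  assumes "module R M" "a \<in> ideal_power R m p" "x \<in> mpow R m q M"
  shows "a \<odot>\<^bsub>M\<^esub> x \<in> mpow R m (p + q) M"
proof -
  interpret M: module R M by fact
  have a: "a \<in> carrier R" using assms(2) ideal_power_sub[of p] by (simp add: subset_iff)
  from assms(3) show ?thesis
    unfolding mpow_def
  proof induction
    case (smult b x)
    then have "b \<in> carrier R" using ideal_power_sub[of q] by (simp add: subset_iff)
    with a smult have "a \<odot>\<^bsub>M\<^esub> (b \<odot>\<^bsub>M\<^esub> x) = (a \<otimes> b) \<odot>\<^bsub>M\<^esub> x" by (simp add: M.smult_assoc1)
    then show ?case using smult assms(2) by (simp add: ideal_smult.smult ideal_power_mult)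
  next
    case (sum x y)
    then have "x \<in> carrier M" "y \<in> carrier M" using mpow_closed[OF assms(1), of _ q] unfolding mpow_def by simp_all
    then show ?case using a sum by (simp add: M.smult_r_distr ideal_smult.sum)
  qed
qed

lemma hom_mpow:
  assumes "module R M" "module R N" "f \<in> module_hom R M N" "x \<in> mpow R m p M"
  shows "f x \<in> mpow R m p N"
proof -
  have "f ` mpow R m p M = ideal_smult N (ideal_power R m p) (f ` carrier M)"
    unfolding mpow_def using assms by (simp add: ideal_smult_image ideal_power_sub)
  also have "\<dots> \<subseteq> mpow R m p N"
    unfolding mpow_def using module_hom_subset[OF assms(3)] by (intro ideal_smult_mono) auto
  finally show ?thesis using assms(4) by auto
qed

lemma hom_mpow_surj:
  assumes "module R M" "f \<in> module_hom R M N" "f ` carrier M = carrier N"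
  shows "f ` mpow R m p M = mpow R m p N"
  unfolding mpow_def using assms by (simp add: ideal_smult_image ideal_power_sub)

text \<open>The reason is \<open>m\<^sup>p (m N) = m\<^sup>p\<^sup>+\<^sup>1 N\<close>. This will be applied to the differentials of minimal complexes and
  to the lift of the inclusion of \<open>M\<close> into \<open>m P\<close>.\<close>

lemma hom_mpow_Suc:
  assumes M: "module R M" and N: "module R N" and f: "f \<in> module_hom R M N"
    and shift: "f ` carrier M \<subseteq> mpow R m (Suc 0) N" and x: "x \<in> mpow R m p M"
  shows "f x \<in> mpow R m (Suc p) N"
proof -
  have "f ` mpow R m p M = ideal_smult N (ideal_power R m p) (f ` carrier M)"
    unfolding mpow_def using assms by (simp add: ideal_smult_image ideal_power_sub)
  also have "\<dots> \<subseteq> mpow R m (Suc p) N"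
  proof (rule ideal_smult_least)
    show "a \<odot>\<^bsub>N\<^esub> y \<in> mpow R m (Suc p) N" if "a \<in> ideal_power R m p" "y \<in> f ` carrier M" for a y
      using mpow_smult[OF N that(1), of y "Suc 0"] that(2) shift by auto
  qed (rule mpow_add[OF N])
  finally show ?thesis using x by auto
qed

end

section \<open>The homology of the linear part in terms of elements\<close>

lemma (in module) mem_coset_iff: "x \<in> H +>\<^bsub>M\<^esub> y \<longleftrightarrow> (\<exists>h\<in>H. x = h \<oplus>\<^bsub>M\<^esub> y)"
  by (auto simp: a_r_coset_def r_coset_def)

lemma (in module) submodule_abelian_subgroup:
  "submodule H R M \<Longrightarrow> abelian_subgroup H M"
  by (intro abelian_subgroupI3 additive_subgroup.intro submodule.axioms(1) M.abelian_group_axioms)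

lemma (in module) coset_eq_iff:
  assumes H: "submodule H R M" and x: "x \<in> carrier M" and y: "y \<in> carrier M"
  shows "H +>\<^bsub>M\<^esub> x = H +>\<^bsub>M\<^esub> y \<longleftrightarrow> (\<exists>h\<in>H. x = h \<oplus>\<^bsub>M\<^esub> y)"
proof
  assume "H +>\<^bsub>M\<^esub> x = H +>\<^bsub>M\<^esub> y"
  moreover have "x \<in> H +>\<^bsub>M\<^esub> x"
    using abelian_subgroup.a_rcos_self[OF submodule_abelian_subgroup[OF H] x] .
  ultimately show "\<exists>h\<in>H. x = h \<oplus>\<^bsub>M\<^esub> y" by (simp add: mem_coset_iff)
next
  assume "\<exists>h\<in>H. x = h \<oplus>\<^bsub>M\<^esub> y"
  then have "x \<in> H +>\<^bsub>M\<^esub> y" by (simp add: mem_coset_iff)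
  then show "H +>\<^bsub>M\<^esub> x = H +>\<^bsub>M\<^esub> y"
    using M.a_repr_independence[OF _ y submodule.axioms(1)[OF H]] by simp
qed

lemma (in module) coset_add:
  assumes "submodule H R M" "x \<in> carrier M" "y \<in> carrier M"
  shows "(H +>\<^bsub>M\<^esub> x) <+>\<^bsub>M\<^esub> (H +>\<^bsub>M\<^esub> y) = H +>\<^bsub>M\<^esub> (x \<oplus>\<^bsub>M\<^esub> y)"
  using abelian_subgroup.a_rcos_sum[OF submodule_abelian_subgroup[OF assms(1)] assms(2,3)] .

lemma (in module) coset_self:
  assumes H: "submodule H R M" and x: "x \<in> carrier M"
  shows "H +>\<^bsub>M\<^esub> x = H \<longleftrightarrow> x \<in> H"
proof
  assume "H +>\<^bsub>M\<^esub> x = H"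
  then show "x \<in> H"
    using abelian_subgroup.a_rcos_self[OF submodule_abelian_subgroup[OF H] x] by simp
qed (rule abelian_subgroup.a_rcos_const[OF submodule_abelian_subgroup[OF H]])

lemma (in module) minus_eq_iff:
  assumes "x \<in> carrier M" "y \<in> carrier M" "z \<in> carrier M"
  shows "x \<ominus>\<^bsub>M\<^esub> y = z \<longleftrightarrow> x = z \<oplus>\<^bsub>M\<^esub> y"
  using assms by (metis M.a_assoc M.a_inv_closed M.l_neg M.minus_eq M.r_neg M.r_zero)

locale minimal_complex = ring_ideal R m
  for R :: "('a, 'r) ring_scheme" (structure) and m :: "'a set" +
  fixes F :: "nat \<Rightarrow> ('a, 'f, 'y) module_scheme" and d :: "nat \<Rightarrow> 'f \<Rightarrow> 'f"
  assumes modules: "module R (F i)"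
    and diff_hom: "d i \<in> module_hom R (F (Suc i)) (F i)"
    and diff_minimal: "d i ` carrier (F (Suc i)) \<subseteq> mpow R m (Suc 0) (F i)"
begin

sublocale F: module R "F i" for i by (rule modules)

lemmas d_closed = module_hom_closed[OF diff_hom]
  and d_add = module_hom_add[OF diff_hom]
  and d_zero = module_hom_zero[OF modules modules diff_hom]
  and d_neg = module_hom_neg[OF modules modules diff_hom]
  and d_minus = module_hom_minus[OF modules modules diff_hom]
  and d_mpow = hom_mpow_Suc[OF modules modules diff_hom diff_minimal]

end

text \<open>Vanishing of the homology of the linear part in homological degree \<open>i + 1\<close> says that
  an element of \<open>m\<^sup>p F\<close> which the differential sends one step deeper than it has to is congruent to a
  boundary coming from \<open>m\<^sup>p\<^sup>-\<^sup>1\<close>. For \<open>p = 0\<close> the truncated subtraction is harmless: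
  all boundaries lie in \<open>m F\<close> by minimality.\<close>

definition lin_exact ::
  "('a, 'r) ring_scheme \<Rightarrow> 'a set \<Rightarrow> (nat \<Rightarrow> ('a, 'f, 'y) module_scheme) \<Rightarrow> (nat \<Rightarrow> 'f \<Rightarrow> 'f) \<Rightarrow> nat \<Rightarrow> bool"
  where "lin_exact R m F d i \<longleftrightarrow>
    (\<forall>p. \<forall>x\<in>mpow R m p (F (Suc i)). d i x \<in> mpow R m (Suc (Suc p)) (F i) \<longrightarrow>
      (\<exists>y\<in>mpow R m (p - 1) (F (Suc (Suc i))). \<exists>z\<in>mpow R m (Suc p) (F (Suc i)).
         x = d (Suc i) y \<oplus>\<^bsub>F (Suc i)\<^esub> z))"

lemma lin_exactD:
  assumes "lin_exact R m F d i" "x \<in> mpow R m p (F (Suc i))" "d i x \<in> mpow R m (Suc (Suc p)) (F i)"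
  obtains y z where "y \<in> mpow R m (p - 1) (F (Suc (Suc i)))" "z \<in> mpow R m (Suc p) (F (Suc i))"
    "x = d (Suc i) y \<oplus>\<^bsub>F (Suc i)\<^esub> z"
  using assms unfolding lin_exact_def by blast

lemma filt_mpow: "filt R m F n i = mpow R m (n - i) (F i)"
  by (simp add: filt_def mpow_def)

context minimal_complex
begin

text \<open>Elements of the linear part are handled through representatives: finitely supported sequences
  of elements of the filtration steps, and the sequences of their cosets.\<close>

definition gr_reps :: "nat \<Rightarrow> (nat \<Rightarrow> 'f) set"
  where "gr_reps i = {x. (\<forall>n. x n \<in> filt R m F n i) \<and> finite {n. x n \<noteq> \<zero>\<^bsub>F i\<^esub>}}"

definition gr_class :: "nat \<Rightarrow> (nat \<Rightarrow> 'f) \<Rightarrow> (nat \<Rightarrow> 'f set)"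
  where "gr_class i x = (\<lambda>n. filt R m F (Suc n) i +>\<^bsub>F i\<^esub> x n)"

lemma filt_submodule: "submodule (filt R m F n i) R (F i)"
  by (simp add: filt_mpow mpow_submodule modules)

lemma filt_closed: "x \<in> filt R m F n i \<Longrightarrow> x \<in> carrier (F i)"
  using F.submoduleE(1)[OF filt_submodule] by auto

lemma d_filt: "x \<in> filt R m F n (Suc i) \<Longrightarrow> d i x \<in> filt R m F n i"
  using d_mpow[of x "n - Suc i" i] mpow_closed[OF modules, of x _ "Suc i"]
  by (cases "i < n") (auto simp: filt_mpow Suc_diff_Suc mpow_0 modules d_closed)

lemma reps_closed: "x \<in> gr_reps i \<Longrightarrow> x n \<in> carrier (F i)"
  using filt_closed by (auto simp: gr_reps_def)

lemma reps_zero: "(\<lambda>_. \<zero>\<^bsub>F i\<^esub>) \<in> gr_reps i"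
  using F.submodule_zero[OF filt_submodule] by (auto simp: gr_reps_def)

lemma reps_add:
  assumes "x \<in> gr_reps i" "y \<in> gr_reps i"
  shows "(\<lambda>n. x n \<oplus>\<^bsub>F i\<^esub> y n) \<in> gr_reps i"
proof -
  have "{n. x n \<oplus>\<^bsub>F i\<^esub> y n \<noteq> \<zero>\<^bsub>F i\<^esub>} \<subseteq> {n. x n \<noteq> \<zero>\<^bsub>F i\<^esub>} \<union> {n. y n \<noteq> \<zero>\<^bsub>F i\<^esub>}" by auto
  moreover have "finite ({n. x n \<noteq> \<zero>\<^bsub>F i\<^esub>} \<union> {n. y n \<noteq> \<zero>\<^bsub>F i\<^esub>})"
    using assms by (auto simp: gr_reps_def)
  ultimately have "finite {n. x n \<oplus>\<^bsub>F i\<^esub> y n \<noteq> \<zero>\<^bsub>F i\<^esub>}" by (rule finite_subset)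
  then show ?thesis using assms F.submoduleE(5)[OF filt_submodule] by (auto simp: gr_reps_def)
qed

lemma reps_neg:
  assumes "x \<in> gr_reps i"
  shows "(\<lambda>n. \<ominus>\<^bsub>F i\<^esub> x n) \<in> gr_reps i"
proof -
  have "{n. \<ominus>\<^bsub>F i\<^esub> x n \<noteq> \<zero>\<^bsub>F i\<^esub>} \<subseteq> {n. x n \<noteq> \<zero>\<^bsub>F i\<^esub>}" by auto
  then have "finite {n. \<ominus>\<^bsub>F i\<^esub> x n \<noteq> \<zero>\<^bsub>F i\<^esub>}"
    using assms finite_subset by (auto simp: gr_reps_def)
  then show ?thesis using assms F.submoduleE(3)[OF filt_submodule] by (auto simp: gr_reps_def)
qed

lemma reps_diff:
  assumes "x \<in> gr_reps (Suc i)" shows "(\<lambda>n. d i (x n)) \<in> gr_reps i"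
proof -
  have "{n. d i (x n) \<noteq> \<zero>\<^bsub>F i\<^esub>} \<subseteq> {n. x n \<noteq> \<zero>\<^bsub>F (Suc i)\<^esub>}" by (auto simp: d_zero)
  then have "finite {n. d i (x n) \<noteq> \<zero>\<^bsub>F i\<^esub>}"
    using assms finite_subset by (auto simp: gr_reps_def)
  then show ?thesis using assms by (auto simp: gr_reps_def d_filt)
qed

lemma class_eq_iff:
  assumes "x \<in> gr_reps i" "y \<in> gr_reps i"
  shows "gr_class i x = gr_class i y \<longleftrightarrow> (\<forall>n. \<exists>h\<in>filt R m F (Suc n) i. x n = h \<oplus>\<^bsub>F i\<^esub> y n)"
  using assms by (simp add: gr_class_def fun_eq_iff F.coset_eq_iff[OF filt_submodule] reps_closed)

lemma class_add:
  assumes "x \<in> gr_reps i" "y \<in> gr_reps i"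
  shows "gr_class i x \<oplus>\<^bsub>lin R m F i\<^esub> gr_class i y = gr_class i (\<lambda>n. x n \<oplus>\<^bsub>F i\<^esub> y n)"
proof -
  have "set_add (F i\<lparr>carrier := H\<rparr>) = set_add (F i)" for H
    by (simp add: set_add_def set_mult_def fun_eq_iff)
  with assms show ?thesis
    by (simp add: lin_def direct_sum_module_def gr_piece_def quotient_module_def gr_class_def
        fun_eq_iff F.coset_add[OF filt_submodule] reps_closed)
qed

lemma class_diff:
  assumes x: "x \<in> gr_reps (Suc i)"
  shows "lin_diff R m F d i (gr_class (Suc i) x) = gr_class i (\<lambda>n. d i (x n))"
proof
  fix n
  let ?H = "filt R m F (Suc n) (Suc i)" and ?K = "filt R m F (Suc n) i"
  have "?K +>\<^bsub>F i\<^esub> d i y = ?K +>\<^bsub>F i\<^esub> d i (x n)" if y: "y \<in> ?H +>\<^bsub>F (Suc i)\<^esub> x n" for y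
  proof -
    from y obtain h where h: "h \<in> ?H" "y = h \<oplus>\<^bsub>F (Suc i)\<^esub> x n" by (auto simp: F.mem_coset_iff)
    then have "d i y = d i h \<oplus>\<^bsub>F i\<^esub> d i (x n)" using filt_closed reps_closed[OF x] by (simp add: d_add)
    moreover have "d i h \<in> ?K" using h by (simp add: d_filt)
    ultimately show ?thesis
      using h reps_closed[OF x] filt_closed
      by (subst F.coset_eq_iff[OF filt_submodule]) (auto simp: d_closed)
  qed
  moreover have "x n \<in> ?H +>\<^bsub>F (Suc i)\<^esub> x n"
    using abelian_subgroup.a_rcos_self[OF F.submodule_abelian_subgroup[OF filt_submodule] reps_closed[OF x]] .
  ultimately have "(\<Union>y\<in>?H +>\<^bsub>F (Suc i)\<^esub> x n. ?K +>\<^bsub>F i\<^esub> d i y) = ?K +>\<^bsub>F i\<^esub> d i (x n)"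
    by (intro SUP_eq_const) blast+
  then show "lin_diff R m F d i (gr_class (Suc i) x) n = gr_class i (\<lambda>n. d i (x n)) n"
    by (simp only: lin_diff_def gr_class_def)
qed

lemma filt_coset_zero: "filt R m F n i +>\<^bsub>F i\<^esub> \<zero>\<^bsub>F i\<^esub> = filt R m F n i"
  using F.coset_self[OF filt_submodule] F.submodule_zero[OF filt_submodule] by simp

lemma lin_carrier: "carrier (lin R m F i) = gr_class i ` gr_reps i"
proof
  show "gr_class i ` gr_reps i \<subseteq> carrier (lin R m F i)"
  proof safe
    fix x assume x: "x \<in> gr_reps i"
    have "{n. gr_class i x n \<noteq> filt R m F (Suc n) i} \<subseteq> {n. x n \<noteq> \<zero>\<^bsub>F i\<^esub>}"
      by (rule Collect_mono) (simp add: gr_class_def, metis filt_coset_zero)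
    then have "finite {n. gr_class i x n \<noteq> filt R m F (Suc n) i}"
      using x finite_subset by (auto simp: gr_reps_def)
    moreover have "gr_class i x n \<in> carrier (gr_piece R m F i n)" for n
      using x by (auto simp: gr_piece_def quotient_module_def gr_class_def A_RCOSETS_def RCOSETS_def
          a_r_coset_def r_coset_def gr_reps_def)
    ultimately show "gr_class i x \<in> carrier (lin R m F i)"
      by (auto simp: lin_def direct_sum_module_def gr_piece_def quotient_module_def)
  qed
  show "carrier (lin R m F i) \<subseteq> gr_class i ` gr_reps i"
  proof
    fix u assume u: "u \<in> carrier (lin R m F i)"
    then have fin: "finite {n. u n \<noteq> filt R m F (Suc n) i}"
      and mem: "u n \<in> carrier (gr_piece R m F i n)" for n
      by (auto simp: lin_def direct_sum_module_def gr_piece_def quotient_module_def)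
    have "\<exists>x. x \<in> filt R m F n i \<and> u n = filt R m F (Suc n) i +>\<^bsub>F i\<^esub> x \<and>
            (u n = filt R m F (Suc n) i \<longrightarrow> x = \<zero>\<^bsub>F i\<^esub>)" for n
    proof (cases "u n = filt R m F (Suc n) i")
      case True
      then show ?thesis
        using F.submodule_zero[OF filt_submodule] by (intro exI[of _ "\<zero>\<^bsub>F i\<^esub>"]) (simp add: filt_coset_zero)
    next
      case False
      then show ?thesis
        using mem[of n] by (auto simp: gr_piece_def quotient_module_def A_RCOSETS_def RCOSETS_def
            a_r_coset_def r_coset_def)
    qed
    then obtain x where x: "\<And>n. x n \<in> filt R m F n i" "\<And>n. u n = filt R m F (Suc n) i +>\<^bsub>F i\<^esub> x n"
      and x0: "\<And>n. u n = filt R m F (Suc n) i \<Longrightarrow> x n = \<zero>\<^bsub>F i\<^esub>"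
      by metis
    have "finite {n. x n \<noteq> \<zero>\<^bsub>F i\<^esub>}"
      by (rule finite_subset[OF _ fin]) (auto dest: x0)
    with x have "x \<in> gr_reps i" "u = gr_class i x" by (auto simp: gr_reps_def gr_class_def)
    then show "u \<in> gr_class i ` gr_reps i" by blast
  qed
qed

lemma lin_zero: "\<zero>\<^bsub>lin R m F i\<^esub> = gr_class i (\<lambda>_. \<zero>\<^bsub>F i\<^esub>)"
  by (simp add: lin_def direct_sum_module_def gr_piece_def quotient_module_def gr_class_def
      filt_coset_zero)

text \<open>A coset \<open>B + u\<close> of the boundaries \<open>B\<close> equals \<open>B\<close> exactly if \<open>u\<close> is itself a boundary,
  so the nested quotients reduce to a statement about representatives.\<close>

lemma lin_homology_nonzero_iff:
  "nonzero_module (homology (lin R m F) (lin_diff R m F d) (Suc i)) \<longleftrightarrow>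
    (\<exists>x\<in>gr_reps (Suc i). (\<forall>n. d i (x n) \<in> filt R m F (Suc n) i) \<and>
       (\<forall>y\<in>gr_reps (Suc (Suc i)). gr_class (Suc i) x \<noteq> gr_class (Suc i) (\<lambda>n. d (Suc i) (y n))))"
  (is "_ \<longleftrightarrow> ?R")
proof -
  let ?L = "lin R m F" and ?D = "lin_diff R m F d" and ?c = "gr_class (Suc i)"
  let ?d = "\<lambda>y n. d (Suc i) (y n)"
  define Z where "Z = {x \<in> gr_reps (Suc i). \<forall>n. d i (x n) \<in> filt R m F (Suc n) i}"
  define B where "B = boundaries ?L ?D (Suc i)"
  define coset where "coset = (\<lambda>u. {b \<oplus>\<^bsub>?L (Suc i)\<^esub> u | b. b \<in> B})"
  have cycle_iff: "?D i (?c x) = \<zero>\<^bsub>?L i\<^esub> \<longleftrightarrow> (\<forall>n. d i (x n) \<in> filt R m F (Suc n) i)"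
    if "x \<in> gr_reps (Suc i)" for x
    using that filt_closed reps_closed[OF that]
    by (simp add: class_diff lin_zero class_eq_iff[OF reps_diff[OF that] reps_zero])
  have cyc: "cycles ?L ?D (Suc i) = ?c ` Z"
    unfolding cycles_def using cycle_iff
    by (auto simp: Z_def a_kernel_def' lin_carrier)
  define b where "b = (\<lambda>y. ?c (?d y))"
  have b_add: "b w \<oplus>\<^bsub>?L (Suc i)\<^esub> b y = b (\<lambda>n. w n \<oplus>\<^bsub>F (Suc (Suc i))\<^esub> y n)"
    if "w \<in> gr_reps (Suc (Suc i))" "y \<in> gr_reps (Suc (Suc i))" for w y
    using that by (simp add: b_def class_add reps_diff d_add reps_closed)
  have B: "B = b ` gr_reps (Suc (Suc i))"
    unfolding b_def B_def boundaries_def lin_carrier by (auto simp: class_diff image_iff)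
  have hom: "carrier (homology ?L ?D (Suc i)) = coset ` ?c ` Z" "\<zero>\<^bsub>homology ?L ?D (Suc i)\<^esub> = B"
    by (auto simp: homology_def quotient_module_def A_RCOSETS_def RCOSETS_def r_coset_def cyc
        coset_def B_def[symmetric])
  have zero_Z: "(\<lambda>_. \<zero>\<^bsub>F (Suc i)\<^esub>) \<in> Z"
    using reps_zero F.submodule_zero[OF filt_submodule] by (auto simp: Z_def d_zero)
  have in_B: "coset (?c x) = B" if x: "x \<in> Z" and y: "y \<in> gr_reps (Suc (Suc i))" and eq: "?c x = b y" for x y
  proof
    show "coset (?c x) \<subseteq> B"
    proof
      fix u assume "u \<in> coset (?c x)"
      then obtain w where w: "w \<in> gr_reps (Suc (Suc i))" "u = b w \<oplus>\<^bsub>?L (Suc i)\<^esub> b y"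
        unfolding coset_def B eq by blast
      then have "u = b (\<lambda>n. w n \<oplus>\<^bsub>F (Suc (Suc i))\<^esub> y n)"
        using y by (simp add: b_add)
      with reps_add[OF w(1) y] show "u \<in> B" unfolding B by blast
    qed
    show "B \<subseteq> coset (?c x)"
    proof
      fix u assume "u \<in> B"
      then obtain w where w: "w \<in> gr_reps (Suc (Suc i))" "u = b w" unfolding B by blast
      let ?v = "\<lambda>n. w n \<oplus>\<^bsub>F (Suc (Suc i))\<^esub> \<ominus>\<^bsub>F (Suc (Suc i))\<^esub> y n"
      have v: "?v \<in> gr_reps (Suc (Suc i))" using w(1) y by (intro reps_add reps_neg)
      have "(\<lambda>n. ?v n \<oplus>\<^bsub>F (Suc (Suc i))\<^esub> y n) = w"
        using reps_closed[OF w(1)] reps_closed[OF y] by (simp add: F.a_assoc F.l_neg)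
      then have "b ?v \<oplus>\<^bsub>?L (Suc i)\<^esub> b y = u"
        using b_add[OF v y] w(2) by simp
      moreover have "b ?v \<in> B" unfolding B using v by blast
      ultimately show "u \<in> coset (?c x)" unfolding coset_def eq by blast
    qed
  qed
  have not_B: "coset (?c x) \<noteq> B" if x: "x \<in> Z" and ne: "\<And>y. y \<in> gr_reps (Suc (Suc i)) \<Longrightarrow> ?c x \<noteq> b y" for x
  proof
    assume eq: "coset (?c x) = B"
    have x': "x \<in> gr_reps (Suc i)" using x by (simp add: Z_def)
    have "b (\<lambda>_. \<zero>\<^bsub>F (Suc (Suc i))\<^esub>) \<in> B" unfolding B using reps_zero by blast
    then have "b (\<lambda>_. \<zero>\<^bsub>F (Suc (Suc i))\<^esub>) \<oplus>\<^bsub>?L (Suc i)\<^esub> ?c x \<in> coset (?c x)" unfolding coset_def by blast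
    also have "b (\<lambda>_. \<zero>\<^bsub>F (Suc (Suc i))\<^esub>) \<oplus>\<^bsub>?L (Suc i)\<^esub> ?c x = ?c x"
      using x' by (simp add: b_def d_zero class_add reps_zero reps_closed)
    finally have "?c x \<in> B" unfolding eq .
    with ne show False unfolding B by blast
  qed
  have "nonzero_module (homology ?L ?D (Suc i)) \<longleftrightarrow> (\<exists>x\<in>Z. coset (?c x) \<noteq> B)"
    unfolding nonzero_module_def hom using zero_Z by blast
  also have "\<dots> \<longleftrightarrow> (\<exists>x\<in>Z. \<forall>y\<in>gr_reps (Suc (Suc i)). ?c x \<noteq> b y)"
  proof (rule bex_cong[OF refl])
    fix x assume x: "x \<in> Z"
    show "coset (?c x) \<noteq> B \<longleftrightarrow> (\<forall>y\<in>gr_reps (Suc (Suc i)). ?c x \<noteq> b y)"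
      using in_B[OF x] not_B[OF x] by metis
  qed
  also have "\<dots> \<longleftrightarrow> ?R" by (auto simp: Z_def b_def)
  finally show ?thesis .
qed

text \<open>Passage between the two numberings: filtration degree \<open>n\<close> in homological degree \<open>i + 1\<close> is
  the power \<open>p = n - (i + 1)\<close>. For \<open>n < i + 1\<close> the graded piece vanishes and nothing has to be shown.\<close>

lemma lin_exact_filt:
  "lin_exact R m F d i \<longleftrightarrow>
    (\<forall>n. \<forall>x\<in>filt R m F n (Suc i). d i x \<in> filt R m F (Suc n) i \<longrightarrow>
      (\<exists>y\<in>filt R m F n (Suc (Suc i)). \<exists>h\<in>filt R m F (Suc n) (Suc i). x = h \<oplus>\<^bsub>F (Suc i)\<^esub> d (Suc i) y))"
    (is "_ \<longleftrightarrow> ?R")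
proof
  assume L: "lin_exact R m F d i"
  show ?R
  proof (intro allI ballI impI)
    fix n x assume x: "x \<in> filt R m F n (Suc i)" and dx: "d i x \<in> filt R m F (Suc n) i"
    show "\<exists>y\<in>filt R m F n (Suc (Suc i)). \<exists>h\<in>filt R m F (Suc n) (Suc i). x = h \<oplus>\<^bsub>F (Suc i)\<^esub> d (Suc i) y"
    proof (cases "n < Suc i")
      case True
      then have "x \<in> filt R m F (Suc n) (Suc i)" using filt_closed[OF x] by (simp add: filt_mpow mpow_0 modules)
      moreover have "\<zero>\<^bsub>F (Suc (Suc i))\<^esub> \<in> filt R m F n (Suc (Suc i))" by (rule F.submodule_zero[OF filt_submodule])
      moreover have "x = x \<oplus>\<^bsub>F (Suc i)\<^esub> d (Suc i) \<zero>\<^bsub>F (Suc (Suc i))\<^esub>" using filt_closed[OF x] by (simp add: d_zero)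
      ultimately show ?thesis by blast
    next
      case False
      then have n: "Suc n - i = Suc (Suc (n - Suc i))" "Suc n - Suc i = Suc (n - Suc i)"
        "n - Suc (Suc i) = n - Suc i - 1" by auto
      obtain y z where yz: "y \<in> mpow R m (n - Suc i - 1) (F (Suc (Suc i)))"
        "z \<in> mpow R m (Suc (n - Suc i)) (F (Suc i))" "x = d (Suc i) y \<oplus>\<^bsub>F (Suc i)\<^esub> z"
        using lin_exactD[OF L] x dx unfolding filt_mpow n by blast
      have "x = z \<oplus>\<^bsub>F (Suc i)\<^esub> d (Suc i) y"
        using yz mpow_closed[OF modules] by (simp add: F.a_comm d_closed)
      then show ?thesis unfolding filt_mpow n using yz by blast
    qed
  qed
next
  assume R: ?R
  show "lin_exact R m F d i"
    unfolding lin_exact_def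
  proof (intro allI ballI impI)
    fix p x assume x: "x \<in> mpow R m p (F (Suc i))" and dx: "d i x \<in> mpow R m (Suc (Suc p)) (F i)"
    define n where "n = p + Suc i"
    have n: "p = n - Suc i" "Suc (Suc p) = Suc n - i" "Suc p = Suc n - Suc i" "p - 1 = n - Suc (Suc i)"
      by (auto simp: n_def)
    have "x \<in> filt R m F n (Suc i)" "d i x \<in> filt R m F (Suc n) i"
      using x dx by (simp_all only: filt_mpow flip: n)
    then obtain y h where yh: "y \<in> filt R m F n (Suc (Suc i))" "h \<in> filt R m F (Suc n) (Suc i)"
      "x = h \<oplus>\<^bsub>F (Suc i)\<^esub> d (Suc i) y"
      using R by blast
    have "x = d (Suc i) y \<oplus>\<^bsub>F (Suc i)\<^esub> h"
      using yh filt_closed by (simp add: F.a_comm d_closed)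
    then show "\<exists>y\<in>mpow R m (p - 1) (F (Suc (Suc i))). \<exists>z\<in>mpow R m (Suc p) (F (Suc i)).
        x = d (Suc i) y \<oplus>\<^bsub>F (Suc i)\<^esub> z"
      using yh unfolding n(3,4) filt_mpow by blast
  qed
qed

text \<open>The linear part is a direct sum over the filtration degree and its differential respects the
  summands, so exactness can be tested on one summand at a time.\<close>

lemma lin_homology_zero_iff:
  "\<not> nonzero_module (homology (lin R m F) (lin_diff R m F d) (Suc i)) \<longleftrightarrow> lin_exact R m F d i"
proof
  assume L: "\<not> nonzero_module (homology (lin R m F) (lin_diff R m F d) (Suc i))"
  show "lin_exact R m F d i"
    unfolding lin_exact_filt
  proof (intro allI ballI impI)
    fix n x assume x: "x \<in> filt R m F n (Suc i)" and dx: "d i x \<in> filt R m F (Suc n) i"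
    \<comment> \<open>the element \<open>x\<close> placed in the summand of degree \<open>n\<close>\<close>
    define u where "u = (\<lambda>k. if k = n then x else \<zero>\<^bsub>F (Suc i)\<^esub>)"
    have u: "u \<in> gr_reps (Suc i)"
      using x F.submodule_zero[OF filt_submodule] by (auto simp: u_def gr_reps_def)
    moreover have "\<forall>k. d i (u k) \<in> filt R m F (Suc k) i"
      using dx F.submodule_zero[OF filt_submodule] by (auto simp: u_def d_zero)
    ultimately obtain y where y: "y \<in> gr_reps (Suc (Suc i))"
      and eq: "gr_class (Suc i) u = gr_class (Suc i) (\<lambda>n. d (Suc i) (y n))"
      using L unfolding lin_homology_nonzero_iff by blast
    from eq have "\<exists>h\<in>filt R m F (Suc n) (Suc i). u n = h \<oplus>\<^bsub>F (Suc i)\<^esub> d (Suc i) (y n)"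
      by (simp only: class_eq_iff[OF u reps_diff[OF y]])
    moreover have "y n \<in> filt R m F n (Suc (Suc i))" using y by (auto simp: gr_reps_def)
    ultimately show "\<exists>y\<in>filt R m F n (Suc (Suc i)). \<exists>h\<in>filt R m F (Suc n) (Suc i).
        x = h \<oplus>\<^bsub>F (Suc i)\<^esub> d (Suc i) y"
      unfolding u_def by auto
  qed
next
  assume R: "lin_exact R m F d i"
  show "\<not> nonzero_module (homology (lin R m F) (lin_diff R m F d) (Suc i))"
    unfolding lin_homology_nonzero_iff
  proof clarify
    fix x assume x: "x \<in> gr_reps (Suc i)" and dx: "\<forall>n. d i (x n) \<in> filt R m F (Suc n) i"
      and ne: "\<forall>y\<in>gr_reps (Suc (Suc i)). gr_class (Suc i) x \<noteq> gr_class (Suc i) (\<lambda>n. d (Suc i) (y n))"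
    \<comment> \<open>where \<open>x\<close> vanishes the preimage is chosen to be zero, to keep the support finite\<close>
    have "\<exists>y. y \<in> filt R m F n (Suc (Suc i)) \<and> (\<exists>h\<in>filt R m F (Suc n) (Suc i).
        x n = h \<oplus>\<^bsub>F (Suc i)\<^esub> d (Suc i) y) \<and> (x n = \<zero>\<^bsub>F (Suc i)\<^esub> \<longrightarrow> y = \<zero>\<^bsub>F (Suc (Suc i))\<^esub>)" for n
    proof (cases "x n = \<zero>\<^bsub>F (Suc i)\<^esub>")
      case True
      then show ?thesis
        using F.submodule_zero[OF filt_submodule]
        by (intro exI[of _ "\<zero>\<^bsub>F (Suc (Suc i))\<^esub>"]) (auto simp: d_zero intro!: bexI[of _ "\<zero>\<^bsub>F (Suc i)\<^esub>"])
    next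
      case False
      have "x n \<in> filt R m F n (Suc i)" using x by (simp add: gr_reps_def)
      with R dx show ?thesis unfolding lin_exact_filt using False by blast
    qed
    then obtain y where y: "\<And>n. y n \<in> filt R m F n (Suc (Suc i))"
      and h: "\<And>n. \<exists>h\<in>filt R m F (Suc n) (Suc i). x n = h \<oplus>\<^bsub>F (Suc i)\<^esub> d (Suc i) (y n)"
      and y0: "\<And>n. x n = \<zero>\<^bsub>F (Suc i)\<^esub> \<longrightarrow> y n = \<zero>\<^bsub>F (Suc (Suc i))\<^esub>"
      by metis
    have "finite {n. x n \<noteq> \<zero>\<^bsub>F (Suc i)\<^esub>}" using x by (simp add: gr_reps_def)
    then have "finite {n. y n \<noteq> \<zero>\<^bsub>F (Suc (Suc i))\<^esub>}"
      by (rule finite_subset[rotated]) (use y0 in auto)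
    with y have "y \<in> gr_reps (Suc (Suc i))" by (simp add: gr_reps_def)
    moreover from this have "gr_class (Suc i) x = gr_class (Suc i) (\<lambda>n. d (Suc i) (y n))"
      unfolding class_eq_iff[OF x reps_diff[OF \<open>y \<in> gr_reps (Suc (Suc i))\<close>]] using h by simp
    ultimately show False using ne by simp
  qed
qed

text \<open>Homology in degree \<open>0\<close> contributes the value \<open>0\<close> to the supremum, which is also the supremum of the
  empty set; so only the positive degrees \<open>i + 1\<close> occur on the right.\<close>

theorem lin_defect_le_iff: "lin_defect R m F d \<le> enat k \<longleftrightarrow> (\<forall>i\<ge>k. lin_exact R m F d i)"
proof -
  have "lin_defect R m F d \<le> enat k \<longleftrightarrow>
    (\<forall>i. nonzero_module (homology (lin R m F) (lin_diff R m F d) i) \<longrightarrow> i \<le> k)"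
    unfolding lin_defect_def Sup_le_iff by auto
  also have "\<dots> \<longleftrightarrow> (\<forall>i. nonzero_module (homology (lin R m F) (lin_diff R m F d) (Suc i)) \<longrightarrow> Suc i \<le> k)"
    by (metis nat.exhaust zero_le)
  also have "\<dots> \<longleftrightarrow> (\<forall>i\<ge>k. lin_exact R m F d i)"
    unfolding lin_homology_zero_iff[symmetric] by (auto simp: not_le Suc_le_eq)
  finally show ?thesis .
qed

end

section \<open>Maps out of free modules\<close>

text \<open>The homotopy identity \<open>d h = g f - 1 - h d\<close>, solved for the argument of the identity map;
  \<open>C + D\<close> will be the value of \<open>g f\<close>.\<close>

lemma (in abelian_group) diff_regroup:
  assumes "A = (C \<oplus> D) \<ominus> x \<ominus> B" "x \<in> carrier G" "B \<in> carrier G" "C \<in> carrier G" "D \<in> carrier G"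
  shows "x = (C \<ominus> A) \<oplus> (D \<ominus> B)"
proof -
  have A: "A = C \<oplus> (D \<oplus> (\<ominus> x \<oplus> \<ominus> B))" using assms by (simp add: a_minus_def a_assoc)
  have "\<ominus> A = \<ominus> C \<oplus> (\<ominus> D \<oplus> (x \<oplus> B))" unfolding A using assms by (simp add: minus_add)
  then have "C \<ominus> A = \<ominus> D \<oplus> (x \<oplus> B)" using assms by (simp add: a_minus_def r_neg2)
  then have "(C \<ominus> A) \<oplus> (D \<ominus> B) = \<ominus> D \<oplus> (D \<oplus> (x \<oplus> (B \<oplus> \<ominus> B)))"
    using assms by (simp add: a_minus_def a_ac)
  also have "\<dots> = x" using assms by (simp add: r_neg1 r_neg)
  finally show ?thesis by simp
qed

lemma basis_generates:
  assumes "module R F" and B: "is_basis R F B" and H: "submodule H R F" "B \<subseteq> H"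
  shows "carrier F \<subseteq> H"
proof
  interpret F: module R F by fact
  fix x assume "x \<in> carrier F"
  then obtain c where c: "c \<in> B \<rightarrow>\<^sub>E carrier R" "x = (\<Oplus>\<^bsub>F\<^esub>b\<in>B. c b \<odot>\<^bsub>F\<^esub> b)"
    using B unfolding is_basis_def by blast
  have "(\<lambda>b. c b \<odot>\<^bsub>F\<^esub> b) \<in> B \<rightarrow> H" using c(1) H F.submoduleE(4)[OF H(1)] by auto
  from F.submodule_finsum[OF H(1) this] show "x \<in> H" by (simp add: c(2))
qed

lemma basis_coordinates:
  fixes R (structure)
  assumes "module R F" and B: "is_basis R F B"
  obtains \<kappa> where "\<And>b x. b \<in> B \<Longrightarrow> x \<in> carrier F \<Longrightarrow> \<kappa> b x \<in> carrier R"
    and "\<And>b x y. b \<in> B \<Longrightarrow> x \<in> carrier F \<Longrightarrow> y \<in> carrier F \<Longrightarrow> \<kappa> b (x \<oplus>\<^bsub>F\<^esub> y) = \<kappa> b x \<oplus> \<kappa> b y"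
    and "\<And>b a x. b \<in> B \<Longrightarrow> a \<in> carrier R \<Longrightarrow> x \<in> carrier F \<Longrightarrow> \<kappa> b (a \<odot>\<^bsub>F\<^esub> x) = a \<otimes> \<kappa> b x"
    and "\<And>b b'. b \<in> B \<Longrightarrow> b' \<in> B \<Longrightarrow> \<kappa> b b' = (if b = b' then \<one> else \<zero>)"
    and "\<And>x. x \<in> carrier F \<Longrightarrow> x = (\<Oplus>\<^bsub>F\<^esub>b\<in>B. \<kappa> b x \<odot>\<^bsub>F\<^esub> b)"
proof -
  interpret F: module R F by fact
  have fin: "finite B" and sub: "B \<subseteq> carrier F" using B by (auto simp: is_basis_def)
  define lc where "lc = (\<lambda>c. \<Oplus>\<^bsub>F\<^esub>b\<in>B. c b \<odot>\<^bsub>F\<^esub> b)"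
  define \<kappa> where "\<kappa> = (\<lambda>x. THE c. c \<in> B \<rightarrow>\<^sub>E carrier R \<and> x = lc c)"
  have ex1: "\<exists>!c. c \<in> B \<rightarrow>\<^sub>E carrier R \<and> x = lc c" if "x \<in> carrier F" for x
    using B that unfolding is_basis_def lc_def by blast
  have \<kappa>: "\<kappa> x \<in> B \<rightarrow>\<^sub>E carrier R" "x = lc (\<kappa> x)" if "x \<in> carrier F" for x
    using theI'[OF ex1[OF that]] unfolding \<kappa>_def by blast+
  have \<kappa>_eq: "\<kappa> x = c" if "x \<in> carrier F" "c \<in> B \<rightarrow>\<^sub>E carrier R" "x = lc c" for x c
    using ex1[OF that(1)] \<kappa>[OF that(1)] that(2,3) by blast
  have \<kappa>_cl: "\<kappa> x b \<in> carrier R" if "x \<in> carrier F" "b \<in> B" for x b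
    using \<kappa>(1)[OF that(1)] that(2) by auto
  have \<kappa>_add: "\<kappa> (x \<oplus>\<^bsub>F\<^esub> y) = (\<lambda>b\<in>B. \<kappa> x b \<oplus> \<kappa> y b)" if x: "x \<in> carrier F" and y: "y \<in> carrier F" for x y
  proof (rule \<kappa>_eq)
    have "lc (\<lambda>b\<in>B. \<kappa> x b \<oplus> \<kappa> y b) = (\<Oplus>\<^bsub>F\<^esub>b\<in>B. \<kappa> x b \<odot>\<^bsub>F\<^esub> b \<oplus>\<^bsub>F\<^esub> \<kappa> y b \<odot>\<^bsub>F\<^esub> b)"
      unfolding lc_def using sub \<kappa>_cl x y
      by (intro F.finsum_cong') (auto simp: F.smult_l_distr subset_iff)
    also have "\<dots> = lc (\<kappa> x) \<oplus>\<^bsub>F\<^esub> lc (\<kappa> y)"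
      unfolding lc_def using sub \<kappa>_cl x y by (intro F.finsum_addf) auto
    finally show "x \<oplus>\<^bsub>F\<^esub> y = lc (\<lambda>b\<in>B. \<kappa> x b \<oplus> \<kappa> y b)"
      using \<kappa>(2)[OF x] \<kappa>(2)[OF y] by simp
  qed (use \<kappa>_cl x y in auto)
  have \<kappa>_smult: "\<kappa> (a \<odot>\<^bsub>F\<^esub> x) = (\<lambda>b\<in>B. a \<otimes> \<kappa> x b)" if a: "a \<in> carrier R" and x: "x \<in> carrier F" for a x
  proof (rule \<kappa>_eq)
    have "lc (\<lambda>b\<in>B. a \<otimes> \<kappa> x b) = (\<Oplus>\<^bsub>F\<^esub>b\<in>B. a \<odot>\<^bsub>F\<^esub> (\<kappa> x b \<odot>\<^bsub>F\<^esub> b))"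
      unfolding lc_def using sub \<kappa>_cl a x
      by (intro F.finsum_cong') (auto simp: F.smult_assoc1 subset_iff)
    also have "\<dots> = a \<odot>\<^bsub>F\<^esub> lc (\<kappa> x)"
      unfolding lc_def using sub \<kappa>_cl a x fin by (intro F.finsum_smult_ldistr[symmetric]) auto
    finally show "a \<odot>\<^bsub>F\<^esub> x = lc (\<lambda>b\<in>B. a \<otimes> \<kappa> x b)" using \<kappa>(2)[OF x] by simp
  qed (use \<kappa>_cl a x in auto)
  have \<kappa>_basis: "\<kappa> b = (\<lambda>b'\<in>B. if b' = b then \<one> else \<zero>)" if b: "b \<in> B" for b
  proof (rule \<kappa>_eq)
    have "lc (\<lambda>b'\<in>B. if b' = b then \<one> else \<zero>) = (\<Oplus>\<^bsub>F\<^esub>b'\<in>B. if b = b' then b' else \<zero>\<^bsub>F\<^esub>)"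
      unfolding lc_def using sub by (intro F.finsum_cong') auto
    also have "\<dots> = b" using b fin sub by (intro F.finsum_singleton) auto
    finally show "b = lc (\<lambda>b'\<in>B. if b' = b then \<one> else \<zero>)" by simp
  qed (use sub b in auto)
  show thesis
  proof (rule that[of "\<lambda>b x. \<kappa> x b"])
    show "x = (\<Oplus>\<^bsub>F\<^esub>b\<in>B. \<kappa> x b \<odot>\<^bsub>F\<^esub> b)" if "x \<in> carrier F" for x
      using \<kappa>(2)[OF that] by (simp only: lc_def)
  qed (auto simp: \<kappa>_cl \<kappa>_add \<kappa>_smult \<kappa>_basis)
qed

lemma basis_hom_extension:
  assumes "module R F" "module R N" and B: "is_basis R F B" and g: "g \<in> B \<rightarrow> carrier N"
  shows "\<exists>f\<in>module_hom R F N. \<forall>b\<in>B. f b = g b"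
proof -
  interpret F: module R F by fact
  interpret N: module R N by fact
  have fin: "finite B" using B by (auto simp: is_basis_def)
  obtain \<kappa> where \<kappa>_cl: "\<And>b x. b \<in> B \<Longrightarrow> x \<in> carrier F \<Longrightarrow> \<kappa> b x \<in> carrier R"
    and \<kappa>_add: "\<And>b x y. b \<in> B \<Longrightarrow> x \<in> carrier F \<Longrightarrow> y \<in> carrier F \<Longrightarrow> \<kappa> b (x \<oplus>\<^bsub>F\<^esub> y) = \<kappa> b x \<oplus>\<^bsub>R\<^esub> \<kappa> b y"
    and \<kappa>_smult: "\<And>b a x. b \<in> B \<Longrightarrow> a \<in> carrier R \<Longrightarrow> x \<in> carrier F \<Longrightarrow> \<kappa> b (a \<odot>\<^bsub>F\<^esub> x) = a \<otimes>\<^bsub>R\<^esub> \<kappa> b x"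
    and \<kappa>_basis: "\<And>b b'. b \<in> B \<Longrightarrow> b' \<in> B \<Longrightarrow> \<kappa> b b' = (if b = b' then \<one>\<^bsub>R\<^esub> else \<zero>\<^bsub>R\<^esub>)"
    by (rule basis_coordinates[OF assms(1) B]) blast
  define f where "f = (\<lambda>x. \<Oplus>\<^bsub>N\<^esub>b\<in>B. \<kappa> b x \<odot>\<^bsub>N\<^esub> g b)"
  have gc: "g b \<in> carrier N" if "b \<in> B" for b using g that by auto
  have "f \<in> module_hom R F N"
  proof (rule module_homI)
    show "f x \<in> carrier N" if "x \<in> carrier F" for x
      unfolding f_def using \<kappa>_cl that gc by (intro N.finsum_closed) auto
    show "f (x \<oplus>\<^bsub>F\<^esub> y) = f x \<oplus>\<^bsub>N\<^esub> f y" if x: "x \<in> carrier F" and y: "y \<in> carrier F" for x y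
    proof -
      have "f (x \<oplus>\<^bsub>F\<^esub> y) = (\<Oplus>\<^bsub>N\<^esub>b\<in>B. \<kappa> b x \<odot>\<^bsub>N\<^esub> g b \<oplus>\<^bsub>N\<^esub> \<kappa> b y \<odot>\<^bsub>N\<^esub> g b)"
        unfolding f_def using \<kappa>_add gc \<kappa>_cl x y
        by (intro N.finsum_cong') (auto simp: N.smult_l_distr)
      also have "\<dots> = f x \<oplus>\<^bsub>N\<^esub> f y"
        unfolding f_def using gc \<kappa>_cl x y by (intro N.finsum_addf) auto
      finally show ?thesis .
    qed
    show "f (a \<odot>\<^bsub>F\<^esub> x) = a \<odot>\<^bsub>N\<^esub> f x" if a: "a \<in> carrier R" and x: "x \<in> carrier F" for a x
    proof -
      have "f (a \<odot>\<^bsub>F\<^esub> x) = (\<Oplus>\<^bsub>N\<^esub>b\<in>B. a \<odot>\<^bsub>N\<^esub> (\<kappa> b x \<odot>\<^bsub>N\<^esub> g b))"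
        unfolding f_def using \<kappa>_smult gc \<kappa>_cl x a
        by (intro N.finsum_cong') (auto simp: N.smult_assoc1)
      also have "\<dots> = a \<odot>\<^bsub>N\<^esub> f x"
        unfolding f_def using gc \<kappa>_cl x a fin by (intro N.finsum_smult_ldistr[symmetric]) auto
      finally show ?thesis .
    qed
  qed
  moreover have "f b = g b" if b: "b \<in> B" for b
  proof -
    have "f b = (\<Oplus>\<^bsub>N\<^esub>b'\<in>B. if b = b' then g b' else \<zero>\<^bsub>N\<^esub>)"
      unfolding f_def using gc b \<kappa>_basis by (intro N.finsum_cong') auto
    also have "\<dots> = g b" using b fin gc by (intro N.finsum_singleton) auto
    finally show ?thesis .
  qed
  ultimately show ?thesis by blast
qed

text \<open>Free modules are projective, in a form that controls where the lift takes its values.\<close>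

lemma basis_lift:
  assumes F: "module R F" and A: "module R A" and N: "module R N" and B: "is_basis R F B"
    and f: "f \<in> module_hom R F N" and d: "d \<in> module_hom R A N" and S: "submodule S R A"
    and im: "\<And>x. x \<in> carrier F \<Longrightarrow> f x \<in> d ` S"
  shows "\<exists>h\<in>module_hom R F A. h ` carrier F \<subseteq> S \<and> (\<forall>x\<in>carrier F. d (h x) = f x)"
proof -
  interpret F: module R F by fact
  interpret A: module R A by fact
  interpret N: module R N by fact
  have sub: "B \<subseteq> carrier F" using B by (auto simp: is_basis_def)
  have SA: "S \<subseteq> carrier A" using A.submoduleE(1)[OF S] .
  have "\<forall>b\<in>B. \<exists>s\<in>S. d s = f b"
  proof
    fix b assume "b \<in> B"
    then have "f b \<in> d ` S" using im sub by blast
    then show "\<exists>s\<in>S. d s = f b" by (metis imageE)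
  qed
  then obtain g where g: "\<And>b. b \<in> B \<Longrightarrow> g b \<in> S" "\<And>b. b \<in> B \<Longrightarrow> d (g b) = f b" by metis
  then have "g \<in> B \<rightarrow> carrier A" using SA by auto
  from basis_hom_extension[OF F A B this] obtain h where h: "h \<in> module_hom R F A"
    and hg: "\<And>b. b \<in> B \<Longrightarrow> h b = g b" by blast
  have "carrier F \<subseteq> {x \<in> carrier F. h x \<in> S}"
    using sub g(1) hg by (intro basis_generates[OF F B submodule_vimage[OF F A h S]]) auto
  moreover have "carrier F \<subseteq> {x \<in> carrier F. d (h x) \<ominus>\<^bsub>N\<^esub> f x \<in> {\<zero>\<^bsub>N\<^esub>}}"
  proof (rule basis_generates[OF F B submodule_vimage[OF F N]])
    show "(\<lambda>x. d (h x) \<ominus>\<^bsub>N\<^esub> f x) \<in> module_hom R F N"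
      by (intro module_hom_minus_fun module_hom_comp[OF h d] f N)
    show "submodule {\<zero>\<^bsub>N\<^esub>} R N" by (rule N.submoduleI) auto
    have "d (h b) \<ominus>\<^bsub>N\<^esub> f b = \<zero>\<^bsub>N\<^esub>" if "b \<in> B" for b
      using that sub g(2) hg module_hom_closed[OF f, of b] by (auto simp: N.r_neg a_minus_def subset_iff)
    then show "B \<subseteq> {x \<in> carrier F. d (h x) \<ominus>\<^bsub>N\<^esub> f x \<in> {\<zero>\<^bsub>N\<^esub>}}"
      using sub by auto
  qed
  then have "d (h x) = f x" if "x \<in> carrier F" for x
  proof -
    have "d (h x) \<ominus>\<^bsub>N\<^esub> f x = \<zero>\<^bsub>N\<^esub>" using calculation that \<open>carrier F \<subseteq> {x \<in> carrier F. d (h x) \<ominus>\<^bsub>N\<^esub> f x \<in> {\<zero>\<^bsub>N\<^esub>}}\<close> by auto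
    moreover have "f x \<in> carrier N" "d (h x) \<in> carrier N"
      using module_hom_closed[OF f that] module_hom_closed[OF d module_hom_closed[OF h that]] by auto
    ultimately show ?thesis using N.minus_eq_iff[of "d (h x)" "f x" "\<zero>\<^bsub>N\<^esub>"] by simp
  qed
  ultimately show ?thesis using h by blast
qed

text \<open>A system of coordinate functionals dual to \<open>B\<close> forces the coefficients of an expansion, and so gives
  the uniqueness part of the definition of a basis.\<close>

lemma is_basisI:
  assumes "module R M" and fin: "finite B" and sub: "B \<subseteq> carrier M"
    and cl: "\<And>b x. b \<in> B \<Longrightarrow> x \<in> carrier M \<Longrightarrow> \<kappa> b x \<in> carrier R"
    and add: "\<And>b x y. b \<in> B \<Longrightarrow> x \<in> carrier M \<Longrightarrow> y \<in> carrier M \<Longrightarrow> \<kappa> b (x \<oplus>\<^bsub>M\<^esub> y) = \<kappa> b x \<oplus>\<^bsub>R\<^esub> \<kappa> b y"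
    and smult: "\<And>b a x. b \<in> B \<Longrightarrow> a \<in> carrier R \<Longrightarrow> x \<in> carrier M \<Longrightarrow> \<kappa> b (a \<odot>\<^bsub>M\<^esub> x) = a \<otimes>\<^bsub>R\<^esub> \<kappa> b x"
    and delta: "\<And>b b'. b \<in> B \<Longrightarrow> b' \<in> B \<Longrightarrow> \<kappa> b b' = (if b = b' then \<one>\<^bsub>R\<^esub> else \<zero>\<^bsub>R\<^esub>)"
    and repr: "\<And>x. x \<in> carrier M \<Longrightarrow> x = (\<Oplus>\<^bsub>M\<^esub>b\<in>B. \<kappa> b x \<odot>\<^bsub>M\<^esub> b)"
  shows "is_basis R M B"
proof -
  interpret M: module R M by fact
  have zero: "\<kappa> b \<zero>\<^bsub>M\<^esub> = \<zero>\<^bsub>R\<^esub>" if "b \<in> B" for b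
    using smult[OF that, of "\<zero>\<^bsub>R\<^esub>" "\<zero>\<^bsub>M\<^esub>"] cl[OF that, of "\<zero>\<^bsub>M\<^esub>"] by simp
  have coord: "\<kappa> b (\<Oplus>\<^bsub>M\<^esub>b'\<in>A. c b' \<odot>\<^bsub>M\<^esub> b') = (if b \<in> A then c b else \<zero>\<^bsub>R\<^esub>)"
    if "finite A" "A \<subseteq> B" "b \<in> B" and c: "c \<in> B \<rightarrow> carrier R" for A b c
    using that(1,2)
  proof (induction A)
    case empty
    then show ?case using that(3) by (simp add: zero)
  next
    case (insert a A)
    have cl': "c b' \<in> carrier R" "b' \<in> carrier M" if "b' \<in> insert a A" for b'
      using that c insert sub by auto
    have s: "(\<Oplus>\<^bsub>M\<^esub>b'\<in>A. c b' \<odot>\<^bsub>M\<^esub> b') \<in> carrier M" using cl' by (intro M.finsum_closed) auto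
    have "(\<Oplus>\<^bsub>M\<^esub>b'\<in>insert a A. c b' \<odot>\<^bsub>M\<^esub> b') = c a \<odot>\<^bsub>M\<^esub> a \<oplus>\<^bsub>M\<^esub> (\<Oplus>\<^bsub>M\<^esub>b'\<in>A. c b' \<odot>\<^bsub>M\<^esub> b')"
      using insert cl' by (intro M.finsum_insert) auto
    then have "\<kappa> b (\<Oplus>\<^bsub>M\<^esub>b'\<in>insert a A. c b' \<odot>\<^bsub>M\<^esub> b') = c a \<otimes>\<^bsub>R\<^esub> \<kappa> b a \<oplus>\<^bsub>R\<^esub> \<kappa> b (\<Oplus>\<^bsub>M\<^esub>b'\<in>A. c b' \<odot>\<^bsub>M\<^esub> b')"
      using cl' s that(3) by (simp add: add smult)
    then show ?case
      using insert that(3) cl' by (auto simp: delta)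
  qed
  have uniq: "\<exists>!c. c \<in> B \<rightarrow>\<^sub>E carrier R \<and> x = (\<Oplus>\<^bsub>M\<^esub>b\<in>B. c b \<odot>\<^bsub>M\<^esub> b)" if x: "x \<in> carrier M" for x
  proof (rule ex1I[of _ "\<lambda>b\<in>B. \<kappa> b x"])
    have "(\<Oplus>\<^bsub>M\<^esub>b\<in>B. (\<lambda>b\<in>B. \<kappa> b x) b \<odot>\<^bsub>M\<^esub> b) = (\<Oplus>\<^bsub>M\<^esub>b\<in>B. \<kappa> b x \<odot>\<^bsub>M\<^esub> b)"
      using cl x sub by (intro M.finsum_cong') auto
    then show "(\<lambda>b\<in>B. \<kappa> b x) \<in> B \<rightarrow>\<^sub>E carrier R \<and> x = (\<Oplus>\<^bsub>M\<^esub>b\<in>B. (\<lambda>b\<in>B. \<kappa> b x) b \<odot>\<^bsub>M\<^esub> b)"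
      using repr[OF x] cl x by auto
  next
    fix c assume c: "c \<in> B \<rightarrow>\<^sub>E carrier R \<and> x = (\<Oplus>\<^bsub>M\<^esub>b\<in>B. c b \<odot>\<^bsub>M\<^esub> b)"
    then have "c \<in> B \<rightarrow> carrier R" by auto
    from coord[OF fin subset_refl _ this] c have "\<kappa> b x = c b" if "b \<in> B" for b using that by simp
    then show "c = (\<lambda>b\<in>B. \<kappa> b x)" using c by (intro ext) (auto simp: PiE_def extensional_def restrict_def)
  qed
  show ?thesis unfolding is_basis_def using fin sub uniq by blast
qed

section \<open>Comparison of minimal free resolutions\<close>

locale ideal_resolution = ring_ideal R m + minimal_free_resolution R m M F d e
  for R :: "('a, 'r) ring_scheme" (structure) and m :: "'a set" and M :: "('a, 'b, 'x) module_scheme"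
    and F :: "nat \<Rightarrow> ('a, 'f, 'y) module_scheme" and d :: "nat \<Rightarrow> 'f \<Rightarrow> 'f" and e :: "'f \<Rightarrow> 'b" +
  assumes target: "module R M"
begin

sublocale minimal_complex R m F d
proof (intro minimal_complex.intro minimal_complex_axioms.intro ring_ideal_axioms)
  fix i
  show "module R (F i)" by (rule modules)
  show "d i \<in> module_hom R (F (Suc i)) (F i)" by (rule diff_hom)
  show "d i ` carrier (F (Suc i)) \<subseteq> mpow R m (Suc 0) (F i)" unfolding mpow_1 by (rule minimal)
qed

sublocale M: module R M by (rule target)

lemmas e_closed = module_hom_closed[OF augmentation_hom]
  and e_add = module_hom_add[OF augmentation_hom]
  and e_zero = module_hom_zero[OF modules target augmentation_hom]
  and e_minus = module_hom_minus[OF modules target augmentation_hom]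

text \<open>The cycles of the augmented complex. In degree \<open>0\<close> these are the kernel of the augmentation,
  so that exactness has the same form in every degree.\<close>

definition aug_cycles :: "nat \<Rightarrow> 'f set"
  where "aug_cycles i = (case i of 0 \<Rightarrow> a_kernel (F 0) M e | Suc j \<Rightarrow> a_kernel (F (Suc j)) (F j) (d j))"

lemma aug_cycles_0: "x \<in> aug_cycles 0 \<longleftrightarrow> x \<in> carrier (F 0) \<and> e x = \<zero>\<^bsub>M\<^esub>"
  by (simp add: aug_cycles_def a_kernel_def')

lemma aug_cycles_Suc: "x \<in> aug_cycles (Suc i) \<longleftrightarrow> x \<in> carrier (F (Suc i)) \<and> d i x = \<zero>\<^bsub>F i\<^esub>"
  by (simp add: aug_cycles_def a_kernel_def')

lemma exact: "d i ` carrier (F (Suc i)) = aug_cycles i"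
  using exact_0 exact_Suc by (cases i) (simp_all add: aug_cycles_def)

lemma d_cycle: "x \<in> carrier (F (Suc i)) \<Longrightarrow> d i x \<in> aug_cycles i"
  using exact[of i] by (auto intro: imageI)

lemma d_d: "x \<in> carrier (F (Suc (Suc i))) \<Longrightarrow> d i (d (Suc i) x) = \<zero>\<^bsub>F i\<^esub>"
  using d_cycle[of x "Suc i"] by (simp add: aug_cycles_Suc)

lemma e_d: "x \<in> carrier (F (Suc 0)) \<Longrightarrow> e (d 0 x) = \<zero>\<^bsub>M\<^esub>"
  using d_cycle[of x 0] by (simp add: aug_cycles_0)

lemma aug_cycles_lift:
  assumes "x \<in> aug_cycles i" obtains y where "y \<in> carrier (F (Suc i))" "d i y = x"
  using assms unfolding exact[symmetric] by (elim imageE) simp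

end

text \<open>The comparison theorem. The submodules \<open>S i\<close> record where the chain map is to take its values;
  besides the whole modules, the choice \<open>m G\<close> will be needed.\<close>

lemma comparison_map:
  fixes R (structure)
  assumes F: "ideal_resolution R m M F d e" and G: "ideal_resolution R m P G d' e'"
    and f: "f \<in> module_hom R M P"
    and S: "\<And>i. submodule (S i) R (G i)"
    and base: "\<And>x. x \<in> carrier (F 0) \<Longrightarrow> f (e x) \<in> e' ` S 0"
    and step: "\<And>i \<phi> x. \<phi> \<in> module_hom R (F i) (G i) \<Longrightarrow> \<phi> ` carrier (F i) \<subseteq> S i \<Longrightarrow>
      x \<in> carrier (F (Suc i)) \<Longrightarrow> \<phi> (d i x) \<in> ideal_resolution.aug_cycles P G d' e' i \<Longrightarrow>
      \<phi> (d i x) \<in> d' i ` S (Suc i)"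
  shows "\<exists>\<phi>. (\<forall>i. \<phi> i \<in> module_hom R (F i) (G i) \<and> \<phi> i ` carrier (F i) \<subseteq> S i) \<and>
    (\<forall>x\<in>carrier (F 0). e' (\<phi> 0 x) = f (e x)) \<and>
    (\<forall>i. \<forall>x\<in>carrier (F (Suc i)). d' i (\<phi> (Suc i) x) = \<phi> i (d i x))"
proof -
  interpret F: ideal_resolution R m M F d e by fact
  interpret G: ideal_resolution R m P G d' e' by fact
  \<comment> \<open>The map in the next degree exists because the composite with the differential consists of
    cycles; this is carried along as part of the invariant.\<close>
  define Good where "Good i \<phi> \<longleftrightarrow> \<phi> \<in> module_hom R (F i) (G i) \<and> \<phi> ` carrier (F i) \<subseteq> S i \<and>
     (\<forall>x\<in>carrier (F (Suc i)). \<phi> (d i x) \<in> G.aug_cycles i) \<and>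
     (i = 0 \<longrightarrow> (\<forall>x\<in>carrier (F 0). e' (\<phi> x) = f (e x)))" for i \<phi>
  define Comm where "Comm i \<phi> \<psi> \<longleftrightarrow> (\<forall>x\<in>carrier (F (Suc i)). d' i (\<psi> x) = \<phi> (d i x))" for i \<phi> \<psi>
  have "\<exists>\<phi>. \<forall>i. Good i (\<phi> i) \<and> Comm i (\<phi> i) (\<phi> (Suc i))"
  proof (rule dependent_nat_choice)
    obtain B where B: "is_basis R (F 0) B" using F.free by blast
    have "\<exists>h\<in>module_hom R (F 0) (G 0). h ` carrier (F 0) \<subseteq> S 0 \<and> (\<forall>x\<in>carrier (F 0). e' (h x) = f (e x))"
      by (rule basis_lift[OF F.modules G.modules G.target B
            module_hom_comp[OF F.augmentation_hom f] G.augmentation_hom S base])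
    then obtain h where h: "h \<in> module_hom R (F 0) (G 0)" "h ` carrier (F 0) \<subseteq> S 0"
      "\<And>x. x \<in> carrier (F 0) \<Longrightarrow> e' (h x) = f (e x)" by blast
    have "h (d 0 x) \<in> G.aug_cycles 0" if x: "x \<in> carrier (F (Suc 0))" for x
      unfolding G.aug_cycles_0 using h(3)[OF F.d_closed[OF x]] module_hom_closed[OF h(1) F.d_closed[OF x]] F.e_d[OF x]
        module_hom_zero[OF F.target G.target f] by simp
    with h show "\<exists>\<phi>. Good 0 \<phi>" unfolding Good_def by blast
  next
    fix \<phi> i assume good: "Good i \<phi>"
    then have \<phi>: "\<phi> \<in> module_hom R (F i) (G i)" "\<phi> ` carrier (F i) \<subseteq> S i"
      and cyc: "\<And>x. x \<in> carrier (F (Suc i)) \<Longrightarrow> \<phi> (d i x) \<in> G.aug_cycles i"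
      unfolding Good_def by blast+
    obtain B where B: "is_basis R (F (Suc i)) B" using F.free by blast
    have "\<exists>h\<in>module_hom R (F (Suc i)) (G (Suc i)). h ` carrier (F (Suc i)) \<subseteq> S (Suc i) \<and>
        (\<forall>x\<in>carrier (F (Suc i)). d' i (h x) = \<phi> (d i x))"
      by (rule basis_lift[OF F.modules G.modules G.modules B
            module_hom_comp[OF F.diff_hom \<phi>(1)] G.diff_hom S step[OF \<phi> _ cyc]])
    then obtain h where h: "h \<in> module_hom R (F (Suc i)) (G (Suc i))" "h ` carrier (F (Suc i)) \<subseteq> S (Suc i)"
      "\<And>x. x \<in> carrier (F (Suc i)) \<Longrightarrow> d' i (h x) = \<phi> (d i x)" by blast
    have "h (d (Suc i) x) \<in> G.aug_cycles (Suc i)" if x: "x \<in> carrier (F (Suc (Suc i)))" for x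
      unfolding G.aug_cycles_Suc using h(3)[OF F.d_closed[OF x]] module_hom_closed[OF h(1) F.d_closed[OF x]] F.d_d[OF x]
        module_hom_zero[OF F.modules G.modules \<phi>(1)] by simp
    with h have "Good (Suc i) h" "Comm i \<phi> h" unfolding Good_def Comm_def by blast+
    then show "\<exists>\<psi>. Good (Suc i) \<psi> \<and> Comm i \<phi> \<psi>" by blast
  qed
  then obtain \<phi> where "\<And>i. Good i (\<phi> i)" "\<And>i. Comm i (\<phi> i) (\<phi> (Suc i))" by blast
  then show ?thesis unfolding Good_def Comm_def by (intro exI[of _ \<phi>]) simp
qed

text \<open>A chain endomorphism of a free resolution lifting zero is homotopic to zero. The formula
  \<open>d h = \<psi> - h d\<close> is recorded in positive degrees only, where it will be applied; the invariant
  \<open>d h d = \<psi> d\<close> makes \<open>\<psi> - h d\<close> take its values in cycles.\<close>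

lemma null_homotopy:
  fixes R (structure)
  assumes F: "ideal_resolution R m M F d e"
    and hom: "\<And>i. \<psi> i \<in> module_hom R (F i) (F i)"
    and aug: "\<And>x. x \<in> carrier (F 0) \<Longrightarrow> e (\<psi> 0 x) = \<zero>\<^bsub>M\<^esub>"
    and comm: "\<And>i x. x \<in> carrier (F (Suc i)) \<Longrightarrow> d i (\<psi> (Suc i) x) = \<psi> i (d i x)"
  shows "\<exists>h. (\<forall>i. h i \<in> module_hom R (F i) (F (Suc i))) \<and>
    (\<forall>i. \<forall>x\<in>carrier (F (Suc i)). d (Suc i) (h (Suc i) x) = \<psi> (Suc i) x \<ominus>\<^bsub>F (Suc i)\<^esub> h i (d i x))"
proof -
  interpret F: ideal_resolution R m M F d e by fact
  define Good where "Good i h \<longleftrightarrow> h \<in> module_hom R (F i) (F (Suc i)) \<and>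
     (\<forall>x\<in>carrier (F (Suc i)). d i (h (d i x)) = \<psi> i (d i x))" for i h
  define Comm where "Comm i h h' \<longleftrightarrow>
     (\<forall>x\<in>carrier (F (Suc i)). d (Suc i) (h' x) = \<psi> (Suc i) x \<ominus>\<^bsub>F (Suc i)\<^esub> h (d i x))" for i h h'
  have lift: "\<exists>h\<in>module_hom R (F i) (F (Suc i)). \<forall>x\<in>carrier (F i). d i (h x) = g x"
    if g: "g \<in> module_hom R (F i) (F i)" and cyc: "\<And>x. x \<in> carrier (F i) \<Longrightarrow> g x \<in> F.aug_cycles i" for i g
  proof -
    obtain B where B: "is_basis R (F i) B" using F.free by blast
    have "g x \<in> d i ` carrier (F (Suc i))" if "x \<in> carrier (F i)" for x
      using cyc[OF that] unfolding F.exact .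
    from basis_lift[OF F.modules F.modules F.modules B g F.diff_hom F.F.carrier_is_submodule this]
    show ?thesis by blast
  qed
  have "\<exists>h. \<forall>i. Good i (h i) \<and> Comm i (h i) (h (Suc i))"
  proof (rule dependent_nat_choice)
    have "\<psi> 0 x \<in> F.aug_cycles 0" if "x \<in> carrier (F 0)" for x
      unfolding F.aug_cycles_0 using aug[OF that] module_hom_closed[OF hom that] by simp
    from lift[OF hom this] show "\<exists>h. Good 0 h" unfolding Good_def using F.d_closed by blast
  next
    fix h i assume "Good i h"
    then have h: "h \<in> module_hom R (F i) (F (Suc i))"
      and good: "\<And>x. x \<in> carrier (F (Suc i)) \<Longrightarrow> d i (h (d i x)) = \<psi> i (d i x)"
      unfolding Good_def by blast+
    let ?g = "\<lambda>x. \<psi> (Suc i) x \<ominus>\<^bsub>F (Suc i)\<^esub> h (d i x)"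
    have g: "?g \<in> module_hom R (F (Suc i)) (F (Suc i))"
      by (intro module_hom_minus_fun F.modules hom module_hom_comp[OF F.diff_hom h])
    have "?g x \<in> F.aug_cycles (Suc i)" if x: "x \<in> carrier (F (Suc i))" for x
    proof -
      note cl = module_hom_closed[OF hom x] module_hom_closed[OF h F.d_closed[OF x]]
      have "d i (?g x) = d i (\<psi> (Suc i) x) \<ominus>\<^bsub>F i\<^esub> d i (h (d i x))"
        by (rule F.d_minus) (use cl in auto)
      also have "\<dots> = \<zero>\<^bsub>F i\<^esub>"
        using good[OF x] comm[OF x] module_hom_closed[OF hom F.d_closed[OF x]]
        by (simp add: a_minus_def F.F.r_neg)
      finally show ?thesis
        unfolding F.aug_cycles_Suc using module_hom_closed[OF g x] by simp
    qed
    from lift[OF g this] obtain h' where h': "h' \<in> module_hom R (F (Suc i)) (F (Suc (Suc i)))"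
      "\<And>x. x \<in> carrier (F (Suc i)) \<Longrightarrow> d (Suc i) (h' x) = ?g x" by blast
    have "d (Suc i) (h' (d (Suc i) x)) = \<psi> (Suc i) (d (Suc i) x)" if x: "x \<in> carrier (F (Suc (Suc i)))" for x
      using h'(2)[OF F.d_closed[OF x]] F.d_d[OF x] module_hom_zero[OF F.modules F.modules h]
        module_hom_closed[OF hom F.d_closed[OF x]]
      by (simp add: a_minus_def F.F.add.inv_one)
    with h' have "Good (Suc i) h'" "Comm i h h'" unfolding Good_def Comm_def by blast+
    then show "\<exists>h'. Good (Suc i) h' \<and> Comm i h h'" by blast
  qed
  then obtain h where "\<And>i. Good i (h i)" "\<And>i. Comm i (h i) (h (Suc i))" by blast
  then show ?thesis unfolding Good_def Comm_def by (intro exI[of _ h]) simp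
qed

text \<open>A homotopy raises the homological degree, hence the degree in the filtration; the error
  term \<open>d h + h d\<close> in the comparison of \<open>F\<close> with itself through \<open>G\<close> is therefore
  invisible to the linear part. This replaces the uniqueness of minimal resolutions up to isomorphism
  and works in the same way in the local and in the graded situation.\<close>

lemma lin_exact_transfer:
  assumes F: "ideal_resolution R m M F d e" and G: "ideal_resolution R m M G d' e'"
    and lin: "lin_exact R m G d' i"
  shows "lin_exact R m F d i"
proof -
  interpret F: ideal_resolution R m M F d e by fact
  interpret G: ideal_resolution R m M G d' e' by fact
  have "\<exists>f. (\<forall>i. f i \<in> module_hom R (F i) (G i) \<and> f i ` carrier (F i) \<subseteq> carrier (G i)) \<and>
    (\<forall>x\<in>carrier (F 0). e' (f 0 x) = e x) \<and>
    (\<forall>i. \<forall>x\<in>carrier (F (Suc i)). d' i (f (Suc i) x) = f i (d i x))"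
    by (rule comparison_map[OF F G module_hom_id, where S = "\<lambda>i. carrier (G i)"])
      (use G.F.carrier_is_submodule F.e_closed G.augmentation_surj G.exact in auto)
  then obtain f where f: "\<And>i. f i \<in> module_hom R (F i) (G i)" "\<And>x. x \<in> carrier (F 0) \<Longrightarrow> e' (f 0 x) = e x"
    "\<And>i x. x \<in> carrier (F (Suc i)) \<Longrightarrow> d' i (f (Suc i) x) = f i (d i x)" by blast
  have "\<exists>g. (\<forall>i. g i \<in> module_hom R (G i) (F i) \<and> g i ` carrier (G i) \<subseteq> carrier (F i)) \<and>
    (\<forall>x\<in>carrier (G 0). e (g 0 x) = e' x) \<and>
    (\<forall>i. \<forall>x\<in>carrier (G (Suc i)). d i (g (Suc i) x) = g i (d' i x))"
    by (rule comparison_map[OF G F module_hom_id, where S = "\<lambda>i. carrier (F i)"])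
      (use F.F.carrier_is_submodule G.e_closed F.augmentation_surj F.exact in auto)
  then obtain g where g: "\<And>i. g i \<in> module_hom R (G i) (F i)" "\<And>x. x \<in> carrier (G 0) \<Longrightarrow> e (g 0 x) = e' x"
    "\<And>i x. x \<in> carrier (G (Suc i)) \<Longrightarrow> d i (g (Suc i) x) = g i (d' i x)" by blast
  define \<psi> where "\<psi> i = (\<lambda>x. g i (f i x) \<ominus>\<^bsub>F i\<^esub> x)" for i
  have gf: "g i (f i x) \<in> carrier (F i)" if "x \<in> carrier (F i)" for i x
    using module_hom_closed[OF g(1) module_hom_closed[OF f(1) that]] .
  have \<psi>: "\<psi> i \<in> module_hom R (F i) (F i)" for i
    unfolding \<psi>_def by (intro module_hom_minus_fun F.modules module_hom_id module_hom_comp[OF f(1) g(1)])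
  have "\<exists>h. (\<forall>i. h i \<in> module_hom R (F i) (F (Suc i))) \<and>
    (\<forall>i. \<forall>x\<in>carrier (F (Suc i)). d (Suc i) (h (Suc i) x) = \<psi> (Suc i) x \<ominus>\<^bsub>F (Suc i)\<^esub> h i (d i x))"
  proof (rule null_homotopy[OF F \<psi>])
    fix x assume x: "x \<in> carrier (F 0)"
    then have "e (\<psi> 0 x) = e (g 0 (f 0 x)) \<ominus>\<^bsub>M\<^esub> e x"
      unfolding \<psi>_def using gf by (intro F.e_minus) auto
    then show "e (\<psi> 0 x) = \<zero>\<^bsub>M\<^esub>"
      using x g(2)[OF module_hom_closed[OF f(1) x]] f(2)[OF x] F.e_closed[OF x]
      by (simp add: a_minus_def F.M.r_neg)
  next
    fix i x assume x: "x \<in> carrier (F (Suc i))"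
    then have "d i (\<psi> (Suc i) x) = d i (g (Suc i) (f (Suc i) x)) \<ominus>\<^bsub>F i\<^esub> d i x"
      unfolding \<psi>_def using gf by (intro F.d_minus) auto
    then show "d i (\<psi> (Suc i) x) = \<psi> i (d i x)"
      using x g(3)[OF module_hom_closed[OF f(1) x]] f(3)[OF x] by (simp add: \<psi>_def)
  qed
  then obtain h where h: "\<And>i. h i \<in> module_hom R (F i) (F (Suc i))"
    "\<And>i x. x \<in> carrier (F (Suc i)) \<Longrightarrow> d (Suc i) (h (Suc i) x) = \<psi> (Suc i) x \<ominus>\<^bsub>F (Suc i)\<^esub> h i (d i x)"
    by blast
  show ?thesis
    unfolding lin_exact_def
  proof (intro allI ballI impI)
    fix p x assume x: "x \<in> mpow R m p (F (Suc i))" and dx: "d i x \<in> mpow R m (Suc (Suc p)) (F i)"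
    have xc: "x \<in> carrier (F (Suc i))" by (rule F.mpow_closed[OF F.modules x])
    have "f (Suc i) x \<in> mpow R m p (G (Suc i))"
      by (rule F.hom_mpow[OF F.modules G.modules f(1) x])
    moreover have "d' i (f (Suc i) x) \<in> mpow R m (Suc (Suc p)) (G i)"
      unfolding f(3)[OF xc] by (rule F.hom_mpow[OF F.modules G.modules f(1) dx])
    ultimately obtain y z where y: "y \<in> mpow R m (p - 1) (G (Suc (Suc i)))"
      and z: "z \<in> mpow R m (Suc p) (G (Suc i))" and fx: "f (Suc i) x = d' (Suc i) y \<oplus>\<^bsub>G (Suc i)\<^esub> z"
      by (rule lin_exactD[OF lin])
    note yc = F.mpow_closed[OF G.modules y] and zc = F.mpow_closed[OF G.modules z]
    let ?C = "d (Suc i) (g (Suc (Suc i)) y)" and ?D = "g (Suc i) z"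
      and ?A = "d (Suc i) (h (Suc i) x)" and ?B = "h i (d i x)"
    have gy: "g (Suc (Suc i)) y \<in> mpow R m (p - 1) (F (Suc (Suc i)))"
      by (rule F.hom_mpow[OF G.modules F.modules g(1) y])
    have hx: "h (Suc i) x \<in> mpow R m (p - 1) (F (Suc (Suc i)))"
      using F.hom_mpow[OF F.modules F.modules h(1) x] by (rule F.mpow_mono_mem) simp
    have D: "?D \<in> mpow R m (Suc p) (F (Suc i))"
      by (rule F.hom_mpow[OF G.modules F.modules g(1) z])
    have B: "?B \<in> mpow R m (Suc p) (F (Suc i))"
      using F.hom_mpow[OF F.modules F.modules h(1) dx] by (rule F.mpow_mono_mem) simp
    have "g (Suc i) (f (Suc i) x) = ?C \<oplus>\<^bsub>F (Suc i)\<^esub> ?D"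
      unfolding fx using module_hom_add[OF g(1) G.d_closed[OF yc] zc] g(3)[OF yc] by simp
    then have "?A = (?C \<oplus>\<^bsub>F (Suc i)\<^esub> ?D) \<ominus>\<^bsub>F (Suc i)\<^esub> x \<ominus>\<^bsub>F (Suc i)\<^esub> ?B"
      using h(2)[OF xc] by (simp add: \<psi>_def)
    then have "x = (?C \<ominus>\<^bsub>F (Suc i)\<^esub> ?A) \<oplus>\<^bsub>F (Suc i)\<^esub> (?D \<ominus>\<^bsub>F (Suc i)\<^esub> ?B)"
      using xc F.mpow_closed[OF F.modules B] F.d_closed[OF F.mpow_closed[OF F.modules gy]]
        F.mpow_closed[OF F.modules D] by (rule F.F.diff_regroup)
    also have "?C \<ominus>\<^bsub>F (Suc i)\<^esub> ?A = d (Suc i) (g (Suc (Suc i)) y \<ominus>\<^bsub>F (Suc (Suc i))\<^esub> h (Suc i) x)"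
      using F.mpow_closed[OF F.modules gy] F.mpow_closed[OF F.modules hx] by (rule F.d_minus[symmetric])
    finally show "\<exists>y\<in>mpow R m (p - 1) (F (Suc (Suc i))). \<exists>z\<in>mpow R m (Suc p) (F (Suc i)).
        x = d (Suc i) y \<oplus>\<^bsub>F (Suc i)\<^esub> z"
      using F.mpow_minus[OF F.modules gy hx] F.mpow_minus[OF F.modules D B] by blast
  qed
qed

section \<open>Products of modules\<close>

definition prod_module :: "('a, 'b, 'x) module_scheme \<Rightarrow> ('a, 'c, 'y) module_scheme \<Rightarrow> ('a, 'b \<times> 'c) module"
  where "prod_module M N =
    \<lparr>carrier = carrier M \<times> carrier N, monoid.mult = undefined, one = undefined,
     ring.zero = (\<zero>\<^bsub>M\<^esub>, \<zero>\<^bsub>N\<^esub>), ring.add = (\<lambda>x y. (fst x \<oplus>\<^bsub>M\<^esub> fst y, snd x \<oplus>\<^bsub>N\<^esub> snd y)),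
     smult = (\<lambda>a x. (a \<odot>\<^bsub>M\<^esub> fst x, a \<odot>\<^bsub>N\<^esub> snd x))\<rparr>"

lemma prod_module_simps [simp]:
  "carrier (prod_module M N) = carrier M \<times> carrier N"
  "\<zero>\<^bsub>prod_module M N\<^esub> = (\<zero>\<^bsub>M\<^esub>, \<zero>\<^bsub>N\<^esub>)"
  "x \<oplus>\<^bsub>prod_module M N\<^esub> y = (fst x \<oplus>\<^bsub>M\<^esub> fst y, snd x \<oplus>\<^bsub>N\<^esub> snd y)"
  "a \<odot>\<^bsub>prod_module M N\<^esub> x = (a \<odot>\<^bsub>M\<^esub> fst x, a \<odot>\<^bsub>N\<^esub> snd x)"
  by (simp_all add: prod_module_def)

lemma module_prod_module:
  assumes "module R M" "module R N" shows "module R (prod_module M N)"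
proof -
  interpret M: module R M by fact
  interpret N: module R N by fact
  show ?thesis
  proof (rule moduleI)
    show "abelian_group (prod_module M N)"
    proof (rule abelian_groupI)
      fix x assume "x \<in> carrier (prod_module M N)"
      then show "\<exists>y\<in>carrier (prod_module M N). y \<oplus>\<^bsub>prod_module M N\<^esub> x = \<zero>\<^bsub>prod_module M N\<^esub>"
        by (intro bexI[of _ "(\<ominus>\<^bsub>M\<^esub> fst x, \<ominus>\<^bsub>N\<^esub> snd x)"]) (auto simp: M.l_neg N.l_neg)
    qed (auto simp: M.a_ac N.a_ac)
  qed (auto simp: M.R.is_cring M.smult_l_distr N.smult_l_distr M.smult_r_distr N.smult_r_distr
      M.smult_assoc1 N.smult_assoc1)
qed

lemma
  shows fst_hom: "fst \<in> module_hom R (prod_module M N) M"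
    and snd_hom: "snd \<in> module_hom R (prod_module M N) N"
  by (auto intro!: module_homI)

lemma
  assumes "module R M" "module R N"
  shows inl_hom: "(\<lambda>x. (x, \<zero>\<^bsub>N\<^esub>)) \<in> module_hom R M (prod_module M N)"
    and inr_hom: "(\<lambda>y. (\<zero>\<^bsub>M\<^esub>, y)) \<in> module_hom R N (prod_module M N)"
proof -
  interpret M: module R M by fact
  interpret N: module R N by fact
  show "(\<lambda>x. (x, \<zero>\<^bsub>N\<^esub>)) \<in> module_hom R M (prod_module M N)"
    "(\<lambda>y. (\<zero>\<^bsub>M\<^esub>, y)) \<in> module_hom R N (prod_module M N)"
    by (auto intro!: module_homI)
qed

lemma (in ring_ideal) mpow_prod_module:
  assumes M: "module R M" and N: "module R N"
  shows "mpow R m p (prod_module M N) = mpow R m p M \<times> mpow R m p N"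
proof
  interpret M: module R M by fact
  interpret N: module R N by fact
  note MN = module_prod_module[OF M N]
  show "mpow R m p (prod_module M N) \<subseteq> mpow R m p M \<times> mpow R m p N"
  proof
    fix x assume x: "x \<in> mpow R m p (prod_module M N)"
    show "x \<in> mpow R m p M \<times> mpow R m p N"
      using hom_mpow[OF MN M fst_hom x] hom_mpow[OF MN N snd_hom x] by (simp add: mem_Times_iff)
  qed
  show "mpow R m p M \<times> mpow R m p N \<subseteq> mpow R m p (prod_module M N)"
  proof clarify
    fix x y assume x: "x \<in> mpow R m p M" and y: "y \<in> mpow R m p N"
    have "(x, \<zero>\<^bsub>N\<^esub>) \<oplus>\<^bsub>prod_module M N\<^esub> (\<zero>\<^bsub>M\<^esub>, y) \<in> mpow R m p (prod_module M N)"
      by (rule mpow_add[OF MN hom_mpow[OF M MN inl_hom[OF M N] x] hom_mpow[OF N MN inr_hom[OF M N] y]])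
    then show "(x, y) \<in> mpow R m p (prod_module M N)"
      using mpow_closed[OF M x] mpow_closed[OF N y] by simp
  qed
qed

lemma prod_module_basis:
  fixes R (structure)
  assumes M: "module R M" and N: "module R N" and ne: "\<one> \<noteq> \<zero>"
    and B: "is_basis R M B" and C: "is_basis R N C"
  shows "is_basis R (prod_module M N) ((\<lambda>b. (b, \<zero>\<^bsub>N\<^esub>)) ` B \<union> (\<lambda>c. (\<zero>\<^bsub>M\<^esub>, c)) ` C)"
proof -
  interpret M: module R M by fact
  interpret N: module R N by fact
  let ?P = "prod_module M N"
  interpret P: module R ?P by (rule module_prod_module[OF M N])
  have fin: "finite B" "B \<subseteq> carrier M" "finite C" "C \<subseteq> carrier N"
    using B C by (auto simp: is_basis_def)
  obtain \<kappa> where \<kappa>: "\<And>b x. b \<in> B \<Longrightarrow> x \<in> carrier M \<Longrightarrow> \<kappa> b x \<in> carrier R"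
      "\<And>b x y. b \<in> B \<Longrightarrow> x \<in> carrier M \<Longrightarrow> y \<in> carrier M \<Longrightarrow> \<kappa> b (x \<oplus>\<^bsub>M\<^esub> y) = \<kappa> b x \<oplus> \<kappa> b y"
      "\<And>b a x. b \<in> B \<Longrightarrow> a \<in> carrier R \<Longrightarrow> x \<in> carrier M \<Longrightarrow> \<kappa> b (a \<odot>\<^bsub>M\<^esub> x) = a \<otimes> \<kappa> b x"
      "\<And>b b'. b \<in> B \<Longrightarrow> b' \<in> B \<Longrightarrow> \<kappa> b b' = (if b = b' then \<one> else \<zero>)"
      "\<And>x. x \<in> carrier M \<Longrightarrow> x = (\<Oplus>\<^bsub>M\<^esub>b\<in>B. \<kappa> b x \<odot>\<^bsub>M\<^esub> b)"
    by (rule basis_coordinates[OF M B]) blast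
  obtain \<mu> where \<mu>: "\<And>b x. b \<in> C \<Longrightarrow> x \<in> carrier N \<Longrightarrow> \<mu> b x \<in> carrier R"
      "\<And>b x y. b \<in> C \<Longrightarrow> x \<in> carrier N \<Longrightarrow> y \<in> carrier N \<Longrightarrow> \<mu> b (x \<oplus>\<^bsub>N\<^esub> y) = \<mu> b x \<oplus> \<mu> b y"
      "\<And>b a x. b \<in> C \<Longrightarrow> a \<in> carrier R \<Longrightarrow> x \<in> carrier N \<Longrightarrow> \<mu> b (a \<odot>\<^bsub>N\<^esub> x) = a \<otimes> \<mu> b x"
      "\<And>b b'. b \<in> C \<Longrightarrow> b' \<in> C \<Longrightarrow> \<mu> b b' = (if b = b' then \<one> else \<zero>)"
      "\<And>x. x \<in> carrier N \<Longrightarrow> x = (\<Oplus>\<^bsub>N\<^esub>b\<in>C. \<mu> b x \<odot>\<^bsub>N\<^esub> b)"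
    by (rule basis_coordinates[OF N C]) blast
  have \<kappa>0: "\<kappa> b \<zero>\<^bsub>M\<^esub> = \<zero>" if "b \<in> B" for b
    using \<kappa>(3)[OF that, of \<zero> "\<zero>\<^bsub>M\<^esub>"] \<kappa>(1)[OF that, of "\<zero>\<^bsub>M\<^esub>"] by simp
  have \<mu>0: "\<mu> b \<zero>\<^bsub>N\<^esub> = \<zero>" if "b \<in> C" for b
    using \<mu>(3)[OF that, of \<zero> "\<zero>\<^bsub>N\<^esub>"] \<mu>(1)[OF that, of "\<zero>\<^bsub>N\<^esub>"] by simp
  have B0: "\<zero>\<^bsub>M\<^esub> \<notin> B" using \<kappa>(4)[of "\<zero>\<^bsub>M\<^esub>" "\<zero>\<^bsub>M\<^esub>"] \<kappa>0[of "\<zero>\<^bsub>M\<^esub>"] ne by auto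
  have C0: "\<zero>\<^bsub>N\<^esub> \<notin> C" using \<mu>(4)[of "\<zero>\<^bsub>N\<^esub>" "\<zero>\<^bsub>N\<^esub>"] \<mu>0[of "\<zero>\<^bsub>N\<^esub>"] ne by auto
  let ?B = "(\<lambda>b. (b, \<zero>\<^bsub>N\<^esub>)) ` B" and ?C = "(\<lambda>c. (\<zero>\<^bsub>M\<^esub>, c)) ` C"
  define \<nu> where "\<nu> w x = (if fst w \<in> B then \<kappa> (fst w) (fst x) else \<mu> (snd w) (snd x))" for w x
  have \<nu>B: "\<nu> (b, \<zero>\<^bsub>N\<^esub>) x = \<kappa> b (fst x)" if "b \<in> B" for b x using that by (simp add: \<nu>_def)
  have \<nu>C: "\<nu> (\<zero>\<^bsub>M\<^esub>, c) x = \<mu> c (snd x)" for c x using B0 by (simp add: \<nu>_def)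
  show ?thesis
  proof (rule is_basisI[where \<kappa> = \<nu>])
    show "module R ?P" by (rule P.module_axioms)
    show "finite (?B \<union> ?C)" "?B \<union> ?C \<subseteq> carrier ?P" using fin by auto
    show "\<nu> w x \<in> carrier R" if "w \<in> ?B \<union> ?C" "x \<in> carrier ?P" for w x
      using that \<kappa>(1) \<mu>(1) by (auto simp: \<nu>B \<nu>C)
    show "\<nu> w (x \<oplus>\<^bsub>?P\<^esub> y) = \<nu> w x \<oplus> \<nu> w y"
      if "w \<in> ?B \<union> ?C" "x \<in> carrier ?P" "y \<in> carrier ?P" for w x y
      using that \<kappa>(2) \<mu>(2) by (auto simp: \<nu>B \<nu>C)
    show "\<nu> w (a \<odot>\<^bsub>?P\<^esub> x) = a \<otimes> \<nu> w x"
      if "w \<in> ?B \<union> ?C" "a \<in> carrier R" "x \<in> carrier ?P" for w a x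
      using that \<kappa>(3) \<mu>(3) by (auto simp: \<nu>B \<nu>C)
    show "\<nu> w w' = (if w = w' then \<one> else \<zero>)" if "w \<in> ?B \<union> ?C" "w' \<in> ?B \<union> ?C" for w w'
      using that \<kappa>(4) \<mu>(4) \<kappa>0 \<mu>0 B0 C0 by (auto simp: \<nu>B \<nu>C split: if_splits)
    show "x = (\<Oplus>\<^bsub>?P\<^esub>w\<in>?B \<union> ?C. \<nu> w x \<odot>\<^bsub>?P\<^esub> w)" if x: "x \<in> carrier ?P" for x
    proof -
      have x': "fst x \<in> carrier M" "snd x \<in> carrier N" using x by auto
      have "(\<Oplus>\<^bsub>?P\<^esub>w\<in>?B \<union> ?C. \<nu> w x \<odot>\<^bsub>?P\<^esub> w)
        = (\<Oplus>\<^bsub>?P\<^esub>w\<in>?B. \<nu> w x \<odot>\<^bsub>?P\<^esub> w) \<oplus>\<^bsub>?P\<^esub> (\<Oplus>\<^bsub>?P\<^esub>w\<in>?C. \<nu> w x \<odot>\<^bsub>?P\<^esub> w)"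
        using fin B0 C0 x' \<kappa>(1) \<mu>(1) by (intro P.finsum_Un_disjoint) (auto simp: \<nu>B \<nu>C)
      also have "(\<Oplus>\<^bsub>?P\<^esub>w\<in>?B. \<nu> w x \<odot>\<^bsub>?P\<^esub> w) = (\<Oplus>\<^bsub>?P\<^esub>b\<in>B. \<nu> (b, \<zero>\<^bsub>N\<^esub>) x \<odot>\<^bsub>?P\<^esub> (b, \<zero>\<^bsub>N\<^esub>))"
        using fin x' \<kappa>(1) by (intro P.finsum_reindex) (auto simp: \<nu>B inj_on_def)
      also have "\<dots> = (\<Oplus>\<^bsub>?P\<^esub>b\<in>B. (\<kappa> b (fst x) \<odot>\<^bsub>M\<^esub> b, \<zero>\<^bsub>N\<^esub>))"
        using fin x' \<kappa>(1) by (intro P.finsum_cong') (auto simp: \<nu>B)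
      also have "\<dots> = (fst x, \<zero>\<^bsub>N\<^esub>)"
        using fin x' \<kappa>(1) \<kappa>(5)[OF x'(1)]
        by (subst module_hom_finsum[OF M P.module_axioms inl_hom[OF M N], symmetric]) auto
      also have "(\<Oplus>\<^bsub>?P\<^esub>w\<in>?C. \<nu> w x \<odot>\<^bsub>?P\<^esub> w) = (\<Oplus>\<^bsub>?P\<^esub>c\<in>C. \<nu> (\<zero>\<^bsub>M\<^esub>, c) x \<odot>\<^bsub>?P\<^esub> (\<zero>\<^bsub>M\<^esub>, c))"
        using fin x' \<mu>(1) by (intro P.finsum_reindex) (auto simp: \<nu>C inj_on_def)
      also have "\<dots> = (\<Oplus>\<^bsub>?P\<^esub>c\<in>C. (\<zero>\<^bsub>M\<^esub>, \<mu> c (snd x) \<odot>\<^bsub>N\<^esub> c))"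
        using fin x' \<mu>(1) by (intro P.finsum_cong') (auto simp: \<nu>C)
      also have "\<dots> = (\<zero>\<^bsub>M\<^esub>, snd x)"
        using fin x' \<mu>(1) \<mu>(5)[OF x'(2)]
        by (subst module_hom_finsum[OF N P.module_axioms inr_hom[OF M N], symmetric]) auto
      finally show ?thesis using x' by (auto simp: prod_eq_iff)
    qed
  qed
qed

section \<open>The mapping cone\<close>

context ideal_resolution
begin

text \<open>Starting from any preimage, each application of linear exactness moves it one filtration step
  deeper without changing its boundary, and finitely many steps reach the depth \<open>n - 1\<close>.\<close>

lemma lin_exact_strict:
  assumes lin: "lin_exact R m F d i" and x: "x \<in> carrier (F (Suc i))" and dx: "d i x \<in> mpow R m n (F i)"
  shows "\<exists>y\<in>mpow R m (n - 1) (F (Suc i)). d i y = d i x"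
proof -
  have "\<exists>y\<in>mpow R m p (F (Suc i)). d i y = d i x" if "p \<le> n - 1" for p
    using that
  proof (induction p)
    case 0
    show ?case using x by (intro bexI[of _ x]) (simp_all add: mpow_0 modules)
  next
    case (Suc p)
    then obtain y where y: "y \<in> mpow R m p (F (Suc i))" "d i y = d i x" by auto
    have "d i y \<in> mpow R m (Suc (Suc p)) (F i)"
      unfolding y(2) by (rule mpow_mono_mem[OF dx]) (use Suc.prems in simp)
    then obtain w z where w: "w \<in> mpow R m (p - 1) (F (Suc (Suc i)))" and z: "z \<in> mpow R m (Suc p) (F (Suc i))"
      and yw: "y = d (Suc i) w \<oplus>\<^bsub>F (Suc i)\<^esub> z"
      by (rule lin_exactD[OF lin y(1)])
    note wc = mpow_closed[OF modules w] and zc = mpow_closed[OF modules z]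
    have "d i y = d i z"
      unfolding yw using d_add[OF d_closed[OF wc] zc] d_d[OF wc] d_closed[OF zc] by simp
    with y(2) z show ?case by (intro bexI[of _ z]) simp_all
  qed
  then show ?thesis by blast
qed

end

lemma module_hom_pair:
  assumes f: "f \<in> module_hom R M A" and g: "g \<in> module_hom R M B"
  shows "(\<lambda>x. (f x, g x)) \<in> module_hom R M (prod_module A B)"
  by (rule module_homI)
    (simp_all add: module_hom_closed[OF f] module_hom_closed[OF g] module_hom_add[OF f]
      module_hom_add[OF g] module_hom_smult[OF f] module_hom_smult[OF g])

locale mapping_cone =
  F: ideal_resolution R m M F d e + G: ideal_resolution R m P G d' e'
  for R :: "('a, 'r) ring_scheme" (structure) and m :: "'a set"
    and M :: "('a, 'b, 'x) module_scheme" and F :: "nat \<Rightarrow> ('a, 'f, 'u) module_scheme"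
    and d :: "nat \<Rightarrow> 'f \<Rightarrow> 'f" and e :: "'f \<Rightarrow> 'b"
    and P :: "('a, 'c, 'y) module_scheme" and G :: "nat \<Rightarrow> ('a, 'g, 'v) module_scheme"
    and d' :: "nat \<Rightarrow> 'g \<Rightarrow> 'g" and e' :: "'g \<Rightarrow> 'c" +
  fixes N :: "('a, 'd, 'z) module_scheme" and \<alpha> :: "'b \<Rightarrow> 'c" and \<beta> :: "'c \<Rightarrow> 'd" and \<phi> :: "nat \<Rightarrow> 'f \<Rightarrow> 'g"
  assumes quotient: "module R N"
    and seq: "short_exact R M P N \<alpha> \<beta>"
    and nontrivial: "\<one> \<noteq> \<zero>"
    and \<phi>_hom: "\<phi> i \<in> module_hom R (F i) (G i)"
    and \<phi>_shift: "\<phi> i ` carrier (F i) \<subseteq> mpow R m (Suc 0) (G i)"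
    and \<phi>_aug: "x \<in> carrier (F 0) \<Longrightarrow> e' (\<phi> 0 x) = \<alpha> (e x)"
    and \<phi>_comm: "x \<in> carrier (F (Suc i)) \<Longrightarrow> d' i (\<phi> (Suc i) x) = \<phi> i (d i x)"
begin

sublocale N: module R N by (rule quotient)

lemma \<alpha>_hom: "\<alpha> \<in> module_hom R M P" and \<beta>_hom: "\<beta> \<in> module_hom R P N"
  and \<alpha>_inj: "inj_on \<alpha> (carrier M)" and \<alpha>_image: "\<alpha> ` carrier M = a_kernel P N \<beta>"
  and \<beta>_surj: "\<beta> ` carrier P = carrier N"
  using seq by (auto simp: short_exact_def)

lemmas \<phi>_closed = module_hom_closed[OF \<phi>_hom]
  and \<phi>_add = module_hom_add[OF \<phi>_hom]
  and \<phi>_zero = module_hom_zero[OF F.modules G.modules \<phi>_hom]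
  and \<phi>_neg = module_hom_neg[OF F.modules G.modules \<phi>_hom]
  and \<phi>_mpow = F.hom_mpow_Suc[OF F.modules G.modules \<phi>_hom \<phi>_shift]

lemma \<alpha>_zero_iff: "x \<in> carrier M \<Longrightarrow> \<alpha> x = \<zero>\<^bsub>P\<^esub> \<longleftrightarrow> x = \<zero>\<^bsub>M\<^esub>"
  using \<alpha>_inj module_hom_zero[OF F.target G.target \<alpha>_hom] F.M.zero_closed
  unfolding inj_on_def by metis

text \<open>The complex \<open>F\<close> shifted by one, with the zero module in degree \<open>0\<close>, so that all terms of the cone
  are products and have the same type. The sign in the second component of the differential makes the
  two contributions of \<open>\<phi>\<close> to its square cancel.\<close>

definition F1 :: "nat \<Rightarrow> ('a, 'f, 'u) module_scheme"
  where "F1 i = (case i of 0 \<Rightarrow> (F 0)\<lparr>carrier := {\<zero>\<^bsub>F 0\<^esub>}\<rparr> | Suc j \<Rightarrow> F j)"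

definition W :: "nat \<Rightarrow> ('a, 'g \<times> 'f) module"
  where "W i = prod_module (G i) (F1 i)"

definition dW :: "nat \<Rightarrow> 'g \<times> 'f \<Rightarrow> 'g \<times> 'f"
  where "dW i x = (d' i (fst x) \<oplus>\<^bsub>G i\<^esub> \<phi> i (snd x),
     (case i of 0 \<Rightarrow> \<zero>\<^bsub>F 0\<^esub> | Suc j \<Rightarrow> \<ominus>\<^bsub>F j\<^esub> d j (snd x)))"

definition eW :: "'g \<times> 'f \<Rightarrow> 'd"
  where "eW x = \<beta> (e' (fst x))"

lemma F1_Suc [simp]: "F1 (Suc j) = F j" by (simp add: F1_def)

lemma zero_submodule: "submodule {\<zero>\<^bsub>F 0\<^esub>} R (F 0)" by (rule F.F.submoduleI) auto

lemma F1_module: "module R (F1 i)"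
proof (cases i)
  case 0
  then show ?thesis
    using submodule.submodule_is_module[OF zero_submodule F.modules] by (simp add: F1_def)
qed (simp add: F.modules)

lemma F1_0: "carrier (F1 0) = {\<zero>\<^bsub>F 0\<^esub>}" "\<zero>\<^bsub>F1 0\<^esub> = \<zero>\<^bsub>F 0\<^esub>" "x \<oplus>\<^bsub>F1 0\<^esub> y = x \<oplus>\<^bsub>F 0\<^esub> y" "a \<odot>\<^bsub>F1 0\<^esub> x = a \<odot>\<^bsub>F 0\<^esub> x"
  by (simp_all add: F1_def)

lemma F1_basis: "\<exists>B. is_basis R (F1 i) B"
proof (cases i)
  case 0
  interpret Z: module R "F1 0" by (rule F1_module)
  have "is_basis R (F1 0) {}"
    by (rule is_basisI[OF F1_module]) (auto simp: F1_0)
  then show ?thesis using 0 by blast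
qed (simp add: F.free)

lemma W_module: "module R (W i)"
  unfolding W_def by (rule module_prod_module[OF G.modules F1_module])

lemma W_Suc: "carrier (W (Suc i)) = carrier (G (Suc i)) \<times> carrier (F i)"
  by (simp add: W_def)

lemma W_mpow: "mpow R m p (W (Suc i)) = mpow R m p (G (Suc i)) \<times> mpow R m p (F i)"
  by (simp add: W_def F.mpow_prod_module G.modules F.modules)

lemma W_mpow_0: "mpow R m p (W 0) = mpow R m p (G 0) \<times> {\<zero>\<^bsub>F 0\<^esub>}"
  using F.mpow_zero[OF F1_module[of 0], of p] F.mpow_sub[OF F1_module[of 0], of p]
  by (auto simp: W_def F.mpow_prod_module G.modules F1_module F1_0)

lemma dW_0: "dW 0 (g, f) = (d' 0 g \<oplus>\<^bsub>G 0\<^esub> \<phi> 0 f, \<zero>\<^bsub>F 0\<^esub>)"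
  and dW_Suc: "dW (Suc j) (g, f) = (d' (Suc j) g \<oplus>\<^bsub>G (Suc j)\<^esub> \<phi> (Suc j) f, \<ominus>\<^bsub>F j\<^esub> d j f)"
  by (simp_all add: dW_def)

lemma dW_kernel_iff:
  assumes "g \<in> carrier (G (Suc i))" "f \<in> carrier (F i)"
  shows "dW i (g, f) = \<zero>\<^bsub>W i\<^esub> \<longleftrightarrow>
    d' i g \<oplus>\<^bsub>G i\<^esub> \<phi> i f = \<zero>\<^bsub>G i\<^esub> \<and> (i = 0 \<or> f \<in> F.aug_cycles i)"
proof (cases i)
  case 0
  then show ?thesis by (simp add: dW_0 W_def F1_0)
next
  case (Suc j)
  then have "\<ominus>\<^bsub>F j\<^esub> d j f = \<zero>\<^bsub>F j\<^esub> \<longleftrightarrow> d j f = \<zero>\<^bsub>F j\<^esub>"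
    using assms F.d_closed[of f j] by (simp add: F.F.add.inv_eq_1_iff)
  then show ?thesis using assms Suc by (simp add: dW_Suc W_def F.aug_cycles_Suc)
qed

text \<open>In degree \<open>0\<close> the second component is not constrained by the cone differential; there
  the injectivity of \<open>M \<rightarrow> P\<close> provides the missing condition.\<close>

lemma kernel_second_cycle:
  assumes g: "g \<in> carrier (G (Suc 0))" and f: "f \<in> carrier (F 0)"
    and eq: "d' 0 g \<oplus>\<^bsub>G 0\<^esub> \<phi> 0 f = \<zero>\<^bsub>G 0\<^esub>"
  shows "f \<in> F.aug_cycles 0"
proof -
  have "\<zero>\<^bsub>P\<^esub> = e' (d' 0 g \<oplus>\<^bsub>G 0\<^esub> \<phi> 0 f)" using eq G.e_zero by simp
  also have "\<dots> = \<alpha> (e f)"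
    using G.e_add[OF G.d_closed[OF g] \<phi>_closed[OF f]] G.e_d[OF g] \<phi>_aug[OF f]
      module_hom_closed[OF \<alpha>_hom F.e_closed[OF f]] by simp
  finally show ?thesis using \<alpha>_zero_iff[OF F.e_closed[OF f]] f by (simp add: F.aug_cycles_0)
qed

lemma dW_dW: 
  assumes g: "g \<in> carrier (G (Suc (Suc i)))" and f: "f \<in> carrier (F (Suc i))"
  shows "dW i (dW (Suc i) (g, f)) = \<zero>\<^bsub>W i\<^esub>"
proof -
  have "d' i (d' (Suc i) g \<oplus>\<^bsub>G (Suc i)\<^esub> \<phi> (Suc i) f) = \<phi> i (d i f)"
    using G.d_add[OF G.d_closed[OF g] \<phi>_closed[OF f]] G.d_d[OF g] \<phi>_comm[OF f]
      \<phi>_closed[OF F.d_closed[OF f]] by simp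
  then have "d' i (d' (Suc i) g \<oplus>\<^bsub>G (Suc i)\<^esub> \<phi> (Suc i) f) \<oplus>\<^bsub>G i\<^esub> \<phi> i (\<ominus>\<^bsub>F i\<^esub> d i f) = \<zero>\<^bsub>G i\<^esub>"
    using \<phi>_closed[OF F.d_closed[OF f]] by (simp add: \<phi>_neg F.d_closed[OF f] G.F.r_neg)
  moreover have "\<ominus>\<^bsub>F i\<^esub> d i f \<in> F.aug_cycles i"
  proof -
    have "d i (\<ominus>\<^bsub>F (Suc i)\<^esub> f) = \<ominus>\<^bsub>F i\<^esub> d i f" by (rule F.d_neg[OF f])
    with F.d_cycle[of "\<ominus>\<^bsub>F (Suc i)\<^esub> f" i] f show ?thesis by simp
  qed
  ultimately show ?thesis
    unfolding dW_Suc using g f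
    by (subst dW_kernel_iff) (simp_all add: G.d_closed \<phi>_closed F.d_closed)
qed

text \<open>If \<open>(g, f)\<close> is a cycle and \<open>f = d y\<close>, then \<open>g + \<phi> y\<close> is a cycle of \<open>G\<close>; a preimage of it together
  with \<open>- y\<close> is a preimage of \<open>(g, f)\<close>.\<close>

lemma kernel_lift:
  assumes g: "g \<in> carrier (G (Suc i))" and f: "f \<in> carrier (F i)"
    and eq: "d' i g \<oplus>\<^bsub>G i\<^esub> \<phi> i f = \<zero>\<^bsub>G i\<^esub>" and cyc: "f \<in> F.aug_cycles i"
  shows "(g, f) \<in> dW (Suc i) ` carrier (W (Suc (Suc i)))"
proof -
  obtain y where y: "y \<in> carrier (F (Suc i))" "d i y = f" using F.aug_cycles_lift[OF cyc] .
  note \<phi>y = \<phi>_closed[OF y(1)]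
  have "d' i (g \<oplus>\<^bsub>G (Suc i)\<^esub> \<phi> (Suc i) y) = \<zero>\<^bsub>G i\<^esub>"
    using G.d_add[OF g \<phi>y] \<phi>_comm[OF y(1)] y(2) eq by simp
  then have "g \<oplus>\<^bsub>G (Suc i)\<^esub> \<phi> (Suc i) y \<in> G.aug_cycles (Suc i)"
    using g \<phi>y by (simp add: G.aug_cycles_Suc)
  then obtain w where w: "w \<in> carrier (G (Suc (Suc i)))" "d' (Suc i) w = g \<oplus>\<^bsub>G (Suc i)\<^esub> \<phi> (Suc i) y"
    using G.aug_cycles_lift by blast
  have "d' (Suc i) w \<oplus>\<^bsub>G (Suc i)\<^esub> \<phi> (Suc i) (\<ominus>\<^bsub>F (Suc i)\<^esub> y) = g"
    using w(2) g \<phi>y y(1) by (simp add: \<phi>_neg G.F.a_assoc G.F.r_neg)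
  moreover have "\<ominus>\<^bsub>F i\<^esub> d i (\<ominus>\<^bsub>F (Suc i)\<^esub> y) = f"
    using F.d_neg[OF y(1)] y(2) f by simp
  ultimately have "(g, f) = dW (Suc i) (w, \<ominus>\<^bsub>F (Suc i)\<^esub> y)" by (simp add: dW_Suc)
  moreover have "(w, \<ominus>\<^bsub>F (Suc i)\<^esub> y) \<in> carrier (W (Suc (Suc i)))" using w(1) y(1) by (simp add: W_Suc)
  ultimately show ?thesis by (rule image_eqI)
qed

lemma dW_hom: "dW i \<in> module_hom R (W (Suc i)) (W i)"
proof -
  have 1: "(\<lambda>x. d' i (fst x) \<oplus>\<^bsub>G i\<^esub> \<phi> i (snd x)) \<in> module_hom R (W (Suc i)) (G i)"
    unfolding W_def F1_Suc
    by (intro module_hom_add_fun G.modules module_hom_comp[OF fst_hom G.diff_hom] module_hom_comp[OF snd_hom \<phi>_hom])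
  have 2: "(\<lambda>x. case i of 0 \<Rightarrow> \<zero>\<^bsub>F 0\<^esub> | Suc j \<Rightarrow> \<ominus>\<^bsub>F j\<^esub> d j (snd x)) \<in> module_hom R (W (Suc i)) (F1 i)"
  proof (cases i)
    case 0
    then show ?thesis by (intro module_homI) (simp_all add: F1_0)
  next
    case (Suc j)
    have "(\<lambda>x. \<ominus>\<^bsub>F j\<^esub> d j (snd x)) \<in> module_hom R (W (Suc i)) (F j)"
      unfolding W_def F1_Suc Suc
      by (intro module_hom_neg_fun F.modules module_hom_comp[OF snd_hom F.diff_hom])
    then show ?thesis by (simp add: Suc)
  qed
  show ?thesis
    using module_hom_pair[OF 1 2] by (simp add: W_def[of i] dW_def[abs_def])
qed

text \<open>Minimality of the cone is where the values of \<open>\<phi>\<close> in \<open>m G\<close> are needed.\<close>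

lemma dW_shift:
  assumes "x \<in> carrier (W (Suc i))" shows "dW i x \<in> mpow R m (Suc 0) (W i)"
proof -
  obtain g f where x: "x = (g, f)" and g: "g \<in> carrier (G (Suc i))" and f: "f \<in> carrier (F i)"
    using assms by (auto simp: W_Suc)
  have 1: "d' i g \<oplus>\<^bsub>G i\<^esub> \<phi> i f \<in> mpow R m (Suc 0) (G i)"
    using G.diff_minimal[of i] \<phi>_shift[of i] g f by (intro F.mpow_add G.modules) auto
  show ?thesis
  proof (cases i)
    case 0
    then show ?thesis using 1 by (simp add: x dW_0 W_mpow_0)
  next
    case (Suc j)
    have "\<ominus>\<^bsub>F j\<^esub> d j f \<in> mpow R m (Suc 0) (F j)"
      using F.diff_minimal[of j] f Suc by (intro F.mpow_neg F.modules) auto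
    then show ?thesis using 1 Suc by (simp add: x dW_Suc W_mpow)
  qed
qed

lemma eW_hom: "eW \<in> module_hom R (W 0) N"
proof -
  have "(\<lambda>x. \<beta> (e' (fst x))) \<in> module_hom R (W 0) N"
    unfolding W_def
    by (rule module_hom_comp[OF module_hom_comp[OF fst_hom G.augmentation_hom] \<beta>_hom])
  then show ?thesis by (simp add: eW_def[abs_def])
qed

lemma eW_kernel: "dW 0 ` carrier (W (Suc 0)) = a_kernel (W 0) N eW"
proof
  show "dW 0 ` carrier (W (Suc 0)) \<subseteq> a_kernel (W 0) N eW"
  proof
    fix x assume "x \<in> dW 0 ` carrier (W (Suc 0))"
    then obtain g f where x: "x = dW 0 (g, f)" and "(g, f) \<in> carrier (W (Suc 0))"
      by (elim imageE) (metis surj_pair)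
    then have g: "g \<in> carrier (G (Suc 0))" and f: "f \<in> carrier (F 0)" by (simp_all add: W_Suc)
    have "e' (d' 0 g \<oplus>\<^bsub>G 0\<^esub> \<phi> 0 f) = \<alpha> (e f)"
      using G.e_add[OF G.d_closed[OF g] \<phi>_closed[OF f]] G.e_d[OF g] \<phi>_aug[OF f]
        module_hom_closed[OF \<alpha>_hom F.e_closed[OF f]] by simp
    moreover have "\<alpha> (e f) \<in> a_kernel P N \<beta>" using F.e_closed[OF f] \<alpha>_image by blast
    ultimately have "eW (dW 0 (g, f)) = \<zero>\<^bsub>N\<^esub>" by (simp add: eW_def dW_0 a_kernel_def')
    moreover have "dW 0 (g, f) \<in> carrier (W 0)"
      using g f by (intro module_hom_closed[OF dW_hom]) (simp add: W_Suc)
    ultimately show "x \<in> a_kernel (W 0) N eW" by (simp add: x a_kernel_def')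
  qed
  show "a_kernel (W 0) N eW \<subseteq> dW 0 ` carrier (W (Suc 0))"
  proof
    fix x assume x: "x \<in> a_kernel (W 0) N eW"
    then obtain g where g: "g \<in> carrier (G 0)" "x = (g, \<zero>\<^bsub>F 0\<^esub>)" and "\<beta> (e' g) = \<zero>\<^bsub>N\<^esub>"
      by (cases x) (simp add: a_kernel_def' W_def F1_0 eW_def)
    then have "e' g \<in> a_kernel P N \<beta>" using G.e_closed by (simp add: a_kernel_def')
    then have "e' g \<in> \<alpha> ` carrier M" unfolding \<alpha>_image .
    then obtain u where u: "u \<in> carrier M" "e' g = \<alpha> u" by (elim imageE)
    then have "u \<in> e ` carrier (F 0)" using F.augmentation_surj by simp
    then obtain f where f: "f \<in> carrier (F 0)" "u = e f" by (elim imageE)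
    have "e' (g \<ominus>\<^bsub>G 0\<^esub> \<phi> 0 f) = \<zero>\<^bsub>P\<^esub>"
      using G.e_minus[OF g(1) \<phi>_closed[OF f(1)]] \<phi>_aug[OF f(1)] u(2) f(2)
        module_hom_closed[OF \<alpha>_hom u(1)] by (simp add: a_minus_def G.M.r_neg)
    then have "g \<ominus>\<^bsub>G 0\<^esub> \<phi> 0 f \<in> G.aug_cycles 0"
      using g(1) \<phi>_closed[OF f(1)] by (simp add: G.aug_cycles_0)
    then obtain y where y: "y \<in> carrier (G (Suc 0))" "d' 0 y = g \<ominus>\<^bsub>G 0\<^esub> \<phi> 0 f"
      using G.aug_cycles_lift by blast
    then have "d' 0 y \<oplus>\<^bsub>G 0\<^esub> \<phi> 0 f = g"
      using g(1) \<phi>_closed[OF f(1)] by (simp add: a_minus_def G.F.a_assoc G.F.l_neg)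
    then have "x = dW 0 (y, f)" by (simp add: g(2) dW_0)
    moreover have "(y, f) \<in> carrier (W (Suc 0))" using y(1) f(1) by (simp add: W_Suc)
    ultimately show "x \<in> dW 0 ` carrier (W (Suc 0))" by (rule image_eqI)
  qed
qed

lemma dW_exact: "dW (Suc i) ` carrier (W (Suc (Suc i))) = a_kernel (W (Suc i)) (W i) (dW i)"
proof
  show "dW (Suc i) ` carrier (W (Suc (Suc i))) \<subseteq> a_kernel (W (Suc i)) (W i) (dW i)"
  proof
    fix x assume "x \<in> dW (Suc i) ` carrier (W (Suc (Suc i)))"
    then obtain g f where x: "x = dW (Suc i) (g, f)" and gf: "(g, f) \<in> carrier (W (Suc (Suc i)))"
      by (elim imageE) (metis surj_pair)
    then show "x \<in> a_kernel (W (Suc i)) (W i) (dW i)"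
      using dW_dW[of g i f] module_hom_closed[OF dW_hom gf] by (simp add: a_kernel_def' W_Suc)
  qed
  show "a_kernel (W (Suc i)) (W i) (dW i) \<subseteq> dW (Suc i) ` carrier (W (Suc (Suc i)))"
  proof
    fix x assume "x \<in> a_kernel (W (Suc i)) (W i) (dW i)"
    then obtain g f where x: "x = (g, f)" and g: "g \<in> carrier (G (Suc i))" and f: "f \<in> carrier (F i)"
      and ker: "dW i (g, f) = \<zero>\<^bsub>W i\<^esub>"
      by (cases x) (simp add: a_kernel_def' W_Suc)
    have eq: "d' i g \<oplus>\<^bsub>G i\<^esub> \<phi> i f = \<zero>\<^bsub>G i\<^esub>" and "i = 0 \<or> f \<in> F.aug_cycles i"
      using ker unfolding dW_kernel_iff[OF g f] by auto
    with kernel_second_cycle g f have "f \<in> F.aug_cycles i" by (cases i) auto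
    from kernel_lift[OF g f eq this] show "x \<in> dW (Suc i) ` carrier (W (Suc (Suc i)))" unfolding x .
  qed
qed

lemma cone_resolution: "ideal_resolution R m N W dW eW"
proof (intro ideal_resolution.intro minimal_free_resolution.intro ideal_resolution_axioms.intro
    F.ring_ideal_axioms quotient)
  fix i
  show "module R (W i)" by (rule W_module)
  obtain B C where "is_basis R (G i) B" "is_basis R (F1 i) C" using G.free F1_basis by blast
  from prod_module_basis[OF G.modules F1_module nontrivial this]
  show "\<exists>B. is_basis R (W i) B" unfolding W_def by blast
  show "dW i \<in> module_hom R (W (Suc i)) (W i)" by (rule dW_hom)
  show "eW \<in> module_hom R (W 0) N" by (rule eW_hom)
  show "dW 0 ` carrier (W (Suc 0)) = a_kernel (W 0) N eW" by (rule eW_kernel)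
  show "dW (Suc i) ` carrier (W (Suc (Suc i))) = a_kernel (W (Suc i)) (W i) (dW i)" by (rule dW_exact)
  show "dW i ` carrier (W (Suc i)) \<subseteq> ideal_smult (W i) m (carrier (W i))"
    using dW_shift by (auto simp: F.mpow_1[symmetric])
  show "eW ` carrier (W 0) = carrier N"
  proof -
    have "eW ` carrier (W 0) = \<beta> ` e' ` carrier (G 0)"
      by (force simp: W_def F1_0 eW_def image_iff)
    then show ?thesis by (simp add: G.augmentation_surj \<beta>_surj)
  qed
qed

end

context mapping_cone
begin

text \<open>If the second component of \<open>(g, f)\<close> is already congruent to \<open>d y\<close>, then subtracting the boundary of
  \<open>(0, - y)\<close> leaves \<open>g + \<phi> y\<close> in the first component, and linear exactness of \<open>G\<close> takes over.\<close>

lemma cone_exact_step: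
  assumes G: "lin_exact R m G d' j"
    and g: "g \<in> mpow R m p (G (Suc j))"
    and small: "d' j g \<oplus>\<^bsub>G j\<^esub> \<phi> j f \<in> mpow R m (Suc (Suc p)) (G j)"
    and y: "y \<in> mpow R m (p - 1) (F (Suc j))" and z: "z \<in> mpow R m (Suc p) (F j)"
    and f: "f = d j y \<oplus>\<^bsub>F j\<^esub> z"
  shows "\<exists>w\<in>mpow R m (p - 1) (W (Suc (Suc j))). \<exists>v\<in>mpow R m (Suc p) (W (Suc j)).
    (g, f) = dW (Suc j) w \<oplus>\<^bsub>W (Suc j)\<^esub> v"
proof -
  note yc = F.mpow_closed[OF F.modules y] and zc = F.mpow_closed[OF F.modules z]
    and gc = F.mpow_closed[OF G.modules g]
  note \<phi>y = \<phi>_closed[OF yc] and \<phi>z = \<phi>_closed[OF zc] and dy = F.d_closed[OF yc]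
  let ?g = "g \<oplus>\<^bsub>G (Suc j)\<^esub> \<phi> (Suc j) y"
  have "\<phi> (Suc j) y \<in> mpow R m p (G (Suc j))"
    using \<phi>_mpow[OF y] by (rule F.mpow_mono_mem) simp
  then have g1: "?g \<in> mpow R m p (G (Suc j))" using g by (intro F.mpow_add G.modules)
  have "d' j ?g = d' j g \<oplus>\<^bsub>G j\<^esub> \<phi> j (d j y)"
    using G.d_add[OF gc \<phi>y] \<phi>_comm[OF yc] by simp
  also have "\<dots> = (d' j g \<oplus>\<^bsub>G j\<^esub> \<phi> j f) \<ominus>\<^bsub>G j\<^esub> \<phi> j z"
    unfolding f using \<phi>_add[OF dy zc] \<phi>_closed[OF dy] \<phi>z G.d_closed[OF gc]
    by (simp add: a_minus_def G.F.a_assoc G.F.r_neg)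
  finally have "d' j ?g \<in> mpow R m (Suc (Suc p)) (G j)"
    using F.mpow_minus[OF G.modules small \<phi>_mpow[OF z]] by simp
  then obtain w v where w: "w \<in> mpow R m (p - 1) (G (Suc (Suc j)))" and v: "v \<in> mpow R m (Suc p) (G (Suc j))"
    and gw: "?g = d' (Suc j) w \<oplus>\<^bsub>G (Suc j)\<^esub> v"
    by (rule lin_exactD[OF G g1])
  note wc = F.mpow_closed[OF G.modules w] and vc = F.mpow_closed[OF G.modules v]
  let ?w = "(w, \<ominus>\<^bsub>F (Suc j)\<^esub> y)"
  have "g = ?g \<oplus>\<^bsub>G (Suc j)\<^esub> \<ominus>\<^bsub>G (Suc j)\<^esub> \<phi> (Suc j) y"
    using gc \<phi>y by (simp add: G.F.a_assoc G.F.r_neg)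
  also have "\<dots> = (d' (Suc j) w \<oplus>\<^bsub>G (Suc j)\<^esub> \<phi> (Suc j) (\<ominus>\<^bsub>F (Suc j)\<^esub> y)) \<oplus>\<^bsub>G (Suc j)\<^esub> v"
    unfolding gw using G.d_closed[OF wc] vc \<phi>y by (simp add: \<phi>_neg[OF yc] G.F.a_ac)
  finally have "(g, f) = dW (Suc j) ?w \<oplus>\<^bsub>W (Suc j)\<^esub> (v, z)"
    unfolding f using F.d_neg[OF yc] dy by (simp add: dW_Suc W_def)
  moreover have "?w \<in> mpow R m (p - 1) (W (Suc (Suc j)))"
    using w F.mpow_neg[OF F.modules y] by (simp add: W_mpow)
  moreover have "(v, z) \<in> mpow R m (Suc p) (W (Suc j))" using v z by (simp add: W_mpow)
  ultimately show ?thesis by blast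
qed

lemma cone_exact_project:
  assumes W: "lin_exact R m W dW j"
    and g: "g \<in> mpow R m p (G (Suc j))" and f: "f \<in> mpow R m p (F j)"
    and small: "dW j (g, f) \<in> mpow R m (Suc (Suc p)) (W j)"
  shows "\<exists>y\<in>mpow R m (p - 1) (F (Suc j)). \<exists>z\<in>mpow R m (Suc p) (F j). f = d j y \<oplus>\<^bsub>F j\<^esub> z"
proof -
  have gf: "(g, f) \<in> mpow R m p (W (Suc j))" using g f by (simp add: W_mpow)
  obtain w v where w: "w \<in> mpow R m (p - 1) (W (Suc (Suc j)))" and v: "v \<in> mpow R m (Suc p) (W (Suc j))"
    and eq: "(g, f) = dW (Suc j) w \<oplus>\<^bsub>W (Suc j)\<^esub> v"
    by (rule lin_exactD[OF W gf small])
  obtain w1 y v1 z where wv: "w = (w1, y)" "v = (v1, z)" by (cases w, cases v)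
  have y: "y \<in> mpow R m (p - 1) (F (Suc j))" and z: "z \<in> mpow R m (Suc p) (F j)"
    using w v by (simp_all add: wv W_mpow)
  have "f = \<ominus>\<^bsub>F j\<^esub> d j y \<oplus>\<^bsub>F j\<^esub> z" using eq by (simp add: wv dW_Suc W_def)
  also have "\<ominus>\<^bsub>F j\<^esub> d j y = d j (\<ominus>\<^bsub>F (Suc j)\<^esub> y)"
    using F.d_neg[OF F.mpow_closed[OF F.modules y]] by simp
  finally show ?thesis using F.mpow_neg[OF F.modules y] z by blast
qed

text \<open>The linear part of the cone is an extension of the shifted linear part of \<open>F\<close> by that of \<open>G\<close>.
  As the latter has no homology in positive degrees, the long exact sequence identifies the homology of
  the former two in degrees at least \<open>2\<close>; this is the element chase behind it. In the direction from
  the cone to \<open>F\<close>, exactness of \<open>G\<close> supplies the first component that completes \<open>f\<close>.\<close>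

lemma cone_lin_exact_Suc:
  assumes G: "\<And>i. lin_exact R m G d' i"
  shows "lin_exact R m W dW (Suc i) \<longleftrightarrow> lin_exact R m F d i"
proof
  assume F: "lin_exact R m F d i"
  show "lin_exact R m W dW (Suc i)"
    unfolding lin_exact_def
  proof (intro allI ballI impI)
    fix p x assume "x \<in> mpow R m p (W (Suc (Suc i)))" and "dW (Suc i) x \<in> mpow R m (Suc (Suc p)) (W (Suc i))"
    then obtain g f where x: "x = (g, f)" and g: "g \<in> mpow R m p (G (Suc (Suc i)))" and f: "f \<in> mpow R m p (F (Suc i))"
      and dg: "d' (Suc i) g \<oplus>\<^bsub>G (Suc i)\<^esub> \<phi> (Suc i) f \<in> mpow R m (Suc (Suc p)) (G (Suc i))"
      and df: "\<ominus>\<^bsub>F i\<^esub> d i f \<in> mpow R m (Suc (Suc p)) (F i)"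
      by (cases x) (simp add: W_mpow dW_Suc)
    have "d i f \<in> mpow R m (Suc (Suc p)) (F i)"
      using F.mpow_neg[OF F.modules df] F.d_closed[OF F.mpow_closed[OF F.modules f]] by simp
    then obtain y z where "y \<in> mpow R m (p - 1) (F (Suc (Suc i)))" "z \<in> mpow R m (Suc p) (F (Suc i))"
      "f = d (Suc i) y \<oplus>\<^bsub>F (Suc i)\<^esub> z"
      by (rule lin_exactD[OF F f])
    from cone_exact_step[OF G g dg this]
    show "\<exists>w\<in>mpow R m (p - 1) (W (Suc (Suc (Suc i)))). \<exists>v\<in>mpow R m (Suc p) (W (Suc (Suc i))).
        x = dW (Suc (Suc i)) w \<oplus>\<^bsub>W (Suc (Suc i))\<^esub> v"
      unfolding x .
  qed
next
  assume W: "lin_exact R m W dW (Suc i)"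
  show "lin_exact R m F d i"
    unfolding lin_exact_def
  proof (intro allI ballI impI)
    fix p f assume f: "f \<in> mpow R m p (F (Suc i))" and df: "d i f \<in> mpow R m (Suc (Suc p)) (F i)"
    note fc = F.mpow_closed[OF F.modules f]
    have "d' i (\<phi> (Suc i) f) \<in> mpow R m (Suc (Suc (Suc p))) (G i)"
      unfolding \<phi>_comm[OF fc] by (rule \<phi>_mpow[OF df])
    then obtain g z where g: "g \<in> mpow R m (Suc p - 1) (G (Suc (Suc i)))"
      and z: "z \<in> mpow R m (Suc (Suc p)) (G (Suc i))"
      and eq: "\<phi> (Suc i) f = d' (Suc i) g \<oplus>\<^bsub>G (Suc i)\<^esub> z"
      by (rule lin_exactD[OF G \<phi>_mpow[OF f]])
    note gc = F.mpow_closed[OF G.modules g] and zc = F.mpow_closed[OF G.modules z]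
    let ?g = "\<ominus>\<^bsub>G (Suc (Suc i))\<^esub> g"
    have "d' (Suc i) ?g \<oplus>\<^bsub>G (Suc i)\<^esub> \<phi> (Suc i) f = z"
      unfolding eq using G.d_neg[OF gc] G.d_closed[OF gc] zc by (simp add: G.F.r_neg1)
    then have "dW (Suc i) (?g, f) \<in> mpow R m (Suc (Suc p)) (W (Suc i))"
      using z F.mpow_neg[OF F.modules df] by (simp add: dW_Suc W_mpow)
    moreover have "?g \<in> mpow R m p (G (Suc (Suc i)))" using F.mpow_neg[OF G.modules g] by simp
    ultimately show "\<exists>y\<in>mpow R m (p - 1) (F (Suc (Suc i))). \<exists>z\<in>mpow R m (Suc p) (F (Suc i)).
        f = d (Suc i) y \<oplus>\<^bsub>F (Suc i)\<^esub> z"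
      using cone_exact_project[OF W _ f] by blast
  qed
qed

lemma \<alpha>_augment_small:
  assumes f: "f \<in> mpow R m p (F 0)" and g: "g \<in> carrier (G (Suc 0))"
    and small: "d' 0 g \<oplus>\<^bsub>G 0\<^esub> \<phi> 0 f \<in> mpow R m q (G 0)"
  shows "\<alpha> (e f) \<in> mpow R m q P"
proof -
  note fc = F.mpow_closed[OF F.modules f]
  have "e' (d' 0 g \<oplus>\<^bsub>G 0\<^esub> \<phi> 0 f) = \<alpha> (e f)"
    using G.e_add[OF G.d_closed[OF g] \<phi>_closed[OF fc]] G.e_d[OF g] \<phi>_aug[OF fc]
      module_hom_closed[OF \<alpha>_hom F.e_closed[OF fc]] by simp
  then show ?thesis
    using F.hom_mpow[OF G.modules G.target G.augmentation_hom small] by simp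
qed

text \<open>In the long exact sequence the homology of the cone in degree \<open>1\<close> is the kernel of the map from
  \<open>gr M\<close> to \<open>gr P\<close> induced by the inclusion, which raises degrees by one. Strictness of the differentials
  of \<open>F\<close> and \<open>G\<close> is what identifies the degree \<open>0\<close> homology of their linear parts with \<open>gr M\<close> and \<open>gr P\<close>.\<close>

lemma cone_lin_exact_0:
  assumes G: "\<And>i. lin_exact R m G d' i" and F: "lin_exact R m F d 0"
  shows "lin_exact R m W dW 0 \<longleftrightarrow>
    (\<forall>p. \<forall>u\<in>mpow R m p M. \<alpha> u \<in> mpow R m (Suc (Suc p)) P \<longrightarrow> u \<in> mpow R m (Suc p) M)"
proof
  assume W: "lin_exact R m W dW 0"
  show "\<forall>p. \<forall>u\<in>mpow R m p M. \<alpha> u \<in> mpow R m (Suc (Suc p)) P \<longrightarrow> u \<in> mpow R m (Suc p) M"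
  proof (intro allI ballI impI)
    fix p u assume u: "u \<in> mpow R m p M" and \<alpha>u: "\<alpha> u \<in> mpow R m (Suc (Suc p)) P"
    have "u \<in> e ` mpow R m p (F 0)"
      using u F.hom_mpow_surj[OF F.modules F.augmentation_hom F.augmentation_surj] by simp
    then obtain f where f: "f \<in> mpow R m p (F 0)" "u = e f" by (elim imageE)
    note fc = F.mpow_closed[OF F.modules f(1)]
    have "\<alpha> u \<in> e' ` mpow R m (Suc (Suc p)) (G 0)"
      using \<alpha>u F.hom_mpow_surj[OF G.modules G.augmentation_hom G.augmentation_surj] by simp
    then obtain v where v: "v \<in> mpow R m (Suc (Suc p)) (G 0)" "\<alpha> u = e' v" by (elim imageE)
    note vc = F.mpow_closed[OF G.modules v(1)]
    let ?c = "v \<ominus>\<^bsub>G 0\<^esub> \<phi> 0 f"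
    have "e' ?c = \<zero>\<^bsub>P\<^esub>"
      using G.e_minus[OF vc \<phi>_closed[OF fc]] \<phi>_aug[OF fc] f(2) v(2) G.e_closed[OF vc]
      by (simp add: a_minus_def G.M.r_neg)
    then have "?c \<in> G.aug_cycles 0" using vc \<phi>_closed[OF fc] by (simp add: G.aug_cycles_0)
    then obtain g' where g': "g' \<in> carrier (G (Suc 0))" "d' 0 g' = ?c" using G.aug_cycles_lift by blast
    have "?c \<in> mpow R m (Suc p) (G 0)"
      using F.mpow_mono_mem[OF v(1), of "Suc p"] \<phi>_mpow[OF f(1)] by (intro F.mpow_minus G.modules) simp_all
    then have "\<exists>g\<in>mpow R m (Suc p - 1) (G (Suc 0)). d' 0 g = d' 0 g'"
      using g' by (intro G.lin_exact_strict[OF G]) simp_all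
    then obtain g where g: "g \<in> mpow R m p (G (Suc 0))" "d' 0 g = ?c" using g'(2) by auto
    have "d' 0 g \<oplus>\<^bsub>G 0\<^esub> \<phi> 0 f = v"
      unfolding g(2) using vc \<phi>_closed[OF fc] by (simp add: a_minus_def G.F.a_assoc G.F.l_neg)
    then have "dW 0 (g, f) \<in> mpow R m (Suc (Suc p)) (W 0)" using v(1) by (simp add: dW_0 W_mpow_0)
    from cone_exact_project[OF W g(1) f(1) this]
    obtain y z where y: "y \<in> mpow R m (p - 1) (F (Suc 0))" and z: "z \<in> mpow R m (Suc p) (F 0)"
      and fy: "f = d 0 y \<oplus>\<^bsub>F 0\<^esub> z" by blast
    note yc = F.mpow_closed[OF F.modules y] and zc = F.mpow_closed[OF F.modules z]
    have "u = e z"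
      unfolding f(2) fy using F.e_add[OF F.d_closed[OF yc] zc] F.e_d[OF yc] F.e_closed[OF zc] by simp
    then show "u \<in> mpow R m (Suc p) M"
      using F.hom_mpow[OF F.modules F.target F.augmentation_hom z] by simp
  qed
next
  assume gr_inj: "\<forall>p. \<forall>u\<in>mpow R m p M. \<alpha> u \<in> mpow R m (Suc (Suc p)) P \<longrightarrow> u \<in> mpow R m (Suc p) M"
  show "lin_exact R m W dW 0"
    unfolding lin_exact_def
  proof (intro allI ballI impI)
    fix p x assume "x \<in> mpow R m p (W (Suc 0))" and "dW 0 x \<in> mpow R m (Suc (Suc p)) (W 0)"
    then obtain g f where x: "x = (g, f)" and g: "g \<in> mpow R m p (G (Suc 0))" and f: "f \<in> mpow R m p (F 0)"
      and dg: "d' 0 g \<oplus>\<^bsub>G 0\<^esub> \<phi> 0 f \<in> mpow R m (Suc (Suc p)) (G 0)"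
      by (cases x) (simp add: W_mpow W_mpow_0 dW_0)
    note fc = F.mpow_closed[OF F.modules f]
    have "e f \<in> mpow R m (Suc p) M"
      using gr_inj F.hom_mpow[OF F.modules F.target F.augmentation_hom f]
        \<alpha>_augment_small[OF f F.mpow_closed[OF G.modules g] dg] by blast
    then have "e f \<in> e ` mpow R m (Suc p) (F 0)"
      using F.hom_mpow_surj[OF F.modules F.augmentation_hom F.augmentation_surj] by simp
    then obtain z where z: "z \<in> mpow R m (Suc p) (F 0)" "e f = e z" by (elim imageE)
    note zc = F.mpow_closed[OF F.modules z(1)]
    let ?c = "f \<ominus>\<^bsub>F 0\<^esub> z"
    have "e ?c = \<zero>\<^bsub>M\<^esub>"
      using F.e_minus[OF fc zc] z(2) F.e_closed[OF zc] by (simp add: a_minus_def F.M.r_neg)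
    then have "?c \<in> F.aug_cycles 0" using fc zc by (simp add: F.aug_cycles_0)
    then obtain y' where y': "y' \<in> carrier (F (Suc 0))" "d 0 y' = ?c" using F.aug_cycles_lift by blast
    have "?c \<in> mpow R m p (F 0)"
      using F.mpow_mono_mem[OF z(1), of p] f by (intro F.mpow_minus F.modules) simp_all
    then have "\<exists>y\<in>mpow R m (p - 1) (F (Suc 0)). d 0 y = d 0 y'"
      using y' by (intro F.lin_exact_strict[OF F]) simp_all
    then obtain y where y: "y \<in> mpow R m (p - 1) (F (Suc 0))" "d 0 y = ?c" using y'(2) by auto
    have "f = d 0 y \<oplus>\<^bsub>F 0\<^esub> z"
      unfolding y(2) using fc zc by (simp add: a_minus_def F.F.a_assoc F.F.l_neg)
    from cone_exact_step[OF G g dg y(1) z(1) this]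
    show "\<exists>w\<in>mpow R m (p - 1) (W (Suc (Suc 0))). \<exists>v\<in>mpow R m (Suc p) (W (Suc 0)).
        x = dW (Suc 0) w \<oplus>\<^bsub>W (Suc 0)\<^esub> v"
      unfolding x .
  qed
qed

end

section \<open>The linearity defect of a quotient of a Koszul module\<close>

lemma lin_defect_zero_iff:
  assumes "minimal_complex R m F d"
  shows "lin_defect R m F d = 0 \<longleftrightarrow> (\<forall>i. lin_exact R m F d i)"
  using minimal_complex.lin_defect_le_iff[OF assms, of 0] by (simp add: zero_enat_def[symmetric])

lemma enat_eqI_le: "(\<And>k. (a :: enat) \<le> enat k \<longleftrightarrow> b \<le> enat k) \<Longrightarrow> a = b"
  by (metis enat_ord_code(3) enat_ord_simps(1) linorder_le_cases not_enat_eq order_antisym order_refl)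

lemma lin_defect_unique:
  assumes F: "ideal_resolution R m M F d e" and G: "ideal_resolution R m M G d' e'"
  shows "lin_defect R m F d = lin_defect R m G d'"
proof -
  interpret F: ideal_resolution R m M F d e by fact
  interpret G: ideal_resolution R m M G d' e' by fact
  show ?thesis
    by (rule enat_eqI_le)
      (simp add: F.lin_defect_le_iff G.lin_defect_le_iff
        lin_exact_transfer[OF F G] lin_exact_transfer[OF G F] iff_conv_conj_imp)
qed

text \<open>The lifting of \<open>M \<rightarrow> P\<close> to resolutions can be chosen with values in
  \<open>m G\<close>: if \<open>\<phi> i\<close> has values in \<open>m G\<close>, then \<open>\<phi> i \<circ> d\<close> has values in
  \<open>m\<^sup>2 G\<close>, and by strictness of the differential of the Koszul module \<open>P\<close> the
  cycles in \<open>m\<^sup>2 G\<close> are boundaries of elements of \<open>m G\<close>.\<close>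

lemma comparison_into_mG:
  assumes F: "ideal_resolution R m M F d e" and G: "ideal_resolution R m P G d' e'"
    and lin: "\<And>i. lin_exact R m G d' i"
    and \<alpha>: "\<alpha> \<in> module_hom R M P" and sub: "\<alpha> ` carrier M \<subseteq> mpow R m (Suc 0) P"
  shows "\<exists>\<phi>. (\<forall>i. \<phi> i \<in> module_hom R (F i) (G i) \<and> \<phi> i ` carrier (F i) \<subseteq> mpow R m (Suc 0) (G i)) \<and>
    (\<forall>x\<in>carrier (F 0). e' (\<phi> 0 x) = \<alpha> (e x)) \<and>
    (\<forall>i. \<forall>x\<in>carrier (F (Suc i)). d' i (\<phi> (Suc i) x) = \<phi> i (d i x))"
proof -
  interpret F: ideal_resolution R m M F d e by fact
  interpret G: ideal_resolution R m P G d' e' by fact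
  show ?thesis
  proof (rule comparison_map[OF F G \<alpha>, where S = "\<lambda>i. mpow R m (Suc 0) (G i)"])
    show "submodule (mpow R m (Suc 0) (G i)) R (G i)" for i by (rule F.mpow_submodule[OF G.modules])
    show "\<alpha> (e x) \<in> e' ` mpow R m (Suc 0) (G 0)" if "x \<in> carrier (F 0)" for x
      unfolding F.hom_mpow_surj[OF G.modules G.augmentation_hom G.augmentation_surj]
      using sub F.e_closed[OF that] by blast
    fix i \<phi> x
    assume \<phi>: "\<phi> \<in> module_hom R (F i) (G i)" "\<phi> ` carrier (F i) \<subseteq> mpow R m (Suc 0) (G i)"
      and x: "x \<in> carrier (F (Suc i))" and cyc: "\<phi> (d i x) \<in> G.aug_cycles i"
    obtain y where y: "y \<in> carrier (G (Suc i))" "d' i y = \<phi> (d i x)" using G.aug_cycles_lift[OF cyc] .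
    have "d i x \<in> mpow R m (Suc 0) (F i)" using F.diff_minimal[of i] x by blast
    then have "d' i y \<in> mpow R m (Suc (Suc 0)) (G i)"
      unfolding y(2) by (rule F.hom_mpow_Suc[OF F.modules G.modules \<phi>])
    from G.lin_exact_strict[OF lin y(1) this]
    obtain z where "z \<in> mpow R m (Suc 0) (G (Suc i))" "d' i z = d' i y" by auto
    then show "\<phi> (d i x) \<in> d' i ` mpow R m (Suc 0) (G (Suc i))" unfolding y(2) by (metis imageI)
  qed
qed

theorem
  fixes R (structure)
  assumes FM: "ideal_resolution R m M FM dM eM" and FP: "ideal_resolution R m P FP dP eP"
    and FN: "ideal_resolution R m N FN dN eN"
    and seq: "short_exact R M P N \<alpha> \<beta>" and ne: "\<one> \<noteq> \<zero>"
    and koszul: "lin_defect R m FP dP = 0"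
    and sub: "\<alpha> ` carrier M \<subseteq> ideal_smult P m (carrier P)"
  shows lin_defect_quotient_le: "lin_defect R m FN dN \<le> enat (Suc k) \<longleftrightarrow> lin_defect R m FM dM \<le> enat k"
    and lin_defect_quotient_zero: "lin_defect R m FN dN = 0 \<longleftrightarrow> lin_defect R m FM dM = 0 \<and>
      (\<forall>s. \<alpha> ` carrier M \<inter> ideal_smult P (ideal_power R m (s + 1)) (carrier P)
        = ideal_smult P (ideal_power R m s) (\<alpha> ` carrier M))"
proof -
  interpret F: ideal_resolution R m M FM dM eM by fact
  interpret G: ideal_resolution R m P FP dP eP by fact
  interpret N: ideal_resolution R m N FN dN eN by fact
  have lin: "lin_exact R m FP dP i" for i
    using koszul lin_defect_zero_iff[OF G.minimal_complex_axioms] by blast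
  have sub': "\<alpha> ` carrier M \<subseteq> mpow R m (Suc 0) P" using sub by (simp add: F.mpow_1)
  have \<alpha>: "\<alpha> \<in> module_hom R M P" and inj: "inj_on \<alpha> (carrier M)" using seq by (auto simp: short_exact_def)
  obtain \<phi> where \<phi>: "\<And>i. \<phi> i \<in> module_hom R (FM i) (FP i)"
    "\<And>i. \<phi> i ` carrier (FM i) \<subseteq> mpow R m (Suc 0) (FP i)"
    "\<And>x. x \<in> carrier (FM 0) \<Longrightarrow> eP (\<phi> 0 x) = \<alpha> (eM x)"
    "\<And>i x. x \<in> carrier (FM (Suc i)) \<Longrightarrow> dP i (\<phi> (Suc i) x) = \<phi> i (dM i x)"
    using comparison_into_mG[OF FM FP lin \<alpha> sub'] by blast
  interpret C: mapping_cone R m M FM dM eM P FP dP eP N \<alpha> \<beta> \<phi>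
    by (intro mapping_cone.intro mapping_cone_axioms.intro FM FP N.target seq ne \<phi>)
  interpret W: ideal_resolution R m N C.W C.dW C.eW by (rule C.cone_resolution)
  have eq: "lin_defect R m FN dN = lin_defect R m C.W C.dW"
    by (rule lin_defect_unique[OF FN C.cone_resolution])
  show "lin_defect R m FN dN \<le> enat (Suc k) \<longleftrightarrow> lin_defect R m FM dM \<le> enat k"
    unfolding eq W.lin_defect_le_iff F.lin_defect_le_iff
    using C.cone_lin_exact_Suc[OF lin] by (metis Suc_le_D Suc_le_mono)
  let ?inj = "\<forall>p. \<forall>u\<in>mpow R m p M. \<alpha> u \<in> mpow R m (Suc (Suc p)) P \<longrightarrow> u \<in> mpow R m (Suc p) M"
  have img: "ideal_smult P (ideal_power R m s) (\<alpha> ` carrier M) = \<alpha> ` mpow R m s M" for s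
    unfolding mpow_def
    by (rule ideal_smult_image[OF F.target \<alpha> F.ideal_power_sub order_refl, symmetric])
  have pow: "ideal_smult P (ideal_power R m (s + 1)) (carrier P) = mpow R m (Suc s) P" for s
    by (simp only: mpow_def Suc_eq_plus1)
  have mem: "\<alpha> u \<in> \<alpha> ` mpow R m s M \<longleftrightarrow> u \<in> mpow R m s M" if "u \<in> carrier M" for u s
    using inj_on_image_mem_iff[OF inj that F.mpow_sub[OF F.target]] .
  \<comment> \<open>injectivity on the associated graded modules degree by degree amounts to the equality of filtrations\<close>
  have "?inj \<longleftrightarrow> (\<forall>s. \<alpha> ` carrier M \<inter> mpow R m (Suc s) P = \<alpha> ` mpow R m s M)"
  proof
    assume gr: ?inj
    have "\<alpha> ` carrier M \<inter> mpow R m (Suc s) P \<subseteq> \<alpha> ` mpow R m s M" for s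
    proof (induction s)
      case 0
      show ?case by (simp add: F.mpow_0[OF F.target])
    next
      case (Suc s)
      show ?case
      proof clarify
        fix u assume u: "u \<in> carrier M" and \<alpha>u: "\<alpha> u \<in> mpow R m (Suc (Suc s)) P"
        have "\<alpha> u \<in> mpow R m (Suc s) P" by (rule F.mpow_mono_mem[OF \<alpha>u]) simp
        then have "u \<in> mpow R m s M" using Suc u mem[OF u] by blast
        then show "\<alpha> u \<in> \<alpha> ` mpow R m (Suc s) M" using gr \<alpha>u by blast
      qed
    qed
    moreover have "\<alpha> ` mpow R m s M \<subseteq> \<alpha> ` carrier M \<inter> mpow R m (Suc s) P" for s
      using F.hom_mpow_Suc[OF F.target G.target \<alpha> sub'] F.mpow_sub[OF F.target] by blast
    ultimately show "\<forall>s. \<alpha> ` carrier M \<inter> mpow R m (Suc s) P = \<alpha> ` mpow R m s M" by blast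
  next
    assume "\<forall>s. \<alpha> ` carrier M \<inter> mpow R m (Suc s) P = \<alpha> ` mpow R m s M"
    then show ?inj using F.mpow_closed[OF F.target] mem by blast
  qed
  moreover have "lin_defect R m FN dN = 0 \<longleftrightarrow> lin_defect R m FM dM = 0 \<and> ?inj"
  proof -
    have "lin_defect R m FN dN = 0 \<longleftrightarrow> lin_exact R m C.W C.dW 0 \<and> (\<forall>i. lin_exact R m FM dM i)"
      unfolding eq lin_defect_zero_iff[OF W.minimal_complex_axioms]
      using C.cone_lin_exact_Suc[OF lin] by (metis nat.exhaust)
    then show ?thesis
      unfolding lin_defect_zero_iff[OF F.minimal_complex_axioms] using C.cone_lin_exact_0[OF lin] by blast
  qed
  ultimately show "lin_defect R m FN dN = 0 \<longleftrightarrow> lin_defect R m FM dM = 0 \<and>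
      (\<forall>s. \<alpha> ` carrier M \<inter> ideal_smult P (ideal_power R m (s + 1)) (carrier P)
        = ideal_smult P (ideal_power R m s) (\<alpha> ` carrier M))"
    unfolding img pow by blast
qed

text \<open>Bounding \<open>b\<close> by \<open>k + 1\<close> is the same as bounding \<open>a\<close> by \<open>k\<close>, so \<open>b = a + 1\<close> unless \<open>a = 0\<close>, where
  \<open>b\<close> may be \<open>0\<close> or \<open>1\<close>.\<close>

lemma enat_shift_consequences:
  fixes a b :: enat
  assumes "\<And>k. b \<le> enat (Suc k) \<longleftrightarrow> a \<le> enat k"
  shows "ereal_of_enat b - 1 \<le> ereal_of_enat a \<and>
    ereal_of_enat a \<le> max 0 (ereal_of_enat b - 1) \<and>
    (a \<ge> 1 \<longrightarrow> b = a + 1) \<and> (a = 0 \<longrightarrow> b \<le> 1)"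
proof (cases a)
  case infinity
  have "b = \<infinity>"
  proof (cases b)
    case (enat n)
    then show ?thesis using assms[of n] infinity by simp
  qed
  then show ?thesis using infinity by simp
next
  case (enat n)
  then have "b \<le> enat (Suc n)" using assms[of n] by simp
  then obtain l where l: "b = enat l" "l \<le> Suc n" by (cases b) auto
  have "n = 0 \<or> l = Suc n"
  proof (rule ccontr)
    assume neq: "\<not> (n = 0 \<or> l = Suc n)"
    then have "b \<le> enat (Suc (n - 1))" using l by simp
    then have "n \<le> n - 1" using assms[of "n - 1"] enat by simp
    then show False using neq by auto
  qed
  then show ?thesis using l enat by (auto simp: one_enat_def zero_enat_def one_ereal_def max_def)
qed

section \<open>Homogeneous components\<close>

definition hcomp :: "('b, 'x) ring_scheme \<Rightarrow> ('i \<Rightarrow> 'b set) \<Rightarrow> 'i \<Rightarrow> 'b \<Rightarrow> 'b"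
  where "hcomp M G i x = (THE f. (\<forall>i. f i \<in> G i) \<and> finite {i. f i \<noteq> \<zero>\<^bsub>M\<^esub>} \<and>
    x = (\<Oplus>\<^bsub>M\<^esub>i\<in>{i. f i \<noteq> \<zero>\<^bsub>M\<^esub>}. f i)) i"

locale decomposed_group = abelian_group M for M :: "('b, 'x) ring_scheme" (structure) +
  fixes G :: "'i \<Rightarrow> 'b set"
  assumes dec: "decomposition M G"
begin

lemma component_subgroup: "subgroup (G i) (add_monoid M)"
  using dec by (simp add: decomposition_def)

lemma component_zero: "\<zero> \<in> G i"
  using subgroup.one_closed[OF component_subgroup] by simp

lemma component_closed: "x \<in> G i \<Longrightarrow> x \<in> carrier M"
  using subgroup.subset[OF component_subgroup] by auto

lemma component_add: "x \<in> G i \<Longrightarrow> y \<in> G i \<Longrightarrow> x \<oplus> y \<in> G i"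
  using subgroup.m_closed[OF component_subgroup] by simp

lemma component_neg: "x \<in> G i \<Longrightarrow> \<ominus> x \<in> G i"
  using subgroup.m_inv_closed[OF component_subgroup] by (simp add: a_inv_def)

lemma component_finsum:
  "(\<And>j. j \<in> I \<Longrightarrow> f j \<in> G i) \<Longrightarrow> (\<Oplus>j\<in>I. f j) \<in> G i"
proof (induction I rule: infinite_finite_induct)
  case (insert j I)
  then have "f \<in> I \<rightarrow> carrier M" "f j \<in> carrier M" using component_closed by auto
  then show ?case using insert by (simp add: component_add)
qed (simp_all add: component_zero finsum_infinite)

lemma finsum_support:
  assumes "finite I" "{i. f i \<noteq> \<zero>} \<subseteq> I" "f \<in> I \<rightarrow> carrier M"
  shows "(\<Oplus>i\<in>{i. f i \<noteq> \<zero>}. f i) = (\<Oplus>i\<in>I. f i)"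
  using assms by (intro add.finprod_mono_neutral_cong_left) auto

lemma
  assumes "x \<in> carrier M"
  shows hcomp_mem: "hcomp M G i x \<in> G i"
    and hcomp_finite: "finite {i. hcomp M G i x \<noteq> \<zero>}"
    and hcomp_sum_support: "x = (\<Oplus>i\<in>{i. hcomp M G i x \<noteq> \<zero>}. hcomp M G i x)"
proof -
  have "\<exists>!f. (\<forall>i. f i \<in> G i) \<and> finite {i. f i \<noteq> \<zero>} \<and> x = (\<Oplus>i\<in>{i. f i \<noteq> \<zero>}. f i)"
    using dec assms unfolding decomposition_def by blast
  from theI'[OF this] show "hcomp M G i x \<in> G i" "finite {i. hcomp M G i x \<noteq> \<zero>}"
    "x = (\<Oplus>i\<in>{i. hcomp M G i x \<noteq> \<zero>}. hcomp M G i x)"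
    unfolding hcomp_def by blast+
qed

lemma hcomp_closed: "x \<in> carrier M \<Longrightarrow> hcomp M G i x \<in> carrier M"
  by (rule component_closed[OF hcomp_mem])

lemma hcomp_sum:
  assumes "x \<in> carrier M" "finite I" "{i. hcomp M G i x \<noteq> \<zero>} \<subseteq> I"
  shows "(\<Oplus>i\<in>I. hcomp M G i x) = x"
  using finsum_support[OF assms(2,3)] hcomp_sum_support[OF assms(1)] hcomp_closed[OF assms(1)] by auto

lemma hcomp_unique:
  assumes "finite I" and f: "\<And>i. i \<in> I \<Longrightarrow> f i \<in> G i" and x: "x = (\<Oplus>i\<in>I. f i)"
  shows "hcomp M G i x = (if i \<in> I then f i else \<zero>)"
proof -
  let ?f = "\<lambda>i. if i \<in> I then f i else \<zero>"
  have fc: "f i \<in> carrier M" if "i \<in> I" for i using component_closed[OF f[OF that]] .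
  have xc: "x \<in> carrier M" unfolding x using fc by (intro finsum_closed) auto
  have fin: "finite {i. ?f i \<noteq> \<zero>}" by (rule finite_subset[OF _ assms(1)]) auto
  have "(\<Oplus>i\<in>{i. ?f i \<noteq> \<zero>}. ?f i) = (\<Oplus>i\<in>I. ?f i)"
    using assms(1) fc by (intro finsum_support) (auto split: if_splits)
  also have "\<dots> = x" unfolding x using fc by (intro finsum_cong') auto
  finally have "x = (\<Oplus>i\<in>{i. ?f i \<noteq> \<zero>}. ?f i)" by simp
  moreover have "\<forall>i. ?f i \<in> G i" using f component_zero by auto
  moreover have "\<exists>!f. (\<forall>i. f i \<in> G i) \<and> finite {i. f i \<noteq> \<zero>} \<and> x = (\<Oplus>i\<in>{i. f i \<noteq> \<zero>}. f i)"
    using dec xc unfolding decomposition_def by blast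
  ultimately have "(THE f. (\<forall>i. f i \<in> G i) \<and> finite {i. f i \<noteq> \<zero>} \<and> x = (\<Oplus>i\<in>{i. f i \<noteq> \<zero>}. f i)) = ?f"
    using fin by (intro the1_equality conjI)
  then show ?thesis unfolding hcomp_def by (rule fun_cong)
qed

lemma hcomp_homogeneous: "x \<in> G j \<Longrightarrow> hcomp M G i x = (if i = j then x else \<zero>)"
  using hcomp_unique[of "{j}" "\<lambda>_. x" x i] component_closed[of x j] by simp

end

lemma hcomp_hom:
  assumes M: "decomposed_group M G" and N: "decomposed_group N H"
    and f: "f \<in> hom (add_monoid M) (add_monoid N)" and deg: "\<And>i. f ` G i \<subseteq> H i" and x: "x \<in> carrier M"
  shows "hcomp N H i (f x) = f (hcomp M G i x)"
proof -
  interpret M: decomposed_group M G by fact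
  interpret N: decomposed_group N H by fact
  interpret f: group_hom "add_monoid M" "add_monoid N" f
    using f by (intro group_hom.intro M.a_group N.a_group group_hom_axioms.intro)
  have add: "f (u \<oplus>\<^bsub>M\<^esub> v) = f u \<oplus>\<^bsub>N\<^esub> f v" if "u \<in> carrier M" "v \<in> carrier M" for u v
    using f.hom_mult[of u v] that by simp
  have cl: "f u \<in> carrier N" if "u \<in> carrier M" for u using f.hom_closed[of u] that by simp
  have zero: "f \<zero>\<^bsub>M\<^esub> = \<zero>\<^bsub>N\<^esub>" using f.hom_one by simp
  have sum: "f (\<Oplus>\<^bsub>M\<^esub>j\<in>I. g j) = (\<Oplus>\<^bsub>N\<^esub>j\<in>I. f (g j))" if "finite I" "g \<in> I \<rightarrow> carrier M" for I g
    using that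
  proof (induction I)
    case (insert j I)
    then have g: "g j \<in> carrier M" "g \<in> I \<rightarrow> carrier M" by auto
    then have "(\<lambda>j. f (g j)) \<in> I \<rightarrow> carrier N" using cl by auto
    then show ?case using insert g by (simp add: add cl)
  qed (simp add: zero)
  let ?I = "{i. hcomp M G i x \<noteq> \<zero>\<^bsub>M\<^esub>}"
  have "f x = f (\<Oplus>\<^bsub>M\<^esub>j\<in>?I. hcomp M G j x)" using M.hcomp_sum_support[OF x] by simp
  also have "\<dots> = (\<Oplus>\<^bsub>N\<^esub>j\<in>?I. f (hcomp M G j x))"
    using M.hcomp_finite[OF x] M.hcomp_closed[OF x] by (intro sum) auto
  finally have "hcomp N H i (f x) = (if i \<in> ?I then f (hcomp M G i x) else \<zero>\<^bsub>N\<^esub>)"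
    using M.hcomp_finite[OF x] M.hcomp_mem[OF x] deg by (intro N.hcomp_unique) auto
  then show ?thesis using zero by auto
qed

text \<open>Here \<open>c\<close> is a candidate for the component functions; uniqueness then only says that \<open>c\<close> recovers the
  summands of every finite sum of homogeneous elements.\<close>

lemma decompositionI:
  assumes "abelian_group M" and sub: "\<And>i. subgroup (G i) (add_monoid M)"
    and fin: "\<And>x. x \<in> carrier M \<Longrightarrow> finite {i. c i x \<noteq> \<zero>\<^bsub>M\<^esub>}"
    and mem: "\<And>x i. x \<in> carrier M \<Longrightarrow> c i x \<in> G i"
    and sum: "\<And>x. x \<in> carrier M \<Longrightarrow> x = (\<Oplus>\<^bsub>M\<^esub>i\<in>{i. c i x \<noteq> \<zero>\<^bsub>M\<^esub>}. c i x)"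
    and uniq: "\<And>f i. (\<And>i. f i \<in> G i) \<Longrightarrow> finite {i. f i \<noteq> \<zero>\<^bsub>M\<^esub>} \<Longrightarrow>
      f i = c i (\<Oplus>\<^bsub>M\<^esub>i\<in>{i. f i \<noteq> \<zero>\<^bsub>M\<^esub>}. f i)"
  shows "decomposition M G"
  unfolding decomposition_def
proof (intro conjI allI ballI sub)
  fix x assume x: "x \<in> carrier M"
  show "\<exists>!f. (\<forall>i. f i \<in> G i) \<and> finite {i. f i \<noteq> \<zero>\<^bsub>M\<^esub>} \<and> x = (\<Oplus>\<^bsub>M\<^esub>i\<in>{i. f i \<noteq> \<zero>\<^bsub>M\<^esub>}. f i)"
  proof (rule ex1I[of _ "\<lambda>i. c i x"])
    show "(\<forall>i. c i x \<in> G i) \<and> finite {i. c i x \<noteq> \<zero>\<^bsub>M\<^esub>} \<and> x = (\<Oplus>\<^bsub>M\<^esub>i\<in>{i. c i x \<noteq> \<zero>\<^bsub>M\<^esub>}. c i x)"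
      using fin[OF x] mem[OF x] sum[OF x] by blast
  next
    fix f assume "(\<forall>i. f i \<in> G i) \<and> finite {i. f i \<noteq> \<zero>\<^bsub>M\<^esub>} \<and> x = (\<Oplus>\<^bsub>M\<^esub>i\<in>{i. f i \<noteq> \<zero>\<^bsub>M\<^esub>}. f i)"
    then have f: "\<And>i. f i \<in> G i" "finite {i. f i \<noteq> \<zero>\<^bsub>M\<^esub>}"
      and x: "x = (\<Oplus>\<^bsub>M\<^esub>i\<in>{i. f i \<noteq> \<zero>\<^bsub>M\<^esub>}. f i)" by blast+
    show "f = (\<lambda>i. c i x)"
      by (rule ext, subst x, rule uniq[OF f])
  qed
qed

text \<open>Outside the image of \<open>\<sigma>\<close> the new components are zero. For the shifts of a ring graded by natural
  numbers, which are graded by integers, these are the degrees below that of the generator.\<close>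

lemma decomposition_reindex:
  assumes "abelian_group M" and dec: "decomposition M G" and inj: "inj \<sigma>"
    and H: "\<And>i. H (\<sigma> i) = G i" "\<And>j. j \<notin> range \<sigma> \<Longrightarrow> H j = {\<zero>\<^bsub>M\<^esub>}"
  shows "decomposition M H"
proof -
  interpret M: decomposed_group M G by (intro decomposed_group.intro assms decomposed_group_axioms.intro)
  define c where "c j x = (if j \<in> range \<sigma> then hcomp M G (inv_into UNIV \<sigma> j) x else \<zero>\<^bsub>M\<^esub>)" for j x
  have c\<sigma>: "c (\<sigma> i) x = hcomp M G i x" for i x by (simp add: c_def inv_f_f[OF inj])
  have supp: "{j. c j x \<noteq> \<zero>\<^bsub>M\<^esub>} = \<sigma> ` {i. hcomp M G i x \<noteq> \<zero>\<^bsub>M\<^esub>}" for x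
  proof
    show "{j. c j x \<noteq> \<zero>\<^bsub>M\<^esub>} \<subseteq> \<sigma> ` {i. hcomp M G i x \<noteq> \<zero>\<^bsub>M\<^esub>}"
    proof
      fix j assume j: "j \<in> {j. c j x \<noteq> \<zero>\<^bsub>M\<^esub>}"
      then have "j \<in> range \<sigma>" by (auto simp: c_def split: if_splits)
      then obtain i where "j = \<sigma> i" by (elim imageE)
      with j show "j \<in> \<sigma> ` {i. hcomp M G i x \<noteq> \<zero>\<^bsub>M\<^esub>}" by (auto simp: c\<sigma>)
    qed
  qed (auto simp: c\<sigma>)
  show ?thesis
  proof (rule decompositionI[where c = c])
    show "subgroup (H j) (add_monoid M)" for j
    proof (cases "j \<in> range \<sigma>")
      case True
      then show ?thesis using H(1) M.component_subgroup by auto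
    next
      case False
      then show ?thesis using M.add.triv_subgroup H(2) by simp
    qed
    show "finite {j. c j x \<noteq> \<zero>\<^bsub>M\<^esub>}" if "x \<in> carrier M" for x
      unfolding supp using M.hcomp_finite[OF that] by simp
    show "c j x \<in> H j" if "x \<in> carrier M" for x j
      using M.hcomp_mem[OF that] H(2) by (cases "j \<in> range \<sigma>") (auto simp: c\<sigma> H(1), simp add: c_def)
    show "x = (\<Oplus>\<^bsub>M\<^esub>j\<in>{j. c j x \<noteq> \<zero>\<^bsub>M\<^esub>}. c j x)" if x: "x \<in> carrier M" for x
    proof -
      have "(\<Oplus>\<^bsub>M\<^esub>j\<in>{j. c j x \<noteq> \<zero>\<^bsub>M\<^esub>}. c j x) = (\<Oplus>\<^bsub>M\<^esub>i\<in>{i. hcomp M G i x \<noteq> \<zero>\<^bsub>M\<^esub>}. c (\<sigma> i) x)"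
        unfolding supp using M.hcomp_closed[OF x] inj
        by (intro M.finsum_reindex) (auto simp: c\<sigma> inj_on_def inj_def)
      also have "\<dots> = x" using M.hcomp_sum_support[OF x] by (simp add: c\<sigma>)
      finally show ?thesis by simp
    qed
    fix f j assume f: "\<And>j. f j \<in> H j" and fin: "finite {j. f j \<noteq> \<zero>\<^bsub>M\<^esub>}"
    have out: "f j = \<zero>\<^bsub>M\<^esub>" if "j \<notin> range \<sigma>" for j using f[of j] H(2)[OF that] by simp
    have f\<sigma>: "f (\<sigma> i) \<in> G i" for i using f[of "\<sigma> i"] H(1) by simp
    let ?I = "{i. f (\<sigma> i) \<noteq> \<zero>\<^bsub>M\<^esub>}"
    have im: "{j. f j \<noteq> \<zero>\<^bsub>M\<^esub>} = \<sigma> ` ?I"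
    proof
      show "{j. f j \<noteq> \<zero>\<^bsub>M\<^esub>} \<subseteq> \<sigma> ` ?I"
      proof
        fix j assume j: "j \<in> {j. f j \<noteq> \<zero>\<^bsub>M\<^esub>}"
        then have "j \<in> range \<sigma>" using out[of j] by auto
        then obtain i where "j = \<sigma> i" by (elim imageE)
        with j show "j \<in> \<sigma> ` ?I" by simp
      qed
    qed auto
    have finI: "finite ?I" using fin unfolding im by (rule finite_imageD) (use inj in \<open>simp add: inj_on_def inj_def\<close>)
    have "(\<Oplus>\<^bsub>M\<^esub>j\<in>{j. f j \<noteq> \<zero>\<^bsub>M\<^esub>}. f j) = (\<Oplus>\<^bsub>M\<^esub>i\<in>?I. f (\<sigma> i))" (is "?s = _")
      unfolding im using M.component_closed[OF f\<sigma>] inj by (intro M.finsum_reindex) (auto simp: inj_on_def inj_def)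
    then have *: "hcomp M G i ?s = (if i \<in> ?I then f (\<sigma> i) else \<zero>\<^bsub>M\<^esub>)" for i
      using finI f\<sigma> by (intro M.hcomp_unique)
    show "f j = c j ?s"
    proof (cases "j \<in> range \<sigma>")
      case True
      then obtain i where "j = \<sigma> i" by (elim imageE)
      then show ?thesis using *[of i] by (auto simp: c\<sigma>)
    qed (simp add: c_def out)
  qed fact
qed

text \<open>With this decomposition an ungraded module becomes a graded one, and the construction of graded
  resolutions applies to local rings.\<close>

lemma decomposition_concentrated:
  assumes "abelian_group M"
  shows "decomposition M (\<lambda>i. if i = z then carrier M else {\<zero>\<^bsub>M\<^esub>})"
proof -
  interpret abelian_group M by fact
  let ?c = "\<lambda>i x. if i = z then x else \<zero>\<^bsub>M\<^esub>"
  have supp: "{i. f i \<noteq> \<zero>\<^bsub>M\<^esub>} = (if f z = \<zero>\<^bsub>M\<^esub> then {} else {z})"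
    if f: "\<And>i. i \<noteq> z \<Longrightarrow> f i = \<zero>\<^bsub>M\<^esub>" for f
  proof -
    have "f i \<noteq> \<zero>\<^bsub>M\<^esub> \<longleftrightarrow> i = z \<and> f z \<noteq> \<zero>\<^bsub>M\<^esub>" for i using f[of i] by (cases "i = z") auto
    then have "{i. f i \<noteq> \<zero>\<^bsub>M\<^esub>} = {i. i = z \<and> f z \<noteq> \<zero>\<^bsub>M\<^esub>}" by (rule Collect_cong)
    also have "\<dots> = (if f z = \<zero>\<^bsub>M\<^esub> then {} else {z})" by auto
    finally show ?thesis .
  qed
  show ?thesis
  proof (rule decompositionI[where c = ?c])
    show "subgroup (if i = z then carrier M else {\<zero>\<^bsub>M\<^esub>}) (add_monoid M)" for i
      using add.subgroup_self add.triv_subgroup by simp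
    show "finite {i. ?c i x \<noteq> \<zero>\<^bsub>M\<^esub>}" for x by (subst supp) auto
    show "x = (\<Oplus>\<^bsub>M\<^esub>i\<in>{i. ?c i x \<noteq> \<zero>\<^bsub>M\<^esub>}. ?c i x)" if "x \<in> carrier M" for x
      using that by (subst supp) auto
    fix f i assume f: "\<And>i. f i \<in> (if i = z then carrier M else {\<zero>\<^bsub>M\<^esub>})"
    then have fz: "f z \<in> carrier M" by (metis (full_types))
    have f0: "f i = \<zero>\<^bsub>M\<^esub>" if "i \<noteq> z" for i using f[of i] that by simp
    show "f i = ?c i (\<Oplus>\<^bsub>M\<^esub>i\<in>{i. f i \<noteq> \<zero>\<^bsub>M\<^esub>}. f i)"
      using fz f0 by (subst supp) auto
  qed (use assms in auto)
qed

section \<open>Free modules of tuples\<close>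

definition free_module :: "('a, 'r) ring_scheme \<Rightarrow> nat \<Rightarrow> ('a, nat \<Rightarrow> 'a) module"
  where "free_module R n =
    \<lparr>carrier = {u. (\<forall>i. u i \<in> carrier R) \<and> (\<forall>i\<ge>n. u i = \<zero>\<^bsub>R\<^esub>)},
     monoid.mult = undefined, one = undefined, ring.zero = (\<lambda>_. \<zero>\<^bsub>R\<^esub>),
     ring.add = (\<lambda>u v i. u i \<oplus>\<^bsub>R\<^esub> v i), smult = (\<lambda>a u i. a \<otimes>\<^bsub>R\<^esub> u i)\<rparr>"

definition unit_vec :: "('a, 'r) ring_scheme \<Rightarrow> nat \<Rightarrow> nat \<Rightarrow> 'a"
  where "unit_vec R i = (\<lambda>j. if j = i then \<one>\<^bsub>R\<^esub> else \<zero>\<^bsub>R\<^esub>)"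

lemma free_module_simps [simp]:
  "u \<in> carrier (free_module R n) \<longleftrightarrow> (\<forall>i. u i \<in> carrier R) \<and> (\<forall>i\<ge>n. u i = \<zero>\<^bsub>R\<^esub>)"
  "\<zero>\<^bsub>free_module R n\<^esub> = (\<lambda>_. \<zero>\<^bsub>R\<^esub>)"
  "u \<oplus>\<^bsub>free_module R n\<^esub> v = (\<lambda>i. u i \<oplus>\<^bsub>R\<^esub> v i)"
  "a \<odot>\<^bsub>free_module R n\<^esub> u = (\<lambda>i. a \<otimes>\<^bsub>R\<^esub> u i)"
  by (simp_all add: free_module_def)

definition lin_comb :: "('a, 'c, 'y) module_scheme \<Rightarrow> nat \<Rightarrow> (nat \<Rightarrow> 'c) \<Rightarrow> (nat \<Rightarrow> 'a) \<Rightarrow> 'c"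
  where "lin_comb M n t u = (\<Oplus>\<^bsub>M\<^esub>i\<in>{..<n}. u i \<odot>\<^bsub>M\<^esub> t i)"

context cring
begin

lemma free_module: "module R (free_module R n)"
proof (rule moduleI)
  show "abelian_group (free_module R n)"
  proof (rule abelian_groupI)
    fix x assume "x \<in> carrier (free_module R n)"
    then show "\<exists>y\<in>carrier (free_module R n). y \<oplus>\<^bsub>free_module R n\<^esub> x = \<zero>\<^bsub>free_module R n\<^esub>"
      by (intro bexI[of _ "\<lambda>i. \<ominus> x i"]) (auto simp: l_neg)
  qed (auto simp: a_ac)
qed (auto simp: is_cring l_distr r_distr m_assoc)

lemma free_module_neg:
  assumes "u \<in> carrier (free_module R n)" shows "\<ominus>\<^bsub>free_module R n\<^esub> u = (\<lambda>i. \<ominus> u i)"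
proof -
  interpret F: module R "free_module R n" by (rule free_module)
  show ?thesis using assms by (intro F.minus_equality) (auto simp: l_neg)
qed

lemma free_module_finsum:
  assumes "\<And>j. j \<in> I \<Longrightarrow> f j \<in> carrier (free_module R n)"
  shows "(\<Oplus>\<^bsub>free_module R n\<^esub>j\<in>I. f j) i = (\<Oplus>j\<in>I. f j i)"
proof -
  interpret F: module R "free_module R n" by (rule free_module)
  show ?thesis using assms
  proof (induction I rule: infinite_finite_induct)
    case (insert j I)
    then have "f \<in> I \<rightarrow> carrier (free_module R n)" "f j \<in> carrier (free_module R n)" by blast+
    moreover have "(\<lambda>j. f j i) \<in> I \<rightarrow> carrier R" "f j i \<in> carrier R" using insert.prems by auto
    ultimately show ?case using insert by (simp del: free_module_simps(1) add: F.finsum_insert)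
  qed (simp_all add: F.finsum_infinite finsum_infinite)
qed

lemma unit_vec_closed: "i < n \<Longrightarrow> unit_vec R i \<in> carrier (free_module R n)"
  by (simp add: unit_vec_def)

lemma unit_vec_expansion:
  assumes u: "u \<in> carrier (free_module R n)"
  shows "u = (\<Oplus>\<^bsub>free_module R n\<^esub>i\<in>{..<n}. u i \<odot>\<^bsub>free_module R n\<^esub> unit_vec R i)" (is "u = ?s")
proof
  fix j
  have "?s j = (\<Oplus>i\<in>{..<n}. (u i \<odot>\<^bsub>free_module R n\<^esub> unit_vec R i) j)"
    using u by (intro free_module_finsum) (auto simp: unit_vec_def)
  also have "\<dots> = (\<Oplus>i\<in>{..<n}. if j = i then u i else \<zero>)"
    using u by (intro finsum_cong') (auto simp: unit_vec_def)
  also have "\<dots> = u j"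
  proof (cases "j < n")
    case True
    then show ?thesis using u by (intro finsum_singleton) auto
  next
    case False
    then have "(\<Oplus>i\<in>{..<n}. if j = i then u i else \<zero>) = (\<Oplus>i\<in>{..<n}. \<zero>)"
      by (intro finsum_cong') auto
    then show ?thesis using False u by simp
  qed
  finally show "u j = ?s j" by simp
qed

lemma unit_vec_inj: "\<one> \<noteq> \<zero> \<Longrightarrow> inj (unit_vec R)"
  by (rule injI) (metis unit_vec_def)

lemma unit_vec_basis:
  assumes ne: "\<one> \<noteq> \<zero>"
  shows "is_basis R (free_module R n) (unit_vec R ` {..<n})"
proof -
  interpret F: module R "free_module R n" by (rule free_module)
  have inj: "inj (unit_vec R)" by (rule unit_vec_inj[OF ne])
  define \<kappa> where "\<kappa> b x = x (inv_into UNIV (unit_vec R) b)" for b and x :: "nat \<Rightarrow> 'a"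
  have \<kappa>: "\<kappa> (unit_vec R i) x = x i" for i x by (simp add: \<kappa>_def inv_f_f[OF inj])
  have \<kappa>_cl: "\<kappa> b x \<in> carrier R" if "x \<in> carrier (free_module R n)" for b x
    using that by (simp add: \<kappa>_def)
  show ?thesis
  proof (rule is_basisI[where \<kappa> = \<kappa>])
    show "\<kappa> b b' = (if b = b' then \<one> else \<zero>)"
      if "b \<in> unit_vec R ` {..<n}" "b' \<in> unit_vec R ` {..<n}" for b b'
      using that by (auto simp: \<kappa> inj_eq[OF inj]) (auto simp: unit_vec_def)
    show "x = (\<Oplus>\<^bsub>free_module R n\<^esub>b\<in>unit_vec R ` {..<n}. \<kappa> b x \<odot>\<^bsub>free_module R n\<^esub> b)"
      if x: "x \<in> carrier (free_module R n)" for x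
    proof -
      have "(\<Oplus>\<^bsub>free_module R n\<^esub>b\<in>unit_vec R ` {..<n}. \<kappa> b x \<odot>\<^bsub>free_module R n\<^esub> b)
        = (\<Oplus>\<^bsub>free_module R n\<^esub>i\<in>{..<n}. \<kappa> (unit_vec R i) x \<odot>\<^bsub>free_module R n\<^esub> unit_vec R i)"
      proof (rule F.finsum_reindex)
        show "inj_on (unit_vec R) {..<n}" by (rule inj_on_subset[OF inj]) simp
        show "(\<lambda>b. \<kappa> b x \<odot>\<^bsub>free_module R n\<^esub> b) \<in> unit_vec R ` {..<n} \<rightarrow> carrier (free_module R n)"
          using \<kappa>_cl[OF x] by (auto intro!: F.smult_closed unit_vec_closed simp del: free_module_simps)
      qed
      also have "\<dots> = x" using unit_vec_expansion[OF x] by (simp only: \<kappa>)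
      finally show ?thesis by simp
    qed
    show "unit_vec R ` {..<n} \<subseteq> carrier (free_module R n)"
      using unit_vec_closed by (auto simp del: free_module_simps)
  qed (auto simp: F.module_axioms \<kappa>)
qed

lemma free_module_ideal_smult:
  assumes "ideal I R" and u: "u \<in> carrier (free_module R n)" and uI: "\<And>i. i < n \<Longrightarrow> u i \<in> I"
  shows "u \<in> ideal_smult (free_module R n) I (carrier (free_module R n))"
proof -
  interpret F: module R "free_module R n" by (rule free_module)
  have "(\<Oplus>\<^bsub>free_module R n\<^esub>i\<in>{..<n}. u i \<odot>\<^bsub>free_module R n\<^esub> unit_vec R i)
      \<in> ideal_smult (free_module R n) I (carrier (free_module R n))"
    using uI unit_vec_closed
    by (intro F.submodule_finsum F.ideal_smult_submodule F.carrier_is_submodule assms(1))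
      (auto intro!: ideal_smult.smult simp del: free_module_simps)
  then show ?thesis using unit_vec_expansion[OF u] by simp
qed

lemma lin_comb_hom:
  assumes "module R M" and t: "\<And>i. i < n \<Longrightarrow> t i \<in> carrier M"
  shows "lin_comb M n t \<in> module_hom R (free_module R n) M"
proof -
  interpret M: module R M by fact
  show ?thesis
  proof (rule module_homI)
    show "lin_comb M n t u \<in> carrier M" if "u \<in> carrier (free_module R n)" for u
      unfolding lin_comb_def using t that by (intro M.finsum_closed) auto
    show "lin_comb M n t (u \<oplus>\<^bsub>free_module R n\<^esub> v) = lin_comb M n t u \<oplus>\<^bsub>M\<^esub> lin_comb M n t v"
      if "u \<in> carrier (free_module R n)" "v \<in> carrier (free_module R n)" for u v
    proof -
      have "lin_comb M n t (u \<oplus>\<^bsub>free_module R n\<^esub> v) = (\<Oplus>\<^bsub>M\<^esub>i\<in>{..<n}. u i \<odot>\<^bsub>M\<^esub> t i \<oplus>\<^bsub>M\<^esub> v i \<odot>\<^bsub>M\<^esub> t i)"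
        unfolding lin_comb_def using t that by (intro M.finsum_cong') (auto simp: M.smult_l_distr)
      also have "\<dots> = lin_comb M n t u \<oplus>\<^bsub>M\<^esub> lin_comb M n t v"
        unfolding lin_comb_def using t that by (intro M.finsum_addf) auto
      finally show ?thesis .
    qed
    show "lin_comb M n t (a \<odot>\<^bsub>free_module R n\<^esub> u) = a \<odot>\<^bsub>M\<^esub> lin_comb M n t u"
      if "a \<in> carrier R" "u \<in> carrier (free_module R n)" for a u
    proof -
      have "lin_comb M n t (a \<odot>\<^bsub>free_module R n\<^esub> u) = (\<Oplus>\<^bsub>M\<^esub>i\<in>{..<n}. a \<odot>\<^bsub>M\<^esub> (u i \<odot>\<^bsub>M\<^esub> t i))"
        unfolding lin_comb_def using t that by (intro M.finsum_cong') (auto simp: M.smult_assoc1)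
      also have "\<dots> = a \<odot>\<^bsub>M\<^esub> lin_comb M n t u"
        unfolding lin_comb_def using t that by (intro M.finsum_smult_ldistr[symmetric]) auto
      finally show ?thesis .
    qed
  qed
qed

lemma lin_comb_unit_vec:
  assumes "module R M" and t: "\<And>i. i < n \<Longrightarrow> t i \<in> carrier M" and "i < n"
  shows "lin_comb M n t (unit_vec R i) = t i"
proof -
  interpret M: module R M by fact
  have "lin_comb M n t (unit_vec R i) = (\<Oplus>\<^bsub>M\<^esub>j\<in>{..<n}. if i = j then t j else \<zero>\<^bsub>M\<^esub>)"
    unfolding lin_comb_def using t by (intro M.finsum_cong') (auto simp: unit_vec_def)
  also have "\<dots> = t i" using assms(3) t by (intro M.finsum_singleton) auto
  finally show ?thesis .
qed

end


section \<open>Finitely generated submodules\<close>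

text \<open>Generation of a submodule is expressed through all submodules of the ambient module, as in the
  definition of finite generation.\<close>

definition generates :: "('a, 'r) ring_scheme \<Rightarrow> ('a, 'b, 'x) module_scheme \<Rightarrow> 'b set \<Rightarrow> 'b set \<Rightarrow> bool"
  where "generates R M T K \<longleftrightarrow> T \<subseteq> K \<and> (\<forall>H. submodule H R M \<longrightarrow> T \<subseteq> H \<longrightarrow> K \<subseteq> H)"

lemma finitely_generated_iff:
  assumes "module R M"
  shows "finitely_generated R M \<longleftrightarrow> (\<exists>T. finite T \<and> generates R M T (carrier M))"
  unfolding finitely_generated_def generates_def
  using module.submoduleE(1)[OF assms] by (metis subset_antisym subset_refl)

lemma lin_comb_image:
  assumes "module R M" and K: "submodule K R M" and gen: "generates R M (t ` {..<n}) K"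
  shows "lin_comb M n t ` carrier (free_module R n) = K"
proof -
  interpret M: module R M by fact
  have tK: "t i \<in> K" if "i < n" for i using gen that by (auto simp: generates_def)
  have tM: "t i \<in> carrier M" if "i < n" for i using tK[OF that] M.submoduleE(1)[OF K] by blast
  let ?l = "lin_comb M n t"
  have hom: "?l \<in> module_hom R (free_module R n) M" by (rule M.R.lin_comb_hom[OF assms(1) tM])
  show ?thesis
  proof
    show "?l ` carrier (free_module R n) \<subseteq> K"
    proof
      fix x assume "x \<in> ?l ` carrier (free_module R n)"
      then obtain u where u: "u \<in> carrier (free_module R n)" "x = ?l u" by (elim imageE)
      show "x \<in> K"
        unfolding u(2) lin_comb_def
        using u(1) tK M.submoduleE(4)[OF K] by (intro M.submodule_finsum[OF K]) auto
    qed
    have "t ` {..<n} \<subseteq> ?l ` carrier (free_module R n)"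
    proof
      fix x assume "x \<in> t ` {..<n}"
      then obtain i where i: "i < n" "x = t i" by blast
      then have "x = ?l (unit_vec R i)" using M.R.lin_comb_unit_vec[OF assms(1) tM] by simp
      then show "x \<in> ?l ` carrier (free_module R n)" using M.R.unit_vec_closed[OF i(1)] by (rule image_eqI)
    qed
    moreover have "submodule (?l ` carrier (free_module R n)) R M"
      by (rule submodule_image[OF M.R.free_module assms(1) hom module.carrier_is_submodule[OF M.R.free_module]])
    ultimately show "K \<subseteq> ?l ` carrier (free_module R n)" using gen by (simp add: generates_def)
  qed
qed

lemma (in cring) free_module_Suc_submodule:
  assumes "submodule H R (free_module R (Suc n))"
  shows "submodule {u \<in> H. u n = \<zero>} R (free_module R n)"
proof -
  interpret F: module R "free_module R n" by (rule free_module)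
  interpret F': module R "free_module R (Suc n)" by (rule free_module)
  note H = F'.submoduleE[OF assms]
  have H1: "\<And>u i. u \<in> H \<Longrightarrow> u i \<in> carrier R" "\<And>u i. u \<in> H \<Longrightarrow> Suc n \<le> i \<Longrightarrow> u i = \<zero>"
    using H(1) by auto
  have H2: "u i = \<zero>" if "u \<in> H" "u n = \<zero>" "n \<le> i" for u i
    using that H1(2)[of u i] by (cases "i = n") auto
  show ?thesis
  proof (rule F.submoduleI)
    show "{u \<in> H. u n = \<zero>} \<subseteq> carrier (free_module R n)"
      using H1 H2 by auto
    show "\<zero>\<^bsub>free_module R n\<^esub> \<in> {u \<in> H. u n = \<zero>}"
      using F'.submodule_zero[OF assms] by simp
    show "\<ominus>\<^bsub>free_module R n\<^esub> a \<in> {u \<in> H. u n = \<zero>}" if a: "a \<in> {u \<in> H. u n = \<zero>}" for a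
    proof -
      have "a \<in> carrier (free_module R n)" "a \<in> carrier (free_module R (Suc n))"
        using H1 H2 a by auto
      then have "\<ominus>\<^bsub>free_module R n\<^esub> a = \<ominus>\<^bsub>free_module R (Suc n)\<^esub> a" by (simp only: free_module_neg)
      moreover have "(\<ominus>\<^bsub>free_module R (Suc n)\<^esub> a) n = \<zero>"
        using a \<open>a \<in> carrier (free_module R (Suc n))\<close> by (simp only: free_module_neg) simp
      ultimately show ?thesis using H(3)[of a] a by simp
    qed
    show "a \<oplus>\<^bsub>free_module R n\<^esub> b \<in> {u \<in> H. u n = \<zero>}"
      if "a \<in> {u \<in> H. u n = \<zero>}" "b \<in> {u \<in> H. u n = \<zero>}" for a b
      using that H(5)[of a b] by simp
    show "a \<odot>\<^bsub>free_module R n\<^esub> x \<in> {u \<in> H. u n = \<zero>}" if "a \<in> carrier R" "x \<in> {u \<in> H. u n = \<zero>}" for a x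
      using that H(4)[of a x] by simp
  qed
qed

lemma (in cring) free_module_coordinate_ideal:
  assumes "submodule H R (free_module R n)"
  shows "ideal ((\<lambda>u. u i) ` H) R"
proof -
  interpret F: module R "free_module R n" by (rule free_module)
  note H = F.submoduleE[OF assms]
  have H1: "\<And>u i. u \<in> H \<Longrightarrow> u i \<in> carrier R" using H(1) by auto
  have sm: "x \<otimes> a \<in> (\<lambda>u. u i) ` H" if "a \<in> (\<lambda>u. u i) ` H" "x \<in> carrier R" for a x
    using that H(4)[of x] by (auto simp: image_iff intro!: bexI[of _ "\<lambda>i. x \<otimes> _ i"])
  show ?thesis
  proof (rule idealI)
    show "ring R" by (rule ring_axioms)
    show "subgroup ((\<lambda>u. u i) ` H) (add_monoid R)"
    proof (rule add.subgroupI)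
      show "(\<lambda>u. u i) ` H \<subseteq> carrier R" using H1 by auto
      show "(\<lambda>u. u i) ` H \<noteq> {}" using H(2) by auto
      show "\<ominus> a \<in> (\<lambda>u. u i) ` H" if "a \<in> (\<lambda>u. u i) ` H" for a
      proof -
        from that obtain u where u: "u \<in> H" "a = u i" by (elim imageE)
        have "\<ominus>\<^bsub>free_module R n\<^esub> u = (\<lambda>i. \<ominus> u i)" using H(1) u(1) by (intro free_module_neg) auto
        then have "\<ominus> a = (\<ominus>\<^bsub>free_module R n\<^esub> u) i" by (simp add: u(2))
        then show ?thesis using H(3)[OF u(1)] by (rule image_eqI)
      qed
      show "a \<oplus> b \<in> (\<lambda>u. u i) ` H" if ab: "a \<in> (\<lambda>u. u i) ` H" "b \<in> (\<lambda>u. u i) ` H" for a b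
      proof -
        from ab(1) obtain u where u: "u \<in> H" "a = u i" by (elim imageE)
        from ab(2) obtain v where v: "v \<in> H" "b = v i" by (elim imageE)
        have "a \<oplus> b = (u \<oplus>\<^bsub>free_module R n\<^esub> v) i" by (simp add: u(2) v(2))
        then show ?thesis using H(5)[OF u(1) v(1)] by (rule image_eqI)
      qed
    qed
    show "x \<otimes> a \<in> (\<lambda>u. u i) ` H" if "a \<in> (\<lambda>u. u i) ` H" "x \<in> carrier R" for a x
      using sm[OF that] .
    show "a \<otimes> x \<in> (\<lambda>u. u i) ` H" if "a \<in> (\<lambda>u. u i) ` H" "x \<in> carrier R" for a x
      using sm[OF that] that H1 by (auto simp: m_comm)
  qed
qed

text \<open>Hilbert's argument by induction on the rank: the last coordinates of the elements of \<open>K\<close> form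
  an ideal, and the elements with last coordinate zero a submodule of smaller rank.\<close>

lemma noetherian_free_module:
  fixes R (structure)
  assumes "cring R" "noetherian_ring R"
  shows "submodule K R (free_module R n) \<Longrightarrow> \<exists>T. finite T \<and> generates R (free_module R n) T K"
proof (induction n arbitrary: K)
  case 0
  interpret R: cring R by fact
  interpret F: module R "free_module R 0" by (rule R.free_module)
  have "x = (\<lambda>_. \<zero>)" if "x \<in> K" for x
    using F.submoduleE(1)[OF 0] that by (intro ext) auto
  then have "generates R (free_module R 0) {} K"
    using F.submodule_zero unfolding generates_def by fastforce
  then show ?case by blast
next
  case (Suc n)
  interpret R: cring R by fact
  interpret N: noetherian_ring R by fact
  interpret F: module R "free_module R n" by (rule R.free_module)
  interpret F': module R "free_module R (Suc n)" by (rule R.free_module)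
  note K = F'.submoduleE[OF Suc.prems]
  let ?K = "{u \<in> K. u n = \<zero>}" and ?pr = "\<lambda>u. u n"
  obtain T where T: "finite T" "generates R (free_module R n) T ?K"
    using Suc.IH[OF R.free_module_Suc_submodule[OF Suc.prems]] by blast
  from N.finetely_gen[OF R.free_module_coordinate_ideal[OF Suc.prems, of n]]
  obtain A where A: "A \<subseteq> carrier R" "finite A" "?pr ` K = Idl A" by blast
  have "A \<subseteq> ?pr ` K" unfolding A(3) by (rule R.genideal_self[OF A(1)])
  from finite_subset_image[OF A(2) this]
  obtain B where B: "B \<subseteq> K" "finite B" "A = ?pr ` B" by blast
  have "generates R (free_module R (Suc n)) (T \<union> B) K"
    unfolding generates_def
  proof (intro conjI allI impI)
    show "T \<union> B \<subseteq> K" using T(2) B(1) by (auto simp: generates_def)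
    fix H assume H: "submodule H R (free_module R (Suc n))" and TB: "T \<union> B \<subseteq> H"
    note HE = F'.submoduleE[OF H]
    have Hn: "submodule {u \<in> H. u n = \<zero>} R (free_module R n)" by (rule R.free_module_Suc_submodule[OF H])
    have "T \<subseteq> {u \<in> H. u n = \<zero>}" using TB T(2) by (auto simp: generates_def)
    then have KH: "?K \<subseteq> H" using T(2) Hn by (auto simp: generates_def)
    have HK: "submodule (H \<inter> K) R (free_module R (Suc n))"
      using HE K F'.submodule_zero[OF H] F'.submodule_zero[OF Suc.prems]
      by (intro F'.submoduleI) (auto simp del: free_module_simps)
    have "A \<subseteq> ?pr ` (H \<inter> K)" unfolding B(3) using TB B(1) by blast
    then have "Idl A \<subseteq> ?pr ` (H \<inter> K)"
      by (rule R.genideal_minimal[OF R.free_module_coordinate_ideal[OF HK]])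
    then have pr: "?pr ` K \<subseteq> ?pr ` (H \<inter> K)" by (simp only: A(3))
    show "K \<subseteq> H"
    proof
      fix u assume u: "u \<in> K"
      then have "u n \<in> ?pr ` (H \<inter> K)" using pr by blast
      then obtain w where w: "w \<in> H" "w \<in> K" "u n = w n" by (elim imageE) auto
      let ?v = "u \<ominus>\<^bsub>free_module R (Suc n)\<^esub> w"
      have uc: "u \<in> carrier (free_module R (Suc n))" and wc: "w \<in> carrier (free_module R (Suc n))"
        using u w(2) K(1) by blast+
      have "?v \<in> K" by (rule F'.submodule_minus[OF Suc.prems u w(2)])
      moreover have "?v n = \<zero>"
        using wc w(3) unfolding a_minus_def R.free_module_neg[OF wc] by (simp add: R.r_neg)
      ultimately have "?v \<in> H" using KH by blast
      then have "?v \<oplus>\<^bsub>free_module R (Suc n)\<^esub> w \<in> H" using w(1) by (rule HE(5))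
      also have "?v \<oplus>\<^bsub>free_module R (Suc n)\<^esub> w = u"
        by (rule iffD1[OF F'.minus_eq_iff[OF uc wc subsetD[OF K(1) \<open>?v \<in> K\<close>]] refl, symmetric])
      finally show "u \<in> H" .
    qed
  qed
  then show ?case using T(1) B(2) by blast
qed

section \<open>Existence of graded minimal free resolutions\<close>

lemma (in ideal) finsum_in_ideal:
  assumes "\<And>i. i \<in> A \<Longrightarrow> f i \<in> I" shows "(\<Oplus>i\<in>A. f i) \<in> I"
  using assms
proof (induction A rule: infinite_finite_induct)
  case (insert i A)
  then have "f \<in> A \<rightarrow> carrier R" "f i \<in> carrier R" using Icarr by auto
  then show ?case using insert by simp
qed (simp_all add: finsum_infinite)

lemma graded_module_decomposed: "graded_module R Rg M Mg \<Longrightarrow> decomposed_group M Mg"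
  unfolding graded_module_def graded_module_axioms_def module_def
  by (intro decomposed_group.intro decomposed_group_axioms.intro) blast+

text \<open>The grading of the free module of rank one whose generator has degree \<open>s\<close>.\<close>

definition shift_grading :: "('a, 'r) ring_scheme \<Rightarrow> (nat \<Rightarrow> 'a set) \<Rightarrow> int \<Rightarrow> int \<Rightarrow> 'a set"
  where "shift_grading R Rg s q = (if s \<le> q then Rg (nat (q - s)) else {\<zero>\<^bsub>R\<^esub>})"

definition free_grading :: "('a, 'r) ring_scheme \<Rightarrow> (nat \<Rightarrow> 'a set) \<Rightarrow> nat \<Rightarrow> (nat \<Rightarrow> int) \<Rightarrow> int \<Rightarrow> (nat \<Rightarrow> 'a) set"
  where "free_grading R Rg n s q =
    {u \<in> carrier (free_module R n). \<forall>i<n. u i \<in> shift_grading R Rg (s i) q}"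

definition graded_subset :: "('b, 'x) ring_scheme \<Rightarrow> ('i \<Rightarrow> 'b set) \<Rightarrow> 'b set \<Rightarrow> bool"
  where "graded_subset M Mg K \<longleftrightarrow> (\<forall>x\<in>K. \<forall>q. hcomp M Mg q x \<in> K)"

text \<open>A common setting for resolutions: a noetherian graded ring in which \<open>m\<close> contains everything of
  positive degree and in degree \<open>0\<close> everything that is not a unit. A standard graded algebra
  satisfies this with its irrelevant ideal, and a local ring with the grading concentrated in degree \<open>0\<close>.\<close>

locale graded_local_ring = ring_ideal R m + noetherian_ring R
  for R :: "('a, 'r) ring_scheme" (structure) and m :: "'a set" +
  fixes Rg :: "nat \<Rightarrow> 'a set"
  assumes ring_decomp: "decomposition R Rg"
    and ring_graded_mult: "a \<in> Rg i \<Longrightarrow> b \<in> Rg j \<Longrightarrow> a \<otimes> b \<in> Rg (i + j)"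
    and one_degree_0: "\<one> \<in> Rg 0"
    and degree_0_units: "a \<in> Rg 0 \<Longrightarrow> a \<notin> m \<Longrightarrow> a \<in> Units R"
    and positive_degree: "0 < i \<Longrightarrow> Rg i \<subseteq> m"
    and one_not_zero: "\<one> \<noteq> \<zero>"
begin

sublocale Rg: decomposed_group R Rg
  by (intro decomposed_group.intro decomposed_group_axioms.intro ring_decomp abelian_group_axioms)

lemma shift_decomposed: "decomposed_group R (shift_grading R Rg s)"
proof (intro decomposed_group.intro decomposed_group_axioms.intro abelian_group_axioms)
  show "decomposition R (shift_grading R Rg s)"
  proof (rule decomposition_reindex[OF abelian_group_axioms ring_decomp, where \<sigma> = "\<lambda>k. int k + s"])
    show "inj (\<lambda>k. int k + s)" by (rule injI) simp
    show "shift_grading R Rg s (int k + s) = Rg k" for k by (simp add: shift_grading_def)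
    show "shift_grading R Rg s j = {\<zero>}" if "j \<notin> range (\<lambda>k. int k + s)" for j
    proof -
      have "\<not> s \<le> j"
      proof
        assume "s \<le> j"
        then have "j = int (nat (j - s)) + s" by simp
        with that show False by blast
      qed
      then show ?thesis by (simp add: shift_grading_def)
    qed
  qed
qed

lemma shift_mult:
  assumes "a \<in> Rg i" "b \<in> shift_grading R Rg s q"
  shows "a \<otimes> b \<in> shift_grading R Rg s (int i + q)"
proof (cases "s \<le> q")
  case True
  then have "nat (int i + q - s) = i + nat (q - s)" by simp
  then show ?thesis using assms True ring_graded_mult by (auto simp: shift_grading_def)
next
  case False
  then have "a \<otimes> b = \<zero>" using assms Rg.component_closed by (auto simp: shift_grading_def)
  then show ?thesis using Rg.component_zero by (simp add: shift_grading_def)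
qed

lemma shift_smult:
  assumes M: "graded_module R Rg M Mg" and a: "a \<in> shift_grading R Rg s q" and x: "x \<in> Mg s"
  shows "a \<odot>\<^bsub>M\<^esub> x \<in> Mg q"
proof -
  interpret M: graded_module R Rg M Mg by fact
  interpret Mg: decomposed_group M Mg by (rule graded_module_decomposed[OF M])
  show ?thesis
  proof (cases "s \<le> q")
    case True
    then have "a \<in> Rg (nat (q - s))" using a by (simp add: shift_grading_def)
    from M.graded_smult[OF this x] True show ?thesis by simp
  next
    case False
    then have "a \<odot>\<^bsub>M\<^esub> x = \<zero>\<^bsub>M\<^esub>" using a Mg.component_closed[OF x] by (simp add: shift_grading_def)
    then show ?thesis using Mg.component_zero by simp
  qed
qed

lemma free_graded_module: "graded_module R Rg (free_module R n) (free_grading R Rg n s)"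
proof -
  let ?F = "free_module R n" and ?G = "free_grading R Rg n s" and ?S = "\<lambda>i. shift_grading R Rg (s i)"
  interpret F: module R ?F by (rule free_module)
  interpret S: decomposed_group R "?S i" for i by (rule shift_decomposed)
  define c where "c q u = (\<lambda>i. if i < n then hcomp R (?S i) q (u i) else \<zero>)" for q u
  have c_closed: "c q u \<in> carrier ?F" if "u \<in> carrier ?F" for q u
    using that S.hcomp_closed by (auto simp: c_def)
  have "decomposition ?F ?G"
  proof (rule decompositionI[where c = c])
    show "abelian_group ?F" by (rule F.abelian_group_axioms)
    show "subgroup (?G q) (add_monoid ?F)" for q
    proof (rule F.add.subgroupI)
      show "?G q \<subseteq> carrier ?F" by (auto simp: free_grading_def)
      show "?G q \<noteq> {}" using S.component_zero by (auto simp: free_grading_def intro!: exI[of _ "\<lambda>_. \<zero>"])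
      show "\<ominus>\<^bsub>?F\<^esub> u \<in> ?G q" if u: "u \<in> ?G q" for u
      proof -
        have uc: "u \<in> carrier ?F" using u by (simp add: free_grading_def)
        have "\<ominus>\<^bsub>?F\<^esub> u \<in> carrier ?F" using uc by (rule F.a_inv_closed)
        then show ?thesis using u S.component_neg
          unfolding free_module_neg[OF uc] free_grading_def by blast
      qed
      show "u \<oplus>\<^bsub>?F\<^esub> v \<in> ?G q" if "u \<in> ?G q" "v \<in> ?G q" for u v
        using that S.component_add by (auto simp: free_grading_def)
    qed
    fix u assume u: "u \<in> carrier ?F"
    have ui: "u i \<in> carrier R" for i using u by simp
    show fin: "finite {q. c q u \<noteq> \<zero>\<^bsub>?F\<^esub>}"
    proof (rule finite_subset)
      show "{q. c q u \<noteq> \<zero>\<^bsub>?F\<^esub>} \<subseteq> (\<Union>i\<in>{..<n}. {q. hcomp R (?S i) q (u i) \<noteq> \<zero>})"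
        by (auto simp: c_def fun_eq_iff split: if_splits)
      show "finite (\<Union>i\<in>{..<n}. {q. hcomp R (?S i) q (u i) \<noteq> \<zero>})"
        using S.hcomp_finite[OF ui] by blast
    qed
    show "c q u \<in> ?G q" for q
      using c_closed[OF u] S.hcomp_mem[OF ui] by (simp add: free_grading_def c_def)
    show "u = (\<Oplus>\<^bsub>?F\<^esub>q\<in>{q. c q u \<noteq> \<zero>\<^bsub>?F\<^esub>}. c q u)" (is "u = finsum _ _ ?Q")
    proof
      fix i
      have "(\<Oplus>\<^bsub>?F\<^esub>q\<in>?Q. c q u) i = (\<Oplus>q\<in>?Q. c q u i)" by (rule free_module_finsum[OF c_closed[OF u]])
      also have "\<dots> = u i"
      proof (cases "i < n")
        case True
        have "{q. hcomp R (?S i) q (u i) \<noteq> \<zero>} \<subseteq> ?Q"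
        proof
          fix q assume "q \<in> {q. hcomp R (?S i) q (u i) \<noteq> \<zero>}"
          then have "c q u i \<noteq> \<zero>" using True by (simp add: c_def)
          then show "q \<in> ?Q" by auto
        qed
        from S.hcomp_sum[OF ui fin this] show ?thesis using True by (simp add: c_def)
      next
        case False
        then show ?thesis using u by (simp add: c_def)
      qed
      finally show "u i = (\<Oplus>\<^bsub>?F\<^esub>q\<in>?Q. c q u) i" by simp
    qed
  next
    fix f q assume f: "\<And>q. f q \<in> ?G q" and fin: "finite {q. f q \<noteq> \<zero>\<^bsub>?F\<^esub>}" (is "finite ?Q")
    have fc: "f q \<in> carrier ?F" for q using f[of q] by (simp add: free_grading_def)
    show "f q = c q (\<Oplus>\<^bsub>?F\<^esub>q\<in>?Q. f q)" (is "_ = c q ?s")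
    proof
      fix i
      show "f q i = c q ?s i"
      proof (cases "i < n")
        case True
        have "?s i = (\<Oplus>q\<in>?Q. f q i)" by (rule free_module_finsum[OF fc])
        then have "hcomp R (?S i) q (?s i) = (if q \<in> ?Q then f q i else \<zero>)"
          using f True by (intro S.hcomp_unique[OF fin]) (auto simp: free_grading_def)
        also have "\<dots> = f q i" by auto
        finally show ?thesis using True by (simp add: c_def)
      next
        case False
        then show ?thesis using fc[of q] by (simp add: c_def)
      qed
    qed
  qed
  then show ?thesis
    using shift_mult Rg.component_closed
    by (intro graded_module.intro graded_module_axioms.intro F.module_axioms) (auto simp: free_grading_def)
qed

lemma free_decomposed: "decomposed_group (free_module R n) (free_grading R Rg n s)"
  by (rule graded_module_decomposed[OF free_graded_module])

lemma free_hcomp: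
  assumes "u \<in> carrier (free_module R n)" "i < n"
  shows "hcomp (free_module R n) (free_grading R Rg n s) q u i = hcomp R (shift_grading R Rg (s i)) q (u i)"
proof -
  have "hcomp R (shift_grading R Rg (s i)) q ((\<lambda>u. u i) u)
      = (\<lambda>u. u i) (hcomp (free_module R n) (free_grading R Rg n s) q u)"
    by (rule hcomp_hom[OF free_decomposed shift_decomposed _ _ assms(1)])
      (use assms(2) in \<open>auto simp: hom_def free_grading_def\<close>)
  then show ?thesis by simp
qed

lemma unit_vec_homogeneous:
  assumes "i < n" shows "unit_vec R i \<in> free_grading R Rg n s (s i)"
proof -
  interpret S: decomposed_group R "shift_grading R Rg t" for t by (rule shift_decomposed)
  show ?thesis
    using assms S.component_zero one_degree_0 unit_vec_closed[OF assms]
    by (auto simp: free_grading_def unit_vec_def) (simp add: shift_grading_def)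
qed

lemma lin_comb_degree_preserving:
  assumes M: "graded_module R Rg M Mg" and t: "\<And>i. i < n \<Longrightarrow> t i \<in> Mg (s i)"
  shows "degree_preserving (free_grading R Rg n s) Mg (lin_comb M n t)"
proof -
  interpret Mg: decomposed_group M Mg by (rule graded_module_decomposed[OF M])
  have "lin_comb M n t u \<in> Mg q" if "u \<in> free_grading R Rg n s q" for q u
    unfolding lin_comb_def
  proof (rule Mg.component_finsum)
    fix i assume "i \<in> {..<n}"
    then show "u i \<odot>\<^bsub>M\<^esub> t i \<in> Mg q"
      using that t by (intro shift_smult[OF M, of _ "s i"]) (auto simp: free_grading_def)
  qed
  then show ?thesis by (auto simp: degree_preserving_def)
qed

lemma homogeneous_generators:
  assumes M: "graded_module R Rg M Mg" and K: "graded_subset M Mg K" "K \<subseteq> carrier M"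
    and T: "finite T" "generates R M T K"
  shows "\<exists>S. finite S \<and> generates R M S K \<and> S \<subseteq> (\<Union>q. Mg q)"
proof -
  interpret M: graded_module R Rg M Mg by fact
  interpret Mg: decomposed_group M Mg by (rule graded_module_decomposed[OF M])
  let ?supp = "\<lambda>x. {q. hcomp M Mg q x \<noteq> \<zero>\<^bsub>M\<^esub>}"
  let ?S = "\<Union>x\<in>T. (\<lambda>q. hcomp M Mg q x) ` ?supp x"
  have TK: "T \<subseteq> K" using T(2) by (simp add: generates_def)
  then have TM: "x \<in> carrier M" if "x \<in> T" for x using K(2) that by blast
  have "finite ?S" using T(1) Mg.hcomp_finite[OF TM] by blast
  moreover have "?S \<subseteq> (\<Union>q. Mg q)" using Mg.hcomp_mem[OF TM] by blast
  moreover have "generates R M ?S K"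
    unfolding generates_def
  proof (intro conjI allI impI)
    show "?S \<subseteq> K" using K(1) TK unfolding graded_subset_def by blast
    fix H assume H: "submodule H R M" and SH: "?S \<subseteq> H"
    have "T \<subseteq> H"
    proof
      fix x assume x: "x \<in> T"
      have "(\<Oplus>\<^bsub>M\<^esub>q\<in>?supp x. hcomp M Mg q x) \<in> H"
        using SH x by (intro M.submodule_finsum[OF H]) blast
      then show "x \<in> H" using Mg.hcomp_sum_support[OF TM[OF x]] by simp
    qed
    then show "K \<subseteq> H" using T(2) H by (simp add: generates_def)
  qed
  ultimately show ?thesis by blast
qed

text \<open>If a relation among homogeneous generators had a coefficient outside \<open>m\<close>, its component in the
  degree of the corresponding generator would be a relation with a unit coefficient there, and the
  generator could be dropped. Hence homogeneous generating sets of minimal cardinality have all their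
  relations in \<open>m\<close>; this yields the minimality of the resolution.\<close>

lemma minimal_generators_relation:
  assumes M: "graded_module R Rg M Mg"
    and n: "bij_betw t {..<n} S" and S: "generates R M S K"
    and t: "\<And>i. i < n \<Longrightarrow> t i \<in> Mg (s i)"
    and minimal: "\<And>i. i < n \<Longrightarrow> \<not> generates R M (S - {t i}) K"
    and u: "u \<in> carrier (free_module R n)" "lin_comb M n t u = \<zero>\<^bsub>M\<^esub>" and j: "j < n"
  shows "u j \<in> m"
proof (rule ccontr)
  assume uj: "u j \<notin> m"
  interpret M: graded_module R Rg M Mg by fact
  interpret Mg: decomposed_group M Mg by (rule graded_module_decomposed[OF M])
  interpret S: decomposed_group R "shift_grading R Rg (s i)" for i by (rule shift_decomposed)
  interpret F: decomposed_group "free_module R n" "free_grading R Rg n s" by (rule free_decomposed)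
  have tM: "t i \<in> carrier M" if "i < n" for i using Mg.component_closed[OF t[OF that]] .
  note hom = lin_comb_hom[OF M.module_axioms tM]
  \<comment> \<open>the component of the relation in the degree of the generator \<open>t j\<close>; its \<open>j\<close>-th entry has degree \<open>0\<close>\<close>
  define v where "v = hcomp (free_module R n) (free_grading R Rg n s) (s j) u"
  have v: "v \<in> carrier (free_module R n)" unfolding v_def by (rule F.hcomp_closed[OF u(1)])
  then have vi: "v i \<in> carrier R" for i by simp
  have "hcomp M Mg (s j) (lin_comb M n t u) = lin_comb M n t v"
    unfolding v_def using hom lin_comb_degree_preserving[OF M t]
    by (intro hcomp_hom[OF free_decomposed Mg.decomposed_group_axioms _ _ u(1)])
      (auto simp: module_hom_def degree_preserving_def)
  then have rel: "lin_comb M n t v = \<zero>\<^bsub>M\<^esub>"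
    using u(2) Mg.hcomp_homogeneous[OF Mg.component_zero, of "s j" "s j"] by simp
  have comp: "v j = hcomp R (shift_grading R Rg (s j)) (s j) (u j)"
    unfolding v_def by (rule free_hcomp[OF u(1) j])
  have ujc: "u j \<in> carrier R" using u(1) by simp
  have vj0: "v j \<in> Rg 0" unfolding comp using S.hcomp_mem[OF ujc, of j "s j"] by (simp add: shift_grading_def)
  have "v j \<notin> m"
  proof
    assume vm: "v j \<in> m"
    have "hcomp R (shift_grading R Rg (s j)) q (u j) \<in> m" for q
    proof (cases "q = s j")
      case False
      then show ?thesis
        using S.hcomp_mem[OF ujc, of j q] positive_degree[of "nat (q - s j)"]
        by (auto simp: shift_grading_def split: if_splits)
    qed (use vm comp in simp)
    then have "(\<Oplus>q\<in>{q. hcomp R (shift_grading R Rg (s j)) q (u j) \<noteq> \<zero>}.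
        hcomp R (shift_grading R Rg (s j)) q (u j)) \<in> m"
      by (intro finsum_in_ideal)
    then show False using uj S.hcomp_sum_support[OF ujc, of j] by simp
  qed
  then have unit: "v j \<in> Units R" using degree_0_units vj0 by blast
  have "generates R M (S - {t j}) K"
    unfolding generates_def
  proof (intro conjI allI impI)
    show "S - {t j} \<subseteq> K" using S by (auto simp: generates_def)
    fix H assume H: "submodule H R M" and SH: "S - {t j} \<subseteq> H"
    note HE = M.submoduleE[OF H]
    let ?r = "\<Oplus>\<^bsub>M\<^esub>i\<in>{..<n} - {j}. v i \<odot>\<^bsub>M\<^esub> t i"
    have tH: "t i \<in> H" if "i \<in> {..<n} - {j}" for i
    proof -
      have "t i \<in> S" using that n by (auto simp: bij_betw_def)
      moreover have "t i \<noteq> t j" using that n j by (auto simp: bij_betw_def inj_on_def)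
      ultimately show ?thesis using SH by blast
    qed
    have rH: "?r \<in> H" using tH HE(4)[OF vi] by (intro M.submodule_finsum[OF H]) auto
    have rM: "?r \<in> carrier M" using rH HE(1) by blast
    have "{..<n} = insert j ({..<n} - {j})" using j by auto
    then have "lin_comb M n t v = (\<Oplus>\<^bsub>M\<^esub>i\<in>insert j ({..<n} - {j}). v i \<odot>\<^bsub>M\<^esub> t i)"
      by (simp add: lin_comb_def)
    also have "\<dots> = v j \<odot>\<^bsub>M\<^esub> t j \<oplus>\<^bsub>M\<^esub> ?r"
      using j vi tM by (intro M.finsum_insert) auto
    finally have "v j \<odot>\<^bsub>M\<^esub> t j \<oplus>\<^bsub>M\<^esub> ?r = \<zero>\<^bsub>M\<^esub>" using rel by simp
    then have "v j \<odot>\<^bsub>M\<^esub> t j = \<ominus>\<^bsub>M\<^esub> ?r"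
      using rM vi tM[OF j] by (intro M.minus_equality[symmetric]) auto
    then have "v j \<odot>\<^bsub>M\<^esub> t j \<in> H" using HE(3)[OF rH] by simp
    then have "inv (v j) \<odot>\<^bsub>M\<^esub> (v j \<odot>\<^bsub>M\<^esub> t j) \<in> H" by (rule HE(4)[OF Units_inv_closed[OF unit]])
    also have "inv (v j) \<odot>\<^bsub>M\<^esub> (v j \<odot>\<^bsub>M\<^esub> t j) = t j"
      using unit tM[OF j] vi by (subst M.smult_assoc1[symmetric]) auto
    finally have "S \<subseteq> H" using SH by blast
    then show "K \<subseteq> H" using S H by (simp add: generates_def)
  qed
  then show False using minimal[OF j] by blast
qed

lemma minimal_cover:
  assumes M: "graded_module R Rg M Mg" and sub: "submodule K R M" and K: "graded_subset M Mg K"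
    and T: "finite T" "generates R M T K"
  shows "\<exists>n s \<pi>. \<pi> \<in> module_hom R (free_module R n) M \<and> \<pi> ` carrier (free_module R n) = K \<and>
    degree_preserving (free_grading R Rg n s) Mg \<pi> \<and>
    a_kernel (free_module R n) M \<pi> \<subseteq> ideal_smult (free_module R n) m (carrier (free_module R n))"
proof -
  interpret M: graded_module R Rg M Mg by fact
  interpret Mg: decomposed_group M Mg by (rule graded_module_decomposed[OF M])
  let ?good = "\<lambda>S. finite S \<and> generates R M S K \<and> S \<subseteq> (\<Union>q. Mg q)"
  obtain S0 where "?good S0"
    using homogeneous_generators[OF M K M.submoduleE(1)[OF sub] T] by blast
  from ex_has_least_nat[of ?good, OF this, of card]
  obtain S where S: "finite S" "generates R M S K" "S \<subseteq> (\<Union>q. Mg q)"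
    and least: "\<And>S'. ?good S' \<Longrightarrow> card S \<le> card S'" by blast
  define n where "n = card S"
  obtain t where t: "bij_betw t {..<n} S"
    using ex_bij_betw_nat_finite[OF S(1)] unfolding n_def atLeast0LessThan by blast
  have "\<forall>i\<in>{..<n}. \<exists>q. t i \<in> Mg q" using t S(3) by (auto simp: bij_betw_def)
  then obtain s where s: "\<And>i. i < n \<Longrightarrow> t i \<in> Mg (s i)" by (metis lessThan_iff)
  have minimal: "\<not> generates R M (S - {t i}) K" if "i < n" for i
  proof
    assume "generates R M (S - {t i}) K"
    then have "card S \<le> card (S - {t i})" using S by (intro least) auto
    moreover have "t i \<in> S" using that t by (auto simp: bij_betw_def)
    ultimately show False using card_Diff1_less[OF S(1), of "t i"] by linarith
  qed
  have tM: "t i \<in> carrier M" if "i < n" for i using Mg.component_closed[OF s[OF that]] .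
  have "lin_comb M n t \<in> module_hom R (free_module R n) M" by (rule lin_comb_hom[OF M.module_axioms tM])
  moreover have "lin_comb M n t ` carrier (free_module R n) = K"
    using S(2) t by (intro lin_comb_image[OF M.module_axioms sub]) (simp add: bij_betw_def)
  moreover have "degree_preserving (free_grading R Rg n s) Mg (lin_comb M n t)"
    by (rule lin_comb_degree_preserving[OF M s])
  moreover have "a_kernel (free_module R n) M (lin_comb M n t)
      \<subseteq> ideal_smult (free_module R n) m (carrier (free_module R n))"
  proof
    fix u assume "u \<in> a_kernel (free_module R n) M (lin_comb M n t)"
    then have u: "u \<in> carrier (free_module R n)" "lin_comb M n t u = \<zero>\<^bsub>M\<^esub>"
      unfolding a_kernel_def' by blast+
    show "u \<in> ideal_smult (free_module R n) m (carrier (free_module R n))"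
      by (rule free_module_ideal_smult[OF ideal_axioms u(1)
            minimal_generators_relation[OF M t S(2) s minimal u]])
  qed
  ultimately show ?thesis by blast
qed

lemma kernel_graded_submodule:
  assumes M: "graded_module R Rg M Mg" and \<pi>: "\<pi> \<in> module_hom R (free_module R n) M"
    and deg: "degree_preserving (free_grading R Rg n s) Mg \<pi>"
  shows "submodule (a_kernel (free_module R n) M \<pi>) R (free_module R n)"
    and "graded_subset (free_module R n) (free_grading R Rg n s) (a_kernel (free_module R n) M \<pi>)"
proof -
  interpret M: graded_module R Rg M Mg by fact
  interpret Mg: decomposed_group M Mg by (rule graded_module_decomposed[OF M])
  interpret F: decomposed_group "free_module R n" "free_grading R Rg n s" by (rule free_decomposed)
  have "submodule {\<zero>\<^bsub>M\<^esub>} R M" by (rule M.submoduleI) auto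
  from submodule_vimage[OF free_module M.module_axioms \<pi> this]
  show "submodule (a_kernel (free_module R n) M \<pi>) R (free_module R n)"
    by (simp only: a_kernel_def' singleton_iff)
  show "graded_subset (free_module R n) (free_grading R Rg n s) (a_kernel (free_module R n) M \<pi>)"
    unfolding graded_subset_def
  proof (intro ballI allI)
    fix u q assume "u \<in> a_kernel (free_module R n) M \<pi>"
    then have u: "u \<in> carrier (free_module R n)" "\<pi> u = \<zero>\<^bsub>M\<^esub>" unfolding a_kernel_def' by blast+
    have "hcomp M Mg q (\<pi> u) = \<pi> (hcomp (free_module R n) (free_grading R Rg n s) q u)"
      using \<pi> deg by (intro hcomp_hom[OF free_decomposed Mg.decomposed_group_axioms _ _ u(1)])
        (auto simp: module_hom_def degree_preserving_def)
    moreover have "hcomp M Mg q \<zero>\<^bsub>M\<^esub> = \<zero>\<^bsub>M\<^esub>"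
      using Mg.hcomp_homogeneous[OF Mg.component_zero, of q q] by simp
    ultimately show "hcomp (free_module R n) (free_grading R Rg n s) q u \<in> a_kernel (free_module R n) M \<pi>"
      using u F.hcomp_closed[OF u(1)] unfolding a_kernel_def' by simp
  qed
qed

text \<open>Successive covers by minimal homogeneous generators. The state of the recursion consists of the rank
  and the degrees of the current free module and of the kernel \<open>K\<close> that the next differential has to hit;
  the maps are chosen afterwards.\<close>

theorem graded_minimal_resolution_exists:
  assumes M: "graded_module R Rg M Mg" and fg: "finitely_generated R M"
  shows "\<exists>(F :: nat \<Rightarrow> ('a, nat \<Rightarrow> 'a) module) d Fg e. minimal_free_resolution R m M F d e \<and>
    (\<forall>i. graded_module R Rg (F i) (Fg i)) \<and>
    (\<forall>i. \<exists>B. is_basis R (F i) B \<and> B \<subseteq> (\<Union>j. Fg i j)) \<and>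
    (\<forall>i. degree_preserving (Fg (Suc i)) (Fg i) (d i)) \<and> degree_preserving (Fg 0) Mg e"
proof -
  interpret M: graded_module R Rg M Mg by fact
  interpret Mg: decomposed_group M Mg by (rule graded_module_decomposed[OF M])
  let ?F = "free_module R" and ?G = "free_grading R Rg"
  define Good where "Good n s K \<longleftrightarrow> submodule K R (?F n) \<and> graded_subset (?F n) (?G n s) K \<and>
    K \<subseteq> ideal_smult (?F n) m (carrier (?F n))" for n s K
  define Aug where "Aug n s K e \<longleftrightarrow> e \<in> module_hom R (?F n) M \<and> e ` carrier (?F n) = carrier M \<and>
    degree_preserving (?G n s) Mg e \<and> a_kernel (?F n) M e = K" for n s K e
  define Diff where "Diff n s K n' s' K' d \<longleftrightarrow> d \<in> module_hom R (?F n') (?F n) \<and> d ` carrier (?F n') = K \<and>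
    degree_preserving (?G n' s') (?G n s) d \<and> a_kernel (?F n') (?F n) d = K'" for n s K n' s' K' d
  have "\<exists>Z. \<forall>i. (case Z i of (n, s, K) \<Rightarrow> Good n s K \<and> (i = 0 \<longrightarrow> (\<exists>e. Aug n s K e))) \<and>
    (case Z i of (n, s, K) \<Rightarrow> case Z (Suc i) of (n', s', K') \<Rightarrow> \<exists>d. Diff n s K n' s' K' d)"
  proof (rule dependent_nat_choice)
    obtain T where T: "finite T" "generates R M T (carrier M)"
      using fg finitely_generated_iff[OF M.module_axioms] by blast
    have "graded_subset M Mg (carrier M)" using Mg.hcomp_closed by (simp add: graded_subset_def)
    from minimal_cover[OF M M.carrier_is_submodule this T]
    obtain n s e where "e \<in> module_hom R (?F n) M" "e ` carrier (?F n) = carrier M"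
      "degree_preserving (?G n s) Mg e" "a_kernel (?F n) M e \<subseteq> ideal_smult (?F n) m (carrier (?F n))"
      by blast
    then have "Good n s (a_kernel (?F n) M e)" "Aug n s (a_kernel (?F n) M e) e"
      using kernel_graded_submodule[OF M] unfolding Good_def Aug_def by blast+
    then show "\<exists>Z. case Z of (n, s, K) \<Rightarrow> Good n s K \<and> (0 = (0::nat) \<longrightarrow> (\<exists>e. Aug n s K e))"
      by (intro exI[of _ "(n, s, a_kernel (?F n) M e)"]) auto
  next
    fix Z :: "nat \<times> (nat \<Rightarrow> int) \<times> (nat \<Rightarrow> 'a) set" and i :: nat
    assume Z: "case Z of (n, s, K) \<Rightarrow> Good n s K \<and> (i = 0 \<longrightarrow> (\<exists>e. Aug n s K e))"
    obtain n s K where XK: "Z = (n, s, K)" by (cases Z)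
    then have K: "submodule K R (?F n)" "graded_subset (?F n) (?G n s) K" using Z by (auto simp: Good_def)
    obtain T where T: "finite T" "generates R (?F n) T K"
      using noetherian_free_module[OF is_cring noetherian_ring_axioms K(1)] by blast
    from minimal_cover[OF free_graded_module K T]
    obtain n' s' d where d: "d \<in> module_hom R (?F n') (?F n)" "d ` carrier (?F n') = K"
      "degree_preserving (?G n' s') (?G n s) d" "a_kernel (?F n') (?F n) d \<subseteq> ideal_smult (?F n') m (carrier (?F n'))"
      by blast
    let ?K = "a_kernel (?F n') (?F n) d"
    have "Good n' s' ?K" "Diff n s K n' s' ?K d"
      using d kernel_graded_submodule[OF free_graded_module d(1,3)] unfolding Good_def Diff_def by blast+
    then show "\<exists>Y. (case Y of (n, s, K) \<Rightarrow> Good n s K \<and> (Suc i = 0 \<longrightarrow> (\<exists>e. Aug n s K e))) \<and>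
      (case Z of (n, s, K) \<Rightarrow> case Y of (n', s', K') \<Rightarrow> \<exists>d. Diff n s K n' s' K' d)"
      by (intro exI[of _ "(n', s', ?K)"]) (auto simp: XK)
  qed
  then obtain Z where "\<forall>i. (case Z i of (n, s, K) \<Rightarrow> Good n s K \<and> (i = 0 \<longrightarrow> (\<exists>e. Aug n s K e))) \<and>
    (case Z i of (n, s, K) \<Rightarrow> case Z (Suc i) of (n', s', K') \<Rightarrow> \<exists>d. Diff n s K n' s' K' d)" ..
  note Z = conjunct1[OF spec[OF this]] conjunct2[OF spec[OF this]]
  define n where "n i = fst (Z i)" for i
  define s where "s i = fst (snd (Z i))" for i
  define K where "K i = snd (snd (Z i))" for i
  have Xi: "Z i = (n i, s i, K i)" for i by (simp add: n_def s_def K_def)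
  have good: "Good (n i) (s i) (K i)" for i using Z(1)[of i] by (simp add: Xi)
  obtain e where e: "Aug (n 0) (s 0) (K 0) e" using Z(1)[of 0] by (auto simp: Xi)
  have "\<exists>d. Diff (n i) (s i) (K i) (n (Suc i)) (s (Suc i)) (K (Suc i)) d" for i
    using Z(2)[of i] by (simp add: Xi)
  then obtain d where d: "\<And>i. Diff (n i) (s i) (K i) (n (Suc i)) (s (Suc i)) (K (Suc i)) (d i)" by metis
  define F where "F i = ?F (n i)" for i
  define Fg where "Fg i = ?G (n i) (s i)" for i
  have basis: "is_basis R (F i) (unit_vec R ` {..<n i})" for i
    unfolding F_def by (rule unit_vec_basis[OF one_not_zero])
  have "unit_vec R ` {..<n i} \<subseteq> (\<Union>j. Fg i j)" for i
    unfolding Fg_def using unit_vec_homogeneous by blast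
  then have graded_basis: "\<exists>B. is_basis R (F i) B \<and> B \<subseteq> (\<Union>j. Fg i j)" for i
    using basis by blast
  have "minimal_free_resolution R m M F d e"
  proof (rule minimal_free_resolution.intro)
    fix i
    show "module R (F i)" unfolding F_def by (rule free_module)
    show "\<exists>B. is_basis R (F i) B" using basis by blast
    show "d i \<in> module_hom R (F (Suc i)) (F i)" using d[of i] unfolding Diff_def F_def by blast
    show "e \<in> module_hom R (F 0) M" "e ` carrier (F 0) = carrier M" using e unfolding Aug_def F_def by blast+
    show "d 0 ` carrier (F (Suc 0)) = a_kernel (F 0) M e"
      using e d[of 0] unfolding Aug_def Diff_def F_def by blast
    show "d (Suc i) ` carrier (F (Suc (Suc i))) = a_kernel (F (Suc i)) (F i) (d i)"
      using d[of i] d[of "Suc i"] unfolding Diff_def F_def by blast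
    show "d i ` carrier (F (Suc i)) \<subseteq> ideal_smult (F i) m (carrier (F i))"
      using d[of i] good[of i] unfolding Diff_def Good_def F_def by blast
  qed
  moreover have "graded_module R Rg (F i) (Fg i)" for i unfolding F_def Fg_def by (rule free_graded_module)
  moreover have "degree_preserving (Fg (Suc i)) (Fg i) (d i)" for i
    using d[of i] unfolding Diff_def Fg_def by blast
  moreover have "degree_preserving (Fg 0) Mg e" using e unfolding Aug_def Fg_def by blast
  ultimately show ?thesis using graded_basis by blast
qed

end

section \<open>Hilbert's basis theorem for finitely generated subrings\<close>

context cring
begin

text \<open>Ideals of a subring \<open>A\<close> and its noetherian property are formulated for subsets of \<open>R\<close>, so that
  all rings in a chain of adjunctions live inside \<open>R\<close>.\<close>

definition sub_ideal :: "'a set \<Rightarrow> 'a set \<Rightarrow> bool"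
  where "sub_ideal A J \<longleftrightarrow> J \<subseteq> A \<and> \<zero> \<in> J \<and> (\<forall>a\<in>J. \<forall>b\<in>J. a \<oplus> b \<in> J) \<and> (\<forall>a\<in>A. \<forall>b\<in>J. a \<otimes> b \<in> J)"

definition noetherian_subring :: "'a set \<Rightarrow> bool"
  where "noetherian_subring A \<longleftrightarrow> subring A R \<and>
    (\<forall>J. sub_ideal A J \<longrightarrow> (\<exists>T. finite T \<and> T \<subseteq> J \<and> (\<forall>H. sub_ideal A H \<longrightarrow> T \<subseteq> H \<longrightarrow> J \<subseteq> H)))"

text \<open>The polynomial expressions in \<open>x\<close> of degree less than \<open>n\<close>, as elements of \<open>R\<close>. The
  representation need not be unique, so degrees and leading coefficients are only available as
  relations.\<close>

primrec polys :: "'a set \<Rightarrow> 'a \<Rightarrow> nat \<Rightarrow> 'a set"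
  where "polys A x 0 = {\<zero>}"
  | "polys A x (Suc n) = {c \<otimes> x [^] n \<oplus> b | c b. c \<in> A \<and> b \<in> polys A x n}"

definition leading :: "'a set \<Rightarrow> 'a \<Rightarrow> 'a set \<Rightarrow> nat \<Rightarrow> 'a set"
  where "leading A x J n = {c \<in> A. \<exists>b\<in>polys A x n. c \<otimes> x [^] n \<oplus> b \<in> J}"

lemma polys_SucI: "c \<in> A \<Longrightarrow> b \<in> polys A x n \<Longrightarrow> c \<otimes> x [^] n \<oplus> b \<in> polys A x (Suc n)"
  by auto

lemma polys_SucE:
  assumes "y \<in> polys A x (Suc n)"
  obtains c b where "c \<in> A" "b \<in> polys A x n" "y = c \<otimes> x [^] n \<oplus> b"
  using assms by auto

end

locale ring_adjunction = cring R for R :: "('a, 'r) ring_scheme" (structure) +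
  fixes A :: "'a set" and x :: 'a
  assumes A: "subring A R" and x: "x \<in> carrier R"
begin

lemma A_sub: "a \<in> A \<Longrightarrow> a \<in> carrier R"
  using subringE(1)[OF A] by blast

lemmas A_zero = subringE(2)[OF A] and A_one = subringE(3)[OF A] and A_neg = subringE(5)[OF A]
  and A_mult = subringE(6)[OF A] and A_add = subringE(7)[OF A]

lemma polys_closed: "y \<in> polys A x n \<Longrightarrow> y \<in> carrier R"
  by (induction n arbitrary: y) (auto simp: A_sub x)

lemma polys_zero: "\<zero> \<in> polys A x n"
proof (induction n)
  case (Suc n)
  have "\<zero> \<otimes> x [^] n \<oplus> \<zero> \<in> polys A x (Suc n)" by (rule polys_SucI[OF A_zero Suc])
  then show ?case using x by simp
qed simp

lemma polys_Suc: "y \<in> polys A x n \<Longrightarrow> y \<in> polys A x (Suc n)"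
  using polys_SucI[OF A_zero, of y x n] polys_closed[of y n] x by simp

lemma polys_mono: "n \<le> k \<Longrightarrow> y \<in> polys A x n \<Longrightarrow> y \<in> polys A x k"
  by (induction k rule: dec_induct) (auto intro: polys_Suc simp del: polys.simps)

lemma polys_add: "y \<in> polys A x n \<Longrightarrow> z \<in> polys A x n \<Longrightarrow> y \<oplus> z \<in> polys A x n"
proof (induction n arbitrary: y z)
  case (Suc n)
  obtain c b where y: "c \<in> A" "b \<in> polys A x n" "y = c \<otimes> x [^] n \<oplus> b" using Suc.prems(1) by (rule polys_SucE)
  obtain c' b' where z: "c' \<in> A" "b' \<in> polys A x n" "z = c' \<otimes> x [^] n \<oplus> b'" using Suc.prems(2) by (rule polys_SucE)
  have "y \<oplus> z = (c \<oplus> c') \<otimes> x [^] n \<oplus> (b \<oplus> b')"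
    using y z x by (simp add: A_sub polys_closed l_distr a_ac)
  moreover have "(c \<oplus> c') \<otimes> x [^] n \<oplus> (b \<oplus> b') \<in> polys A x (Suc n)"
    by (rule polys_SucI[OF A_add[OF y(1) z(1)] Suc.IH[OF y(2) z(2)]])
  ultimately show ?case by simp
qed simp

lemma polys_smult: "a \<in> A \<Longrightarrow> y \<in> polys A x n \<Longrightarrow> a \<otimes> y \<in> polys A x n"
proof (induction n arbitrary: y)
  case (Suc n)
  obtain c b where y: "c \<in> A" "b \<in> polys A x n" "y = c \<otimes> x [^] n \<oplus> b" using Suc.prems(2) by (rule polys_SucE)
  have "a \<otimes> y = (a \<otimes> c) \<otimes> x [^] n \<oplus> a \<otimes> b"
    using y x Suc.prems(1) by (simp add: A_sub polys_closed r_distr m_assoc)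
  moreover have "(a \<otimes> c) \<otimes> x [^] n \<oplus> a \<otimes> b \<in> polys A x (Suc n)"
    by (rule polys_SucI[OF A_mult[OF Suc.prems(1) y(1)] Suc.IH[OF Suc.prems(1) y(2)]])
  ultimately show ?case by simp
qed (simp add: A_sub)

lemma polys_neg:
  assumes "y \<in> polys A x n" shows "\<ominus> y \<in> polys A x n"
  using polys_smult[OF A_neg[OF A_one] assms] polys_closed[OF assms] by (simp add: l_minus)

lemma polys_shift: "y \<in> polys A x n \<Longrightarrow> x \<otimes> y \<in> polys A x (Suc n)"
proof (induction n arbitrary: y)
  case 0
  then have "x \<otimes> y = \<zero>" using x by simp
  then show ?case using polys_zero by (simp del: polys.simps)
next
  case (Suc n)
  obtain c b where y: "c \<in> A" "b \<in> polys A x n" "y = c \<otimes> x [^] n \<oplus> b" using Suc.prems by (rule polys_SucE)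
  have "x \<otimes> y = c \<otimes> x [^] Suc n \<oplus> x \<otimes> b"
    using y x by (simp add: A_sub polys_closed r_distr m_ac)
  moreover have "c \<otimes> x [^] Suc n \<oplus> x \<otimes> b \<in> polys A x (Suc (Suc n))"
    by (rule polys_SucI[OF y(1) Suc.IH[OF y(2)]])
  ultimately show ?case by (simp del: polys.simps)
qed

lemma polys_shift_pow: "y \<in> polys A x n \<Longrightarrow> x [^] k \<otimes> y \<in> polys A x (n + k)"
proof (induction k)
  case (Suc k)
  have "x [^] Suc k \<otimes> y = x \<otimes> (x [^] k \<otimes> y)"
    using x polys_closed[OF Suc.prems] by (simp add: m_ac)
  then show ?case using polys_shift[OF Suc.IH[OF Suc.prems]] by (simp del: polys.simps)
qed (simp add: polys_closed)

definition adjoined :: "'a set"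
  where "adjoined = (\<Union>n. polys A x n)"

lemma adjoined_polys: "y \<in> adjoined \<longleftrightarrow> (\<exists>n. y \<in> polys A x n)"
  by (simp add: adjoined_def)

lemma adjoined_common:
  assumes "y \<in> adjoined" "z \<in> adjoined"
  obtains n where "y \<in> polys A x n" "z \<in> polys A x n"
proof -
  obtain n k where "y \<in> polys A x n" "z \<in> polys A x k" using assms adjoined_polys by auto
  then show ?thesis using polys_mono[of n "max n k" y] polys_mono[of k "max n k" z] that by simp
qed

lemma adjoined_mult: "y \<in> polys A x n \<Longrightarrow> z \<in> adjoined \<Longrightarrow> y \<otimes> z \<in> adjoined"
proof (induction n arbitrary: y)
  case 0
  obtain k where "z \<in> polys A x k" using 0(2) adjoined_polys by auto
  then have "y \<otimes> z = \<zero>" using 0 by (simp add: polys_closed)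
  then show ?case using polys_zero adjoined_polys by auto
next
  case (Suc n)
  obtain c b where y: "c \<in> A" "b \<in> polys A x n" "y = c \<otimes> x [^] n \<oplus> b" using Suc.prems(1) by (rule polys_SucE)
  obtain k where z: "z \<in> polys A x k" using Suc.prems(2) adjoined_polys by auto
  have "y \<otimes> z = c \<otimes> (x [^] n \<otimes> z) \<oplus> b \<otimes> z"
    using y x z by (simp add: A_sub polys_closed l_distr m_assoc)
  moreover have "c \<otimes> (x [^] n \<otimes> z) \<in> adjoined"
    using polys_smult[OF y(1) polys_shift_pow[OF z]] adjoined_polys by blast
  moreover have "b \<otimes> z \<in> adjoined" by (rule Suc.IH[OF y(2) Suc.prems(2)])
  ultimately show ?case using adjoined_common polys_add adjoined_polys by metis
qed

lemma A_polys: "a \<in> A \<Longrightarrow> a \<in> polys A x (Suc 0)"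
  using polys_SucI[of a A \<zero> x 0] by (simp add: A_sub)

lemma x_polys: "x \<in> polys A x (Suc (Suc 0))"
  using polys_shift[OF A_polys[OF A_one]] x by simp

lemma adjoined_subring: "subring adjoined R"
proof (rule subringI)
  show "adjoined \<subseteq> carrier R" using polys_closed adjoined_polys by auto
  show "\<one> \<in> adjoined" using A_polys[OF A_one] adjoined_polys by blast
  show "\<ominus> h \<in> adjoined" if "h \<in> adjoined" for h using that polys_neg adjoined_polys by blast
  show "h1 \<otimes> h2 \<in> adjoined" if "h1 \<in> adjoined" "h2 \<in> adjoined" for h1 h2
    using that adjoined_mult adjoined_polys by blast
  show "h1 \<oplus> h2 \<in> adjoined" if "h1 \<in> adjoined" "h2 \<in> adjoined" for h1 h2
    using adjoined_common[OF that] polys_add adjoined_polys by metis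
qed

lemma A_adjoined: "A \<subseteq> adjoined" and x_adjoined: "x \<in> adjoined"
  using A_polys x_polys adjoined_polys by blast+

lemma leading_ideal:
  assumes J: "sub_ideal adjoined J" shows "sub_ideal A (leading A x J n)"
  unfolding sub_ideal_def
proof (intro conjI ballI)
  show "leading A x J n \<subseteq> A" by (auto simp: leading_def)
  have "\<zero> \<otimes> x [^] n \<oplus> \<zero> \<in> J" using J x by (simp add: sub_ideal_def)
  then show "\<zero> \<in> leading A x J n" using A_zero polys_zero unfolding leading_def by blast
next
  fix c c' assume "c \<in> leading A x J n" "c' \<in> leading A x J n"
  then obtain b b' where c: "c \<in> A" "b \<in> polys A x n" "c \<otimes> x [^] n \<oplus> b \<in> J"
    and c': "c' \<in> A" "b' \<in> polys A x n" "c' \<otimes> x [^] n \<oplus> b' \<in> J" unfolding leading_def by blast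
  have "(c \<oplus> c') \<otimes> x [^] n \<oplus> (b \<oplus> b') = (c \<otimes> x [^] n \<oplus> b) \<oplus> (c' \<otimes> x [^] n \<oplus> b')"
    using c c' x by (simp add: A_sub polys_closed l_distr a_ac)
  also have "\<dots> \<in> J" using J c(3) c'(3) unfolding sub_ideal_def by blast
  finally show "c \<oplus> c' \<in> leading A x J n"
    using A_add[OF c(1) c'(1)] polys_add[OF c(2) c'(2)] unfolding leading_def by blast
next
  fix a c assume a: "a \<in> A" and "c \<in> leading A x J n"
  then obtain b where c: "c \<in> A" "b \<in> polys A x n" "c \<otimes> x [^] n \<oplus> b \<in> J" unfolding leading_def by blast
  have "(a \<otimes> c) \<otimes> x [^] n \<oplus> a \<otimes> b = a \<otimes> (c \<otimes> x [^] n \<oplus> b)"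
    using c a x by (simp add: A_sub polys_closed r_distr m_assoc)
  also have "\<dots> \<in> J" using J c(3) a A_adjoined unfolding sub_ideal_def by blast
  finally show "a \<otimes> c \<in> leading A x J n"
    using A_mult[OF a c(1)] polys_smult[OF a c(2)] unfolding leading_def by blast
qed

lemma leading_Suc:
  assumes J: "sub_ideal adjoined J" shows "leading A x J n \<subseteq> leading A x J (Suc n)"
proof
  fix c assume "c \<in> leading A x J n"
  then obtain b where c: "c \<in> A" "b \<in> polys A x n" "c \<otimes> x [^] n \<oplus> b \<in> J" unfolding leading_def by blast
  have "c \<otimes> x [^] Suc n \<oplus> x \<otimes> b = x \<otimes> (c \<otimes> x [^] n \<oplus> b)"
    using c x by (simp add: A_sub polys_closed r_distr m_ac)
  also have "\<dots> \<in> J" using J c(3) x_adjoined unfolding sub_ideal_def by blast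
  finally show "c \<in> leading A x J (Suc n)" using c(1) polys_shift[OF c(2)] unfolding leading_def by blast
qed

lemma leading_mono: "sub_ideal adjoined J \<Longrightarrow> n \<le> k \<Longrightarrow> leading A x J n \<subseteq> leading A x J k"
  by (rule lift_Suc_mono_le[of "leading A x J"]) (use leading_Suc in auto)

lemma leading_union_ideal:
  assumes J: "sub_ideal adjoined J" shows "sub_ideal A (\<Union>n. leading A x J n)"
  unfolding sub_ideal_def
proof (intro conjI ballI)
  note L = leading_ideal[OF J, unfolded sub_ideal_def]
  show "(\<Union>n. leading A x J n) \<subseteq> A" "\<zero> \<in> (\<Union>n. leading A x J n)" using L by blast+
  fix a b assume b: "b \<in> (\<Union>n. leading A x J n)"
  then obtain k where k: "b \<in> leading A x J k" by blast
  show "a \<otimes> b \<in> (\<Union>n. leading A x J n)" if "a \<in> A" using that k L by blast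
  show "a \<oplus> b \<in> (\<Union>n. leading A x J n)" if a: "a \<in> (\<Union>n. leading A x J n)"
  proof -
    obtain n where "a \<in> leading A x J n" using a by blast
    then have "a \<in> leading A x J (max n k)" "b \<in> leading A x J (max n k)"
      using k leading_mono[OF J, of n "max n k"] leading_mono[OF J, of k "max n k"] by auto
    then show ?thesis using L by blast
  qed
qed

text \<open>An element of \<open>J\<close> and an element of \<open>H \<inter> J\<close> with the same leading coefficient in the same degree
  differ by an element of \<open>J\<close> of smaller degree; induction on the degree brings it into \<open>H\<close>.\<close>

lemma leading_determines:
  assumes H: "sub_ideal adjoined H" and J: "J \<subseteq> adjoined"
    and minus: "\<And>a b. a \<in> J \<Longrightarrow> b \<in> J \<Longrightarrow> a \<ominus> b \<in> J"
    and L: "\<And>n. leading A x J n \<subseteq> leading A x (H \<inter> J) n"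
  shows "J \<subseteq> H"
proof -
  have "y \<in> H" if "y \<in> J" "y \<in> polys A x n" for y n
    using that
  proof (induction n arbitrary: y)
    case 0
    then show ?case using H by (simp add: sub_ideal_def)
  next
    case (Suc n)
    obtain c b where y: "c \<in> A" "b \<in> polys A x n" "y = c \<otimes> x [^] n \<oplus> b" using Suc.prems(2) by (rule polys_SucE)
    have "c \<in> leading A x J n" using Suc.prems(1) y unfolding leading_def by blast
    then obtain b' where b': "b' \<in> polys A x n" "c \<otimes> x [^] n \<oplus> b' \<in> H \<inter> J"
      using L[of n] unfolding leading_def by blast
    let ?w = "c \<otimes> x [^] n \<oplus> b'"
    have cl: "c \<otimes> x [^] n \<in> carrier R" "b \<in> carrier R" "b' \<in> carrier R"
      using y b' x by (simp_all add: A_sub polys_closed)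
    have "y \<ominus> ?w = b \<oplus> \<ominus> b'"
      unfolding y(3) using cl by algebra
    moreover have "b \<oplus> \<ominus> b' \<in> polys A x n" by (rule polys_add[OF y(2) polys_neg[OF b'(1)]])
    moreover have "y \<ominus> ?w \<in> J" using minus[OF Suc.prems(1)] b'(2) by blast
    ultimately have "y \<ominus> ?w \<in> H" using Suc.IH by simp
    then have "?w \<oplus> (y \<ominus> ?w) \<in> H" using H b'(2) unfolding sub_ideal_def by blast
    also have "?w \<oplus> (y \<ominus> ?w) = y" unfolding y(3) using cl by algebra
    finally show ?case .
  qed
  then show ?thesis using J adjoined_polys by blast
qed

text \<open>The leading coefficients of an ideal \<open>J\<close> in degree \<open>n\<close> form ideals of \<open>A\<close> that grow with \<open>n\<close>. Their
  union is finitely generated and hence reached in some degree \<open>N\<close>. Lifts to \<open>J\<close> of generators of the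
  leading ideals in degrees at most \<open>N\<close> generate \<open>J\<close>.\<close>

theorem noetherian_adjoined:
  assumes noeth: "noetherian_subring A" shows "noetherian_subring adjoined"
  unfolding noetherian_subring_def
proof (intro conjI allI impI adjoined_subring)
  fix J assume J: "sub_ideal adjoined J"
  have gen: "\<exists>T. finite T \<and> T \<subseteq> K \<and> (\<forall>H. sub_ideal A H \<longrightarrow> T \<subseteq> H \<longrightarrow> K \<subseteq> H)" if "sub_ideal A K" for K
    using noeth that unfolding noetherian_subring_def by blast
  obtain U where U: "finite U" "U \<subseteq> (\<Union>n. leading A x J n)"
    "\<And>H. sub_ideal A H \<Longrightarrow> U \<subseteq> H \<Longrightarrow> (\<Union>n. leading A x J n) \<subseteq> H"
    using gen[OF leading_union_ideal[OF J]] by blast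
  have "\<exists>N. U \<subseteq> leading A x J N"
    using U(1,2)
  proof (induction U)
    case (insert a U)
    then obtain N k where N: "U \<subseteq> leading A x J N" "a \<in> leading A x J k" by blast
    have "leading A x J N \<subseteq> leading A x J (max N k)" "leading A x J k \<subseteq> leading A x J (max N k)"
      by (rule leading_mono[OF J], simp)+
    then have "insert a U \<subseteq> leading A x J (max N k)" using N by blast
    then show ?case ..
  qed simp
  then obtain N where N: "U \<subseteq> leading A x J N" ..
  have "\<forall>n. \<exists>T. finite T \<and> T \<subseteq> leading A x J n \<and> (\<forall>H. sub_ideal A H \<longrightarrow> T \<subseteq> H \<longrightarrow> leading A x J n \<subseteq> H)"
    using gen[OF leading_ideal[OF J]] by blast
  then obtain T where T: "\<And>n. finite (T n)" "\<And>n. T n \<subseteq> leading A x J n"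
    "\<And>n H. sub_ideal A H \<Longrightarrow> T n \<subseteq> H \<Longrightarrow> leading A x J n \<subseteq> H" by metis
  have "\<forall>n. \<forall>c\<in>T n. \<exists>b\<in>polys A x n. c \<otimes> x [^] n \<oplus> b \<in> J" using T(2) unfolding leading_def by blast
  then obtain l where l: "\<And>n c. c \<in> T n \<Longrightarrow> l n c \<in> polys A x n" "\<And>n c. c \<in> T n \<Longrightarrow> c \<otimes> x [^] n \<oplus> l n c \<in> J"
    by metis
  define V where "V = (\<Union>n\<in>{..N}. (\<lambda>c. c \<otimes> x [^] n \<oplus> l n c) ` T n)"
  have "finite V" unfolding V_def using T(1) by blast
  moreover have "V \<subseteq> J" unfolding V_def using l(2) by blast
  moreover have "J \<subseteq> H" if H: "sub_ideal adjoined H" and VH: "V \<subseteq> H" for H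
  proof (rule leading_determines[OF H])
    show "J \<subseteq> adjoined" using J by (simp add: sub_ideal_def)
    show "a \<ominus> b \<in> J" if "a \<in> J" "b \<in> J" for a b
    proof -
      have "b \<in> carrier R" using that(2) J subringE(1)[OF adjoined_subring] unfolding sub_ideal_def by blast
      moreover have "\<ominus> \<one> \<in> adjoined" using A_neg[OF A_one] A_adjoined by blast
      then have "\<ominus> \<one> \<otimes> b \<in> J" using J that(2) unfolding sub_ideal_def by blast
      ultimately have "\<ominus> b \<in> J" by (simp add: l_minus)
      then show ?thesis using J that(1) unfolding sub_ideal_def a_minus_def by blast
    qed
    have HJ: "sub_ideal adjoined (H \<inter> J)" using H J unfolding sub_ideal_def by blast
    have low: "leading A x J n \<subseteq> leading A x (H \<inter> J) n" if "n \<le> N" for n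
    proof (rule T(3)[OF leading_ideal[OF HJ]])
      show "T n \<subseteq> leading A x (H \<inter> J) n"
      proof
        fix c assume c: "c \<in> T n"
        have "c \<otimes> x [^] n \<oplus> l n c \<in> V" unfolding V_def using c that by blast
        then show "c \<in> leading A x (H \<inter> J) n"
          using VH l[OF c] T(2)[of n] c unfolding leading_def by blast
      qed
    qed
    show "leading A x J n \<subseteq> leading A x (H \<inter> J) n" for n
    proof (cases "n \<le> N")
      case False
      have "U \<subseteq> leading A x (H \<inter> J) n"
        using N low[of N] leading_mono[OF HJ, of N n] False by auto
      then show ?thesis using U(3)[OF leading_ideal[OF HJ]] by blast
    qed (rule low)
  qed
  ultimately show "\<exists>T. finite T \<and> T \<subseteq> J \<and> (\<forall>H. sub_ideal adjoined H \<longrightarrow> T \<subseteq> H \<longrightarrow> J \<subseteq> H)" by blast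
qed

end

context cring
begin

lemma noetherian_extension:
  assumes "finite S" "S \<subseteq> carrier R" "noetherian_subring A"
  shows "\<exists>B. noetherian_subring B \<and> A \<union> S \<subseteq> B"
  using assms
proof (induction S)
  case (insert x S)
  then obtain B where B: "noetherian_subring B" "A \<union> S \<subseteq> B" by auto
  have "subring B R" "x \<in> carrier R" using B(1) insert.prems by (simp_all add: noetherian_subring_def)
  then interpret B: ring_adjunction R B x
    by (intro ring_adjunction.intro ring_adjunction_axioms.intro cring_axioms)
  have "A \<union> insert x S \<subseteq> B.adjoined" using B(2) B.A_adjoined B.x_adjoined by blast
  then show ?case using B.noetherian_adjoined[OF B(1)] by blast
qed auto

lemma noetherian_subfield:
  assumes K: "subfield K R" shows "noetherian_subring K"
  unfolding noetherian_subring_def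
proof (intro conjI allI impI)
  show sub: "subring K R" using subfieldE(1)[OF K] .
  fix J assume J: "sub_ideal K J"
  show "\<exists>T. finite T \<and> T \<subseteq> J \<and> (\<forall>H. sub_ideal K H \<longrightarrow> T \<subseteq> H \<longrightarrow> J \<subseteq> H)"
  proof (cases "J = {\<zero>}")
    case True
    then show ?thesis by (intro exI[of _ "{\<zero>}"]) auto
  next
    case False
    then obtain a where a: "a \<in> J" "a \<noteq> \<zero>" using J unfolding sub_ideal_def by blast
    have aK: "a \<in> K" using a(1) J by (auto simp: sub_ideal_def)
    have "J \<subseteq> H" if H: "sub_ideal K H" "{a} \<subseteq> H" for H
    proof
      fix b assume "b \<in> J"
      then have bK: "b \<in> K" using J by (auto simp: sub_ideal_def)
      have inv: "inv a \<in> K" "inv a \<otimes> a = \<one>"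
        using subfield_m_inv[OF K, of a] aK a(2) by auto
      have "b \<otimes> inv a \<in> K" using bK inv(1) subringE(6)[OF sub] by blast
      then have "(b \<otimes> inv a) \<otimes> a \<in> H" using H unfolding sub_ideal_def by blast
      moreover have "(b \<otimes> inv a) \<otimes> a = b"
        using subringE(1)[OF sub] bK aK inv by (simp add: m_assoc subset_iff)
      ultimately show "b \<in> H" by simp
    qed
    then show ?thesis using a(1) by (intro exI[of _ "{a}"]) auto
  qed
qed

lemma noetherian_subring_carrier:
  assumes "noetherian_subring (carrier R)" shows "noetherian_ring R"
proof (rule noetherian_ringI)
  fix I assume "ideal I R"
  interpret I: ideal I R by fact
  have sub: "sub_ideal (carrier R) H" if "ideal H R" for H
    using ideal.Icarr[OF that] ideal.I_l_closed[OF that] additive_subgroup.zero_closed[OF ideal.axioms(1)[OF that]]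
      additive_subgroup.a_closed[OF ideal.axioms(1)[OF that]] by (auto simp: sub_ideal_def)
  obtain T where T: "finite T" "T \<subseteq> I" "\<And>H. sub_ideal (carrier R) H \<Longrightarrow> T \<subseteq> H \<Longrightarrow> I \<subseteq> H"
    using assms sub[OF I.ideal_axioms] unfolding noetherian_subring_def by blast
  have TR: "T \<subseteq> carrier R" using T(2) I.Icarr by blast
  have "I \<subseteq> Idl T" by (rule T(3)[OF sub[OF genideal_ideal[OF TR]] genideal_self[OF TR]])
  moreover have "Idl T \<subseteq> I" by (rule genideal_minimal[OF I.ideal_axioms T(2)])
  ultimately show "\<exists>A\<subseteq>carrier R. finite A \<and> I = Idl A" using T(1) TR by blast
qed

end

lemma (in standard_graded_algebra) noetherian: "noetherian_ring R"
proof -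
  obtain S where S: "finite S" "S \<subseteq> Rg 1" "generate_ring R (Rg 0 \<union> S) = carrier R"
    using standard by blast
  have "subgroup (Rg i) (add_monoid R)" for i using decomp by (simp add: decomposition_def)
  then have Rg: "Rg i \<subseteq> carrier R" for i using subgroup.subset by fastforce
  obtain B where B: "noetherian_subring B" "Rg 0 \<union> S \<subseteq> B"
    using noetherian_extension[OF S(1) _ noetherian_subfield[OF base_field]] S(2) Rg by blast
  have sub: "subring B R" using B(1) by (simp add: noetherian_subring_def)
  have "carrier R \<subseteq> B"
    using generate_ring_min_subring1[of "Rg 0 \<union> S" B] Rg S(2,3) sub B(2) by blast
  then have "B = carrier R" using subringE(1)[OF sub] by blast
  then show ?thesis using B(1) noetherian_subring_carrier by simp
qed

section \<open>The local and the graded case\<close>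

text \<open>A non-unit lies in some proper ideal, and a maximal one among the proper ideals containing it exists
  because unions of chains are members of the chain in a noetherian ring.\<close>

lemma (in noetherian_local_ring) unit_outside_maximal:
  assumes a: "a \<in> carrier R" "a \<notin> m"
  shows "a \<in> Units R"
proof (rule ccontr)
  assume nu: "a \<notin> Units R"
  let ?A = "{I. ideal I R \<and> a \<in> I \<and> \<one> \<notin> I}"
  have "\<exists>I\<in>?A. \<forall>J\<in>?A. I \<subseteq> J \<longrightarrow> J = I"
  proof (rule subset_Zorn_nonempty)
    have "\<one> \<notin> PIdl a"
    proof
      assume "\<one> \<in> PIdl a"
      then obtain b where b: "b \<in> carrier R" "\<one> = b \<otimes> a" by (auto simp: cgenideal_def)
      then have "b \<otimes> a = \<one>" "a \<otimes> b = \<one>" using a(1) by (simp_all add: m_comm)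
      then show False using nu a(1) b(1) unfolding Units_def by blast
    qed
    then have "PIdl a \<in> ?A" using cgenideal_ideal[OF a(1)] cgenideal_self[OF a(1)] by simp
    then show "?A \<noteq> {}" by blast
    fix C assume C: "C \<noteq> {}" "subset.chain ?A C"
    then have "subset.chain {I. ideal I R} C" "C \<subseteq> ?A" unfolding subset.chain_def by auto
    then show "\<Union>C \<in> ?A" using ideal_chain_is_trivial[OF C(1)] by blast
  qed
  then obtain I where I: "ideal I R" "a \<in> I" "\<one> \<notin> I"
    and max: "\<And>J. ideal J R \<Longrightarrow> a \<in> J \<Longrightarrow> \<one> \<notin> J \<Longrightarrow> I \<subseteq> J \<Longrightarrow> J = I" by blast
  have "maximalideal I R"
  proof (rule maximalidealI[OF I(1)])
    show "carrier R \<noteq> I" using I(3) by blast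
    fix J assume J: "ideal J R" "I \<subseteq> J" "J \<subseteq> carrier R"
    show "J = I \<or> J = carrier R"
    proof (cases "\<one> \<in> J")
      case True
      then show ?thesis using ideal.one_imp_carrier[OF J(1)] by simp
    next
      case False
      then show ?thesis using max[OF J(1)] J(2) I(2) by blast
    qed
  qed
  then show False using unique_maximal I(2) a(2) by blast
qed

lemma (in noetherian_local_ring) local_one_not_zero: "\<one> \<noteq> \<zero>"
proof
  assume "\<one> = \<zero>"
  then have "\<one> \<in> m" using additive_subgroup.zero_closed[OF is_additive_subgroup] by simp
  then show False using one_imp_carrier I_notcarr by simp
qed

lemma graded_local_ring_concentrated:
  fixes R (structure)
  assumes "noetherian_local_ring R m"
  shows "graded_local_ring R m (\<lambda>i. if i = 0 then carrier R else {\<zero>})"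
proof -
  interpret noetherian_local_ring R m by fact
  show ?thesis
  proof (intro graded_local_ring.intro graded_local_ring_axioms.intro ring_ideal.intro
      cring_axioms ideal_axioms noetherian_ring_axioms local_one_not_zero)
    show "decomposition R (\<lambda>i. if i = 0 then carrier R else {\<zero>})"
      by (rule decomposition_concentrated[OF abelian_group_axioms])
  qed (use unit_outside_maximal additive_subgroup.zero_closed[OF is_additive_subgroup] in
      \<open>auto split: if_splits\<close>)
qed

lemma graded_module_concentrated:
  assumes "module R M"
  shows "graded_module R (\<lambda>i. if i = 0 then carrier R else {\<zero>\<^bsub>R\<^esub>}) M
    (\<lambda>q. if q = 0 then carrier M else {\<zero>\<^bsub>M\<^esub>})"
proof -
  interpret M: module R M by fact
  show ?thesis
  proof (intro graded_module.intro graded_module_axioms.intro M.module_axioms)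
    show "decomposition M (\<lambda>q. if q = 0 then carrier M else {\<zero>\<^bsub>M\<^esub>})"
      by (rule decomposition_concentrated[OF M.abelian_group_axioms])
  qed (auto split: if_splits)
qed

lemma (in standard_graded_algebra) graded_local_ring_irrelevant:
  "graded_local_ring R (irrelevant_ideal R Rg) Rg"
proof -
  have sub: "subgroup (Rg i) (add_monoid R)" for i using decomp by (simp add: decomposition_def)
  then have Rg: "Rg i \<subseteq> carrier R" for i using subgroup.subset by fastforce
  have gens: "(\<Union>i\<in>{1..}. Rg i) \<subseteq> carrier R" using Rg by blast
  have zero: "\<zero> \<in> irrelevant_ideal R Rg"
    unfolding irrelevant_ideal_def using genideal_ideal[OF gens] ideal.axioms(1) additive_subgroup.zero_closed by blast
  show ?thesis
  proof (intro graded_local_ring.intro graded_local_ring_axioms.intro ring_ideal.intro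
      cring_axioms noetherian decomp graded_mult)
    show "ideal (irrelevant_ideal R Rg) R"
      unfolding irrelevant_ideal_def by (rule genideal_ideal[OF gens])
    show "\<one> \<in> Rg 0" using subringE(3)[OF subfieldE(1)[OF base_field]] .
    show "a \<in> Units R" if a: "a \<in> Rg 0" "a \<notin> irrelevant_ideal R Rg" for a
    proof -
      have "a \<in> Rg 0 - {\<zero>}" using a zero by auto
      from subfield_m_inv[OF base_field this] have "inv a \<in> Rg 0" "a \<otimes> inv a = \<one>" "inv a \<otimes> a = \<one>" by auto
      then show ?thesis using a(1) Rg[of 0] unfolding Units_def by blast
    qed
    show "Rg i \<subseteq> irrelevant_ideal R Rg" if "0 < i" for i
    proof -
      have "Rg i \<subseteq> (\<Union>i\<in>{1..}. Rg i)" using that by force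
      then show ?thesis unfolding irrelevant_ideal_def using genideal_self[OF gens] by blast
    qed
    show "\<one> \<noteq> \<zero>" using subfieldE(6)[OF base_field] by simp
  qed
qed

text \<open>The definition of the linearity defect chooses a resolution; as one exists, the chosen one is a
  resolution as well. That the value does not depend on the choice is the content of the
  comparison of resolutions above.\<close>

lemma ld_resolution:
  fixes R :: "('a, 'r) ring_scheme"
  assumes R: "noetherian_local_ring R m" and M: "module R M" "finitely_generated R M" "nonzero_module M"
  shows "\<exists>(F :: nat \<Rightarrow> ('a, nat \<Rightarrow> 'a) module) d e.
    ideal_resolution R m M F d e \<and> ld R m M = lin_defect R m F d"
proof -
  interpret R: graded_local_ring R m "\<lambda>i. if i = 0 then carrier R else {\<zero>\<^bsub>R\<^esub>}"
    by (rule graded_local_ring_concentrated[OF R])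
  let ?P = "\<lambda>(F :: nat \<Rightarrow> ('a, nat \<Rightarrow> 'a) module, d). \<exists>e. minimal_free_resolution R m M F d e"
  obtain F :: "nat \<Rightarrow> ('a, nat \<Rightarrow> 'a) module" and d e where "minimal_free_resolution R m M F d e"
    using R.graded_minimal_resolution_exists[OF graded_module_concentrated[OF M(1)] M(2)] by blast
  then have "?P (F, d)" by auto
  then have some: "?P (Eps ?P)" by (rule someI)
  obtain F' d' where Fd: "Eps ?P = (F', d')" by (cases "Eps ?P")
  with some obtain e' where "minimal_free_resolution R m M F' d' e'" by auto
  then have "ideal_resolution R m M F' d' e'"
    by (intro ideal_resolution.intro ideal_resolution_axioms.intro R.ring_ideal_axioms M(1))
  moreover have "ld R m M = lin_defect R m F' d'" using M(3) Fd by (simp add: ld_def)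
  ultimately show ?thesis by blast
qed

lemma graded_ld_resolution:
  fixes R :: "('a, 'r) ring_scheme"
  assumes R: "standard_graded_algebra R Rg" and M: "graded_module R Rg M Mg" "finitely_generated R M" "nonzero_module M"
  shows "\<exists>(F :: nat \<Rightarrow> ('a, nat \<Rightarrow> 'a) module) d e.
    ideal_resolution R (irrelevant_ideal R Rg) M F d e \<and>
    graded_ld R Rg M Mg = lin_defect R (irrelevant_ideal R Rg) F d"
proof -
  interpret R: graded_local_ring R "irrelevant_ideal R Rg" Rg
    by (rule standard_graded_algebra.graded_local_ring_irrelevant[OF R])
  let ?P = "\<lambda>(F :: nat \<Rightarrow> ('a, nat \<Rightarrow> 'a) module, d). \<exists>Fg e. graded_minimal_free_resolution R Rg M Mg F Fg d e"
  obtain F :: "nat \<Rightarrow> ('a, nat \<Rightarrow> 'a) module" and d Fg e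
    where "minimal_free_resolution R (irrelevant_ideal R Rg) M F d e"
      "\<forall>i. graded_module R Rg (F i) (Fg i)" "\<forall>i. \<exists>B. is_basis R (F i) B \<and> B \<subseteq> (\<Union>j. Fg i j)"
      "\<forall>i. degree_preserving (Fg (Suc i)) (Fg i) (d i)" "degree_preserving (Fg 0) Mg e"
    using R.graded_minimal_resolution_exists[OF M(1,2)] by blast
  then have "graded_minimal_free_resolution R Rg M Mg F Fg d e"
    by (intro graded_minimal_free_resolution.intro graded_minimal_free_resolution_axioms.intro) blast+
  then have "?P (F, d)" by auto
  then have some: "?P (Eps ?P)" by (rule someI)
  obtain F' d' where Fd: "Eps ?P = (F', d')" by (cases "Eps ?P")
  with some obtain Fg' e' where "graded_minimal_free_resolution R Rg M Mg F' Fg' d' e'" by auto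
  then have "minimal_free_resolution R (irrelevant_ideal R Rg) M F' d' e'"
    by (rule graded_minimal_free_resolution.axioms(1))
  then have "ideal_resolution R (irrelevant_ideal R Rg) M F' d' e'"
    by (intro ideal_resolution.intro ideal_resolution_axioms.intro R.ring_ideal_axioms
        graded_module.axioms(1)[OF M(1)])
  moreover have "graded_ld R Rg M Mg = lin_defect R (irrelevant_ideal R Rg) F' d'"
    using M(3) Fd by (simp add: graded_ld_def)
  ultimately show ?thesis by blast
qed

lemma linearity_defect_conclusions:
  fixes R (structure)
  assumes "\<exists>(F :: nat \<Rightarrow> ('a, nat \<Rightarrow> 'a) module) d e. ideal_resolution R m M F d e \<and> a = lin_defect R m F d"
    and "\<exists>(F :: nat \<Rightarrow> ('a, nat \<Rightarrow> 'a) module) d e. ideal_resolution R m P F d e \<and> 0 = lin_defect R m F d"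
    and "\<exists>(F :: nat \<Rightarrow> ('a, nat \<Rightarrow> 'a) module) d e. ideal_resolution R m N F d e \<and> b = lin_defect R m F d"
    and seq: "short_exact R M P N \<alpha> \<beta>" and ne: "\<one> \<noteq> \<zero>"
    and sub: "\<alpha> ` carrier M \<subseteq> ideal_smult P m (carrier P)"
  shows "ereal_of_enat b - 1 \<le> ereal_of_enat a \<and> ereal_of_enat a \<le> max 0 (ereal_of_enat b - 1) \<and>
    (a \<ge> 1 \<longrightarrow> b = a + 1) \<and> (a = 0 \<longrightarrow> b \<le> 1) \<and>
    (b = 0 \<longleftrightarrow> a = 0 \<and> (\<forall>s. \<alpha> ` carrier M \<inter> ideal_smult P (ideal_power R m (s + 1)) (carrier P)
        = ideal_smult P (ideal_power R m s) (\<alpha> ` carrier M)))"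
proof -
  obtain FM :: "nat \<Rightarrow> ('a, nat \<Rightarrow> 'a) module" and dM eM
    where FM: "ideal_resolution R m M FM dM eM" "a = lin_defect R m FM dM" using assms(1) by blast
  obtain FP :: "nat \<Rightarrow> ('a, nat \<Rightarrow> 'a) module" and dP eP
    where FP: "ideal_resolution R m P FP dP eP" "lin_defect R m FP dP = 0" using assms(2) by metis
  obtain FN :: "nat \<Rightarrow> ('a, nat \<Rightarrow> 'a) module" and dN eN
    where FN: "ideal_resolution R m N FN dN eN" "b = lin_defect R m FN dN" using assms(3) by blast
  have "b \<le> enat (Suc k) \<longleftrightarrow> a \<le> enat k" for k
    unfolding FM(2) FN(2) by (rule lin_defect_quotient_le[OF FM(1) FP(1) FN(1) seq ne FP(2) sub])
  moreover have "b = 0 \<longleftrightarrow> a = 0 \<and> (\<forall>s. \<alpha> ` carrier M \<inter> ideal_smult P (ideal_power R m (s + 1)) (carrier P)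
        = ideal_smult P (ideal_power R m s) (\<alpha> ` carrier M))"
    unfolding FM(2) FN(2) by (rule lin_defect_quotient_zero[OF FM(1) FP(1) FN(1) seq ne FP(2) sub])
  ultimately show ?thesis using enat_shift_consequences[of b a] by blast
qed

theorem theorem3p5:
  fixes R :: "('a, 'r) ring_scheme"
    and M :: "('a, 'b, 'x) module_scheme"
    and P :: "('a, 'c, 'y) module_scheme"
    and N :: "('a, 'd, 'z) module_scheme"
    and \<phi> :: "'b \<Rightarrow> 'c" and \<psi> :: "'c \<Rightarrow> 'd"
  assumes "module R M" "module R P" "module R N"
    and "finitely_generated R M" "finitely_generated R P" "finitely_generated R N"
    and "nonzero_module M" "nonzero_module P" "nonzero_module N"
    and "short_exact R M P N \<phi> \<psi>"
  shows
    "(\<forall>m. noetherian_local_ring R m \<longrightarrow>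
        koszul R m P \<longrightarrow>
        \<phi> ` carrier M \<subseteq> ideal_smult P m (carrier P) \<longrightarrow>
          ereal_of_enat (ld R m N) - 1 \<le> ereal_of_enat (ld R m M) \<and>
          ereal_of_enat (ld R m M) \<le> max 0 (ereal_of_enat (ld R m N) - 1) \<and>
          (ld R m M \<ge> 1 \<longrightarrow> ld R m N = ld R m M + 1) \<and>
          (ld R m M = 0 \<longrightarrow> ld R m N \<le> 1) \<and>
          (ld R m N = 0 \<longleftrightarrow>
             koszul R m M \<and>
             (\<forall>s. \<phi> ` carrier M \<inter> ideal_smult P (ideal_power R m (s + 1)) (carrier P)
                  = ideal_smult P (ideal_power R m s) (\<phi> ` carrier M)))) \<and>
     (\<forall>Rg Mg Pg Ng m. standard_graded_algebra R Rg \<longrightarrow>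
        m = irrelevant_ideal R Rg \<longrightarrow>
        graded_module R Rg M Mg \<longrightarrow> graded_module R Rg P Pg \<longrightarrow> graded_module R Rg N Ng \<longrightarrow>
        degree_preserving Mg Pg \<phi> \<longrightarrow> degree_preserving Pg Ng \<psi> \<longrightarrow>
        graded_koszul R Rg P Pg \<longrightarrow>
        \<phi> ` carrier M \<subseteq> ideal_smult P m (carrier P) \<longrightarrow>
          ereal_of_enat (graded_ld R Rg N Ng) - 1 \<le> ereal_of_enat (graded_ld R Rg M Mg) \<and>
          ereal_of_enat (graded_ld R Rg M Mg) \<le> max 0 (ereal_of_enat (graded_ld R Rg N Ng) - 1) \<and>
          (graded_ld R Rg M Mg \<ge> 1 \<longrightarrow> graded_ld R Rg N Ng = graded_ld R Rg M Mg + 1) \<and>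
          (graded_ld R Rg M Mg = 0 \<longrightarrow> graded_ld R Rg N Ng \<le> 1) \<and>
          (graded_ld R Rg N Ng = 0 \<longleftrightarrow>
             graded_koszul R Rg M Mg \<and>
             (\<forall>s. \<phi> ` carrier M \<inter> ideal_smult P (ideal_power R m (s + 1)) (carrier P)
                  = ideal_smult P (ideal_power R m s) (\<phi> ` carrier M))))"
  unfolding koszul_def graded_koszul_def
proof (rule conjI; (rule allI | rule impI)+)
  fix m assume R: "noetherian_local_ring R m" and P: "ld R m P = 0"
    and sub: "\<phi> ` carrier M \<subseteq> ideal_smult P m (carrier P)"
  show "ereal_of_enat (ld R m N) - 1 \<le> ereal_of_enat (ld R m M) \<and>
      ereal_of_enat (ld R m M) \<le> max 0 (ereal_of_enat (ld R m N) - 1) \<and>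
      (ld R m M \<ge> 1 \<longrightarrow> ld R m N = ld R m M + 1) \<and> (ld R m M = 0 \<longrightarrow> ld R m N \<le> 1) \<and>
      (ld R m N = 0 \<longleftrightarrow> ld R m M = 0 \<and>
         (\<forall>s. \<phi> ` carrier M \<inter> ideal_smult P (ideal_power R m (s + 1)) (carrier P)
              = ideal_smult P (ideal_power R m s) (\<phi> ` carrier M)))"
    by (rule linearity_defect_conclusions[OF ld_resolution[OF R assms(1,4,7)]
          ld_resolution[OF R assms(2,5,8), unfolded P] ld_resolution[OF R assms(3,6,9)] assms(10)
          noetherian_local_ring.local_one_not_zero[OF R] sub])
next
  fix Rg Mg Pg Ng m
  assume R: "standard_graded_algebra R Rg" and m: "m = irrelevant_ideal R Rg"
    and g: "graded_module R Rg M Mg" "graded_module R Rg P Pg" "graded_module R Rg N Ng"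
    and P: "graded_ld R Rg P Pg = 0"
    and sub: "\<phi> ` carrier M \<subseteq> ideal_smult P m (carrier P)"
  have ne: "\<one>\<^bsub>R\<^esub> \<noteq> \<zero>\<^bsub>R\<^esub>"
    using graded_local_ring.one_not_zero[OF standard_graded_algebra.graded_local_ring_irrelevant[OF R]] .
  show "ereal_of_enat (graded_ld R Rg N Ng) - 1 \<le> ereal_of_enat (graded_ld R Rg M Mg) \<and>
      ereal_of_enat (graded_ld R Rg M Mg) \<le> max 0 (ereal_of_enat (graded_ld R Rg N Ng) - 1) \<and>
      (graded_ld R Rg M Mg \<ge> 1 \<longrightarrow> graded_ld R Rg N Ng = graded_ld R Rg M Mg + 1) \<and>
      (graded_ld R Rg M Mg = 0 \<longrightarrow> graded_ld R Rg N Ng \<le> 1) \<and>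
      (graded_ld R Rg N Ng = 0 \<longleftrightarrow> graded_ld R Rg M Mg = 0 \<and>
         (\<forall>s. \<phi> ` carrier M \<inter> ideal_smult P (ideal_power R m (s + 1)) (carrier P)
              = ideal_smult P (ideal_power R m s) (\<phi> ` carrier M)))"
    by (rule linearity_defect_conclusions[OF graded_ld_resolution[OF R g(1) assms(4,7), folded m]
          graded_ld_resolution[OF R g(2) assms(5,8), folded m, unfolded P]
          graded_ld_resolution[OF R g(3) assms(6,9), folded m] assms(10) ne sub])
qed

end
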